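(* Let $n\ge 2$. For the braid group $\mathbf{Br}_n$, generated by the non-repeating braids $R_a$, $a\in\mathbb{S}_n$ (together with $\Omega^{-1}$), the following relations form a Gröbner–Shirshov basis with respect to the order $\preceq$: $$R_aR_b=R_{a\asymp b}\,R_{a\bowtie b}\quad(a,b\in\mathbb{S}_n),$$ $$\Omega^{-1}R_a=\widetilde{R_a}\,\Omega^{-1}\quad(a\in\mathbb{S}_n),$$ $$\Omega\,\Omega^{-1}=\Omega^{-1}\Omega=R_\varepsilon .$$
   Context: Permutations in $\mathbb{S}_n$ are multiplied from left to right: $(\pi_1\pi_2)(i)=\pi_2(\pi_1(i))$; $\varepsilon$ is the identity and $\omega$ is $i\mapsto n+1-i$. For $\pi\in\mathbb{S}_n$ put $R_\pi=\{(i,j): 1\le i<j\le n,\ \pi(i)>\pi(j)\}$. $\mathbf{Br}_n$ is the braid group with generators $\sigma_1,\dots,\sigma_{n-1}$ and the usual relations $\sigma_i\sigma_j=\sigma_j\sigma_i$ ($|i-j|>1$), $\sigma_i\sigma_{i+1}\sigma_i=\sigma_{i+1}\sigma_i\sigma_{i+1}$. A positive braid is non-repeating if any two of its strands cross at most once; $D$ is the set of non-repeating braids. The map sending a non-repeating braid to its permutation is a bijection $D\to\mathbb{S}_n$; the non-repeating braid with permutation $\pi$ is also denoted $R_\pi$, and in it the strands with top positions $i<j$ cross iff $(i,j)\in R_\pi$. The trivial braid $R_\varepsilon$ is identified with the empty word, and $\Omega:=R_\omega$ (Garside's braid). The flip $R\mapsto\widetilde R$ is the automorphism with $\widetilde{\sigma_i}=\sigma_{n-i}$;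 it maps $D$ to $D$. Order $\pi_1\le\pi_2$ iff $R_{\pi_1}\subseteq R_{\pi_2}$; this makes $\mathbb{S}_n$ a lattice with greatest lower bound $\wedge$. Define $$a\asymp b:=a(a^{-1}\wedge b\omega),\qquad a\bowtie b:=(a^{-1}\wedge b\omega)^{-1}b .$$ Order $\preceq$ on $D$: let $|R_\pi|$ be the cardinality of the set $R_\pi$, and list the pairs of $R_\pi$ in increasing lexicographic order; then $R_\pi$ and $R_\tau$ are compared first by $|R_\pi|$, $|R_\tau|$, and, if these are equal, by comparing the lists lexicographically using $1<2<\dots<n$. The order is extended to the letter $\Omega^{-1}$ by making it larger than all letters of $D$, and to words deg-lexicographically (first by the number of letters, then lexicographically from the left). A set of defining relations $u=v$ (with $u$ greater than $v$ in the order; relations with identical sides are ignored) is a Gröbner–Shirshov basis if all compositions (overlap and inclusion ambiguities of the leading words $u$) are resolvable, i.e. the terminating rewriting system $u\to v$ is confluent. The left-hand sides of the relations above are the leading words. *)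

theory Defs
  imports
    "HOL-Algebra.Group"
    "HOL-Algebra.Lattice"
    "HOL-Combinatorics.Permutations"
    "HOL-Library.Confluence"
    "HOL-Library.Product_Lexorder"
begin

section \<open>Words, rewriting and presentations\<close>

text \<open>A relation \<open>u = v\<close> between words over the alphabet \<open>X\<close> is a pair \<open>(u, v)\<close>.\<close>

definition word_step ::
    "'a set \<Rightarrow> ('a list \<times> 'a list) set \<Rightarrow> 'a list \<Rightarrow> 'a list \<Rightarrow> bool" where
  "word_step X S x y \<longleftrightarrow>
     (\<exists>p\<in>lists X. \<exists>q\<in>lists X. \<exists>(u, v)\<in>S. x = p @ u @ q \<and> y = p @ v @ q)"

definition word_cong ::
    "'a set \<Rightarrow> ('a list \<times> 'a list) set \<Rightarrow> ('a list \<times> 'a list) set" where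
  "word_cong X S =
     {(x, y). x \<in> lists X \<and> y \<in> lists X \<and> equivclp (word_step X S) x y}"

definition presented_monoid ::
    "'a set \<Rightarrow> ('a list \<times> 'a list) set \<Rightarrow> 'a list set monoid" where
  "presented_monoid X S =
     \<lparr>carrier = lists X // word_cong X S,
      monoid.mult = (\<lambda>A B. \<Union>x\<in>A. \<Union>y\<in>B. word_cong X S `` {x @ y}),
      monoid.one = word_cong X S `` {[]}\<rparr>"

definition word_prod :: "('a, 'b) monoid_scheme \<Rightarrow> 'a list \<Rightarrow> 'a" where
  "word_prod G w = foldr (monoid.mult G) w \<one>\<^bsub>G\<^esub>"

text \<open>The letters are elements of \<open>G\<close>: they generate \<open>G\<close> as a monoid, and two words over
  them have the same value in \<open>G\<close> iff they are congruent modulo the relations.\<close>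

definition defining_relations ::
    "('a, 'b) monoid_scheme \<Rightarrow> 'a set \<Rightarrow> ('a list \<times> 'a list) set \<Rightarrow> bool" where
  "defining_relations G X S \<longleftrightarrow>
     X \<subseteq> carrier G \<and> S \<subseteq> lists X \<times> lists X \<and>
     word_prod G ` lists X = carrier G \<and>
     (\<forall>u\<in>lists X. \<forall>v\<in>lists X. word_prod G u = word_prod G v \<longleftrightarrow> (u, v) \<in> word_cong X S)"

section \<open>Groebner--Shirshov bases\<close>

definition proper_rules :: "('a list \<times> 'a list) set \<Rightarrow> ('a list \<times> 'a list) set" where
  "proper_rules S = {(u, v)\<in>S. u \<noteq> v}"

definition joinable ::
    "'a set \<Rightarrow> ('a list \<times> 'a list) set \<Rightarrow> 'a list \<Rightarrow> 'a list \<Rightarrow> bool" where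
  "joinable X R x y \<longleftrightarrow> (\<exists>z. (word_step X R)\<^sup>*\<^sup>* x z \<and> (word_step X R)\<^sup>*\<^sup>* y z)"

text \<open>The two kinds of ambiguities: an overlap \<open>p @ q @ r\<close> of the leading words \<open>p @ q\<close> and
  \<open>q @ r\<close>, and a leading word \<open>p @ u @ q\<close> that contains another leading word \<open>u\<close>.\<close>

definition compositions_resolvable ::
    "'a set \<Rightarrow> ('a list \<times> 'a list) set \<Rightarrow> bool" where
  "compositions_resolvable X R \<longleftrightarrow>
     (\<forall>p q r v v'. q \<noteq> [] \<and> (p @ q, v) \<in> R \<and> (q @ r, v') \<in> R
        \<longrightarrow> joinable X R (v @ r) (p @ v')) \<and>
     (\<forall>p q u v v'. (p @ u @ q, v) \<in> R \<and> (u, v') \<in> R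
        \<longrightarrow> joinable X R v (p @ v' @ q))"

text \<open>\<open>lt\<close> is the strict order on words, as a set of pairs (smaller word first).\<close>

definition groebner_shirshov_basis ::
    "('a, 'b) monoid_scheme \<Rightarrow> 'a set \<Rightarrow> ('a list \<times> 'a list) set \<Rightarrow> ('a list \<times> 'a list) set \<Rightarrow> bool"
  where
  "groebner_shirshov_basis G X lt S \<longleftrightarrow>
     defining_relations G X S \<and>
     (\<forall>(u, v)\<in>proper_rules S. (v, u) \<in> lt) \<and>
     compositions_resolvable X (proper_rules S) \<and>
     wfp (word_step X (proper_rules S))\<inverse>\<inverse> \<and>
     confluentp (word_step X (proper_rules S))"

section \<open>Permutations\<close>

text \<open>Permutations are functions on the naturals that fix everything outside \<open>{1..n}\<close>, and
  they are multiplied from left to right.\<close>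

definition pmult :: "(nat \<Rightarrow> nat) \<Rightarrow> (nat \<Rightarrow> nat) \<Rightarrow> nat \<Rightarrow> nat" (infixl "\<cdot>" 75) where
  "a \<cdot> b = b \<circ> a"

abbreviation pinv :: "(nat \<Rightarrow> nat) \<Rightarrow> nat \<Rightarrow> nat" where
  "pinv a \<equiv> Hilbert_Choice.inv a"

definition omega :: "nat \<Rightarrow> nat \<Rightarrow> nat" where
  "omega n i = (if i \<in> {1..n} then n + 1 - i else i)"

definition inversions :: "nat \<Rightarrow> (nat \<Rightarrow> nat) \<Rightarrow> (nat \<times> nat) set" where
  "inversions n a = {(i, j). 1 \<le> i \<and> i < j \<and> j \<le> n \<and> a i > a j}"

definition perm_lattice :: "nat \<Rightarrow> (nat \<Rightarrow> nat) gorder" where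
  "perm_lattice n =
     \<lparr>carrier = {a. a permutes {1..n}}, eq = (=),
      le = (\<lambda>a b. inversions n a \<subseteq> inversions n b)\<rparr>"

definition asymp_op :: "nat \<Rightarrow> (nat \<Rightarrow> nat) \<Rightarrow> (nat \<Rightarrow> nat) \<Rightarrow> nat \<Rightarrow> nat" where
  "asymp_op n a b = a \<cdot> (pinv a \<sqinter>\<^bsub>perm_lattice n\<^esub> (b \<cdot> omega n))"

definition bowtie_op :: "nat \<Rightarrow> (nat \<Rightarrow> nat) \<Rightarrow> (nat \<Rightarrow> nat) \<Rightarrow> nat \<Rightarrow> nat" where
  "bowtie_op n a b = pinv (pinv a \<sqinter>\<^bsub>perm_lattice n\<^esub> (b \<cdot> omega n)) \<cdot> b"

section \<open>The braid group\<close>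

text \<open>The letter \<open>(i, True)\<close> stands for \<open>\<sigma>\<^sub>i\<close> and \<open>(i, False)\<close> for its inverse. The braid
  group on \<open>n\<close> strands consists of the classes of words in these letters.\<close>

type_synonym braid_word = "(nat \<times> bool) list"
type_synonym braid = "braid_word set"

definition braid_letters :: "nat \<Rightarrow> (nat \<times> bool) set" where
  "braid_letters n = {1..<n} \<times> UNIV"

definition braid_relations :: "nat \<Rightarrow> (braid_word \<times> braid_word) set" where
  "braid_relations n =
     {([(i, s), (i, \<not> s)], []) | i s. i \<in> {1..<n}} \<union>
     {([(i, True), (j, True)], [(j, True), (i, True)]) | i j.
        i \<in> {1..<n} \<and> j \<in> {1..<n} \<and> \<bar>int i - int j\<bar> > 1} \<union>
     {([(i, True), (i + 1, True), (i, True)], [(i + 1, True), (i, True), (i + 1, True)]) | i.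
        i \<in> {1..<n} \<and> i + 1 \<in> {1..<n}}"

definition Br :: "nat \<Rightarrow> braid monoid" where
  "Br n = presented_monoid (braid_letters n) (braid_relations n)"

definition braid_of :: "nat \<Rightarrow> braid_word \<Rightarrow> braid" where
  "braid_of n w = word_cong (braid_letters n) (braid_relations n) `` {w}"

text \<open>The strand with top position \<open>i\<close> ends at position \<open>word_perm w i\<close>.\<close>

primrec word_perm :: "braid_word \<Rightarrow> nat \<Rightarrow> nat" where
  "word_perm [] = id"
| "word_perm (x # w) = transpose (fst x) (fst x + 1) \<cdot> word_perm w"

definition braid_perm :: "braid \<Rightarrow> nat \<Rightarrow> nat" where
  "braid_perm B = the_elem (word_perm ` B)"

text \<open>The number of crossings between the strands with top positions \<open>p\<close> and \<open>q\<close>: the \<open>k\<close>-th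
  letter of \<open>w\<close> crosses the strands that occupy positions \<open>i\<close> and \<open>i + 1\<close> after the first
  \<open>k\<close> letters, where \<open>i\<close> is the index of that letter.\<close>

definition crossings :: "braid_word \<Rightarrow> nat \<Rightarrow> nat \<Rightarrow> nat" where
  "crossings w p q =
     card {k. k < length w \<and>
       {word_perm (take k w) p, word_perm (take k w) q} = {fst (w ! k), fst (w ! k) + 1}}"

definition non_repeating_braids :: "nat \<Rightarrow> braid set" where
  "non_repeating_braids n =
     {braid_of n w | w. w \<in> lists ({1..<n} \<times> {True}) \<and>
        (\<forall>p\<in>{1..n}. \<forall>q\<in>{1..n}. p \<noteq> q \<longrightarrow> crossings w p q \<le> 1)}"

definition perm_braid :: "nat \<Rightarrow> (nat \<Rightarrow> nat) \<Rightarrow> braid" where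
  "perm_braid n a = (THE B. B \<in> non_repeating_braids n \<and> braid_perm B = a)"

definition Garside :: "nat \<Rightarrow> braid" where
  "Garside n = perm_braid n (omega n)"

text \<open>Replacing every index \<open>i\<close> by \<open>n - i\<close> is an involution of the set of words and preserves
  the set of relations, so the image of a class is again a class.\<close>

definition flip :: "nat \<Rightarrow> braid \<Rightarrow> braid" where
  "flip n B = map (\<lambda>(i, s). (n - i, s)) ` B"

section \<open>The generators, the order and the relations\<close>

text \<open>The trivial braid is not a letter: it is identified with the empty word.\<close>

definition gens :: "nat \<Rightarrow> braid set" where
  "gens n = (non_repeating_braids n - {\<one>\<^bsub>Br n\<^esub>}) \<union> {inv\<^bsub>Br n\<^esub> (Garside n)}"

definition to_word :: "nat \<Rightarrow> braid \<Rightarrow> braid list" where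
  "to_word n B = (if B = \<one>\<^bsub>Br n\<^esub> then [] else [B])"

definition perm_less :: "nat \<Rightarrow> (nat \<Rightarrow> nat) \<Rightarrow> (nat \<Rightarrow> nat) \<Rightarrow> bool" where
  "perm_less n a b \<longleftrightarrow>
     card (inversions n a) < card (inversions n b) \<or>
     card (inversions n a) = card (inversions n b) \<and>
       (sorted_list_of_set (inversions n a), sorted_list_of_set (inversions n b))
         \<in> lexord {(x, y). x < y}"

definition letter_less :: "nat \<Rightarrow> (braid \<times> braid) set" where
  "letter_less n =
     {(A, B). A \<in> non_repeating_braids n \<and> B \<in> non_repeating_braids n \<and>
        perm_less n (braid_perm A) (braid_perm B)} \<union>
     {(A, B). A \<in> non_repeating_braids n \<and> B = inv\<^bsub>Br n\<^esub> (Garside n)}"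

text \<open>\<open>lenlex\<close> compares words by length first and then lexicographically from the left.\<close>

definition deglex_less :: "nat \<Rightarrow> (braid list \<times> braid list) set" where
  "deglex_less n = lenlex (letter_less n)"

definition GS_relations :: "nat \<Rightarrow> (braid list \<times> braid list) set" where
  "GS_relations n =
     {(to_word n (perm_braid n a) @ to_word n (perm_braid n b),
       to_word n (perm_braid n (asymp_op n a b)) @ to_word n (perm_braid n (bowtie_op n a b)))
      | a b. a permutes {1..n} \<and> b permutes {1..n}} \<union>
     {([inv\<^bsub>Br n\<^esub> (Garside n)] @ to_word n (perm_braid n a),
       to_word n (flip n (perm_braid n a)) @ [inv\<^bsub>Br n\<^esub> (Garside n)])
      | a. a permutes {1..n}} \<union>
     {([Garside n, inv\<^bsub>Br n\<^esub> (Garside n)], to_word n (perm_braid n id)),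
      ([inv\<^bsub>Br n\<^esub> (Garside n), Garside n], to_word n (perm_braid n id))}"

end

theory Submission
  imports Defs
begin

text \<open>Why the relations present the group. Call a product \<open>a \<cdot> b\<close> of permutations reduced if
  no pair of points is inverted twice. Then the non-repeating braids satisfy \<open>R\<^sub>a R\<^sub>b =
  R\<^bsub>a\<cdot>b\<^esub>\<close>. The meet with \<open>b \<cdot> \<omega>\<close> selects the longest suffix \<open>x\<close> of \<open>a\<close> for which \<open>x \<cdot> b\<close> is
  reduced, and the first family of relations moves \<open>x\<close> from the first letter to the second
  one: \<open>a \<asymp> b = a x\<^sup>-\<^sup>1\<close> and \<open>a \<bowtie> b = x b\<close>. So these relations and the relations \<open>R\<^sub>a R\<^sub>b =
  R\<^bsub>a\<cdot>b\<^esub>\<close> for reduced products imply each other. The latter give the braid relations, as two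
  reduced words with the same permutation have the same image, and they hold in the braid
  group, as two such words are equal there (Matsumoto's theorem, \<open>reduced_words_congruent\<close>).

  Why the rewriting terminates. A rule shortens the word, or it replaces a two-letter word
  by one whose first letter has fewer crossings or is no longer \<open>\<Omega>\<^sup>-\<^sup>1\<close>.

  Why it is confluent. No critical pair is inspected. As the rewriting terminates, it is
  enough that congruent irreducible words are equal, and this follows from van der Waerden's
  trick: the letters act from the right on states \<open>(s, m)\<close>, which stand for \<open>R\<^bsub>s\<^sub>1\<^esub> \<dots> R\<^bsub>s\<^sub>k\<^esub>
  \<Omega>\<^sup>-\<^sup>m\<close>, such that all relations hold for the action and an irreducible word takes the
  initial state to the state that spells this word. The letter \<open>R\<^sub>c\<close> is pushed into a
  sequence from the right: the last entry \<open>b\<close> becomes \<open>b \<bowtie> c\<close>, and \<open>b \<asymp> c\<close> is pushed into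
  the remaining sequence. That pushing \<open>b\<close> and then \<open>c\<close> is the same as pushing \<open>b \<cdot> c\<close> for a
  reduced product (\<open>push_pmult\<close>) rests on two properties of the operations: \<open>\<bowtie>\<close> is a right
  action of reduced products (\<open>bowtie_action\<close>), and \<open>\<asymp>\<close> is a cocycle for it
  (\<open>asymp_cocycle\<close>). This is the place where the lattice property enters. The compositions
  are then resolvable because the two sides of a composition are reducts of one word.\<close>

section \<open>Congruences of words and presentations\<close>

lemma word_step_context:
  assumes "word_step X S x y" "p \<in> lists X" "q \<in> lists X"
  shows "word_step X S (p @ x @ q) (p @ y @ q)"
proof -
  obtain p' q' u v where *: "p' \<in> lists X" "q' \<in> lists X" "(u, v) \<in> S" "x = p' @ u @ q'"
      "y = p' @ v @ q'"
    using assms(1) by (auto simp: word_step_def)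
  then have "p @ x @ q = (p @ p') @ u @ (q' @ q)" "p @ y @ q = (p @ p') @ v @ (q' @ q)"
    "p @ p' \<in> lists X" "q' @ q \<in> lists X"
    using assms by auto
  then show ?thesis
    using *(3) unfolding word_step_def by blast
qed

lemma word_stepI:
  assumes "(u, v) \<in> S" "p \<in> lists X" "q \<in> lists X"
  shows "word_step X S (p @ u @ q) (p @ v @ q)"
  using assms unfolding word_step_def by blast

lemma word_stepE:
  assumes "word_step X S x y"
  obtains p q u v where "p \<in> lists X" "q \<in> lists X" "(u, v) \<in> S" "x = p @ u @ q" "y = p @ v @ q"
  using assms unfolding word_step_def by blast

lemma word_cong_context:
  assumes "(x, y) \<in> word_cong X S" "p \<in> lists X" "q \<in> lists X"
  shows "(p @ x @ q, p @ y @ q) \<in> word_cong X S"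
proof -
  have "equivclp (word_step X S) x y"
    using assms(1) by (simp add: word_cong_def)
  then have "equivclp (word_step X S) (p @ x @ q) (p @ y @ q)"
  proof (induction rule: equivclp_induct)
    case base
    show ?case by simp
  next
    case (step y z)
    have "equivclp (word_step X S) (p @ y @ q) (p @ z @ q)"
      using step(2) word_step_context[OF _ assms(2,3)]
      by (metis r_into_equivclp converse_r_into_equivclp)
    with step.IH show ?case
      using equivclp_trans by metis
  qed
  with assms show ?thesis
    by (auto simp: word_cong_def)
qed

lemma word_cong_in_lists:
  assumes "(x, y) \<in> word_cong X S"
  shows "x \<in> lists X" "y \<in> lists X"
  using assms by (auto simp: word_cong_def)

lemma word_cong_refl: "x \<in> lists X \<Longrightarrow> (x, x) \<in> word_cong X S"
  by (auto simp: word_cong_def)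

lemma word_cong_sym: "(x, y) \<in> word_cong X S \<Longrightarrow> (y, x) \<in> word_cong X S"
  by (auto simp: word_cong_def intro: equivclp_sym)

lemma word_cong_trans [trans]:
  "(x, y) \<in> word_cong X S \<Longrightarrow> (y, z) \<in> word_cong X S \<Longrightarrow> (x, z) \<in> word_cong X S"
  by (auto simp: word_cong_def intro: equivclp_trans)

lemma equiv_word_cong: "equiv (lists X) (word_cong X S)"
  by (rule equivI)
     (auto simp: word_cong_in_lists intro!: refl_onI symI transI
        intro: word_cong_refl word_cong_sym word_cong_trans dest: word_cong_in_lists)

lemma word_cong_append:
  assumes "(x, x') \<in> word_cong X S" "(y, y') \<in> word_cong X S"
  shows "(x @ y, x' @ y') \<in> word_cong X S"
proof -
  have "(x @ y, x' @ y) \<in> word_cong X S"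
    using word_cong_context[OF assms(1), of "[]" y] word_cong_in_lists[OF assms(2)] by simp
  also have "(x' @ y, x' @ y') \<in> word_cong X S"
    using word_cong_context[OF assms(2), of x' "[]"] word_cong_in_lists[OF assms(1)] by simp
  finally show ?thesis .
qed

lemma word_cong_rule:
  assumes "(u, v) \<in> S" "u \<in> lists X" "v \<in> lists X"
  shows "(u, v) \<in> word_cong X S"
proof -
  have "word_step X S u v"
    using word_stepI[OF assms(1), of "[]" X "[]"] by simp
  with assms show ?thesis
    by (auto simp: word_cong_def)
qed

text \<open>A function on words that every relation preserves in every context is constant on
  congruence classes. Permutation, exponent sum and product of a word are treated in this
  way.\<close>
lemma word_cong_invariant:
  assumes "(x, y) \<in> word_cong X S"
    and "\<And>p q u v. p \<in> lists X \<Longrightarrow> q \<in> lists X \<Longrightarrow> (u, v) \<in> S \<Longrightarrow> F (p @ u @ q) = F (p @ v @ q)"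
  shows "F x = F y"
proof -
  have "equivclp (word_step X S) x y"
    using assms(1) by (simp add: word_cong_def)
  then show ?thesis
  proof (induction rule: equivclp_induct)
    case (step y z)
    from step(2) have "F y = F z"
      using assms(2) by (metis word_stepE)
    with step.IH show ?case by simp
  qed simp
qed

lemma concat_map_in_lists:
  assumes "\<And>x. x \<in> X \<Longrightarrow> \<phi> x \<in> lists Y" "w \<in> lists X"
  shows "concat (map \<phi> w) \<in> lists Y"
  using assms(2) assms(1) by (induction w) auto

lemma word_cong_morphism:
  assumes "\<And>x. x \<in> X \<Longrightarrow> \<phi> x \<in> lists Y"
    and "\<And>u v. (u, v) \<in> S \<Longrightarrow> (concat (map \<phi> u), concat (map \<phi> v)) \<in> word_cong Y T"
    and "(x, y) \<in> word_cong X S"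
  shows "(concat (map \<phi> x), concat (map \<phi> y)) \<in> word_cong Y T"
proof -
  have "equivclp (word_step X S) x y"
    using assms(3) by (simp add: word_cong_def)
  then show ?thesis
  proof (induction rule: equivclp_induct)
    case base
    show ?case
      using assms by (intro word_cong_refl concat_map_in_lists[of X])
          (auto dest: word_cong_in_lists)
  next
    case (step y z)
    have *: "(concat (map \<phi> y), concat (map \<phi> z)) \<in> word_cong Y T"
      if st: "word_step X S y z" for y z
    proof -
      obtain p q u v where "p \<in> lists X" "q \<in> lists X" "(u, v) \<in> S" "y = p @ u @ q" "z = p @ v @ q"
        using st by (rule word_stepE)
      then show ?thesis
        using word_cong_context[OF assms(2)[of u v]] concat_map_in_lists[of X \<phi> Y] assms(1) by simp
    qed
    from step(2) have "(concat (map \<phi> y), concat (map \<phi> z)) \<in> word_cong Y T"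
      using * word_cong_sym by blast
    with step.IH show ?case by (rule word_cong_trans)
  qed
qed

context
  fixes X :: "'a set" and S :: "('a list \<times> 'a list) set"
begin

abbreviation "cls w \<equiv> word_cong X S `` {w}"

lemma cls_eq_iff:
  assumes "x \<in> lists X" "y \<in> lists X"
  shows "cls x = cls y \<longleftrightarrow> (x, y) \<in> word_cong X S"
  using eq_equiv_class_iff[OF equiv_word_cong] assms by metis

lemma carrier_presented: "carrier (presented_monoid X S) = (\<lambda>w. cls w) ` lists X"
  by (auto simp: presented_monoid_def quotient_def)

lemma one_presented: "\<one>\<^bsub>presented_monoid X S\<^esub> = cls []"
  by (simp add: presented_monoid_def)

lemma mult_presented:
  assumes "x \<in> lists X" "y \<in> lists X"
  shows "cls x \<otimes>\<^bsub>presented_monoid X S\<^esub> cls y = cls (x @ y)"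
proof -
  have "cls (x' @ y') = cls (x @ y)" if "(x, x') \<in> word_cong X S" "(y, y') \<in> word_cong X S" for x'
      y'
    using cls_eq_iff[of "x' @ y'" "x @ y"] word_cong_append[OF that] that word_cong_in_lists
        word_cong_sym
    by (metis append_in_lists_conv)
  then have "(\<Union>x'\<in>cls x. \<Union>y'\<in>cls y. cls (x' @ y')) = (\<Union>x'\<in>cls x. \<Union>y'\<in>cls y. cls (x @ y))"
    by blast
  also have "\<dots> = cls (x @ y)"
    using word_cong_refl[OF assms(1), of S] word_cong_refl[OF assms(2), of S] by blast
  finally show ?thesis
    by (simp add: presented_monoid_def)
qed

lemma monoid_presented: "monoid (presented_monoid X S)"
  by (rule monoidI; unfold carrier_presented one_presented; (elim imageE)?; simp add:
      mult_presented)

lemma word_prod_closed: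
  assumes "monoid G" "set w \<subseteq> carrier G"
  shows "word_prod G w \<in> carrier G"
proof -
  interpret monoid G by fact
  show ?thesis
    using assms(2) by (induction w) (auto simp: word_prod_def)
qed

lemma word_prod_append:
  assumes "monoid G" "set u \<subseteq> carrier G" "set v \<subseteq> carrier G"
  shows "word_prod G (u @ v) = word_prod G u \<otimes>\<^bsub>G\<^esub> word_prod G v"
proof -
  interpret monoid G by fact
  show ?thesis
    using assms(2)
  proof (induction u)
    case Nil
    then show ?case using word_prod_closed[OF assms(1,3)] by (simp add: word_prod_def)
  next
    case (Cons a u)
    have "word_prod G (a # u @ v) = a \<otimes>\<^bsub>G\<^esub> word_prod G (u @ v)"
      by (simp add: word_prod_def)
    also have "\<dots> = a \<otimes>\<^bsub>G\<^esub> word_prod G u \<otimes>\<^bsub>G\<^esub> word_prod G v"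
      using Cons word_prod_closed[OF assms(1,3)] word_prod_closed[OF assms(1), of u]
          by (simp add: m_assoc)
    also have "a \<otimes>\<^bsub>G\<^esub> word_prod G u = word_prod G (a # u)"
      by (simp add: word_prod_def)
    finally show ?case by simp
  qed
qed

lemma word_prod_presented:
  assumes "\<And>B. B \<in> Y \<Longrightarrow> \<rho> B \<in> lists X" "\<And>B. B \<in> Y \<Longrightarrow> cls (\<rho> B) = B" "w \<in> lists Y"
  shows "word_prod (presented_monoid X S) w = cls (concat (map \<rho> w))"
  using assms(3)
proof (induction w)
  case Nil
  show ?case by (simp add: word_prod_def one_presented)
next
  case (Cons B w)
  then have w: "w \<in> lists Y" and B: "B \<in> Y" by auto
  have "word_prod (presented_monoid X S) (B # w) =
      cls (\<rho> B) \<otimes>\<^bsub>presented_monoid X S\<^esub> cls (concat (map \<rho> w))"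
    using Cons.IH assms(2)[OF B] by (simp add: word_prod_def)
  also have "\<dots> = cls (\<rho> B @ concat (map \<rho> w))"
    using assms(1)[OF B] concat_map_in_lists[OF assms(1) w] by (intro mult_presented) auto
  finally show ?case by simp
qed

text \<open>The words \<open>\<rho> B\<close> and \<open>\<phi> x\<close> translate between two alphabets. If \<open>u\<close> and \<open>v\<close> have the
  same product, then their translations to \<open>X\<close> are congruent, hence so are the translations
  of these back to \<open>Y\<close>; and translating there and back does not leave the class of a word,
  because it does so for single letters.\<close>
lemma tietze:
  fixes \<phi> :: "'a \<Rightarrow> 'a list set list" and \<rho> :: "'a list set \<Rightarrow> 'a list"
  defines "G \<equiv> presented_monoid X S"
  assumes S: "S \<subseteq> lists X \<times> lists X"
    and T: "T \<subseteq> lists Y \<times> lists Y"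
    and \<rho>: "\<And>B. B \<in> Y \<Longrightarrow> \<rho> B \<in> lists X" "\<And>B. B \<in> Y \<Longrightarrow> cls (\<rho> B) = B"
    and \<phi>: "\<And>x. x \<in> X \<Longrightarrow> \<phi> x \<in> lists Y" "\<And>x. x \<in> X \<Longrightarrow> word_prod G (\<phi> x) = cls [x]"
    and sound: "\<And>u v. (u, v) \<in> T \<Longrightarrow> word_prod G u = word_prod G v"
    and rels: "\<And>u v. (u, v) \<in> S \<Longrightarrow> (concat (map \<phi> u), concat (map \<phi> v)) \<in> word_cong Y T"
    and gen: "\<And>B. B \<in> Y \<Longrightarrow> ([B], concat (map \<phi> (\<rho> B))) \<in> word_cong Y T"
  shows "defining_relations G Y T"
proof -
  have mon: "monoid G"
    by (simp add: G_def monoid_presented)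
  have YG: "Y \<subseteq> carrier G"
    using \<rho> unfolding G_def carrier_presented by blast
  have setY: "w \<in> lists Y \<Longrightarrow> set w \<subseteq> carrier G" for w
    using YG by (auto simp: in_lists_conv_set)
  have \<rho>s: "concat (map \<rho> w) \<in> lists X" if "w \<in> lists Y" for w
    using concat_map_in_lists[OF \<rho>(1) that] by simp
  have \<phi>s: "concat (map \<phi> w) \<in> lists Y" if "w \<in> lists X" for w
    using concat_map_in_lists[OF \<phi>(1) that] by simp
  have prod: "word_prod G w = cls (concat (map \<rho> w))" if "w \<in> lists Y" for w
    using word_prod_presented[OF \<rho> that] by (simp add: G_def)
  have inv: "word_prod G (concat (map \<phi> w)) = cls w" if "w \<in> lists X" for w
    using that
  proof (induction w)
    case Nil
    show ?case by (simp add: word_prod_def G_def one_presented)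
  next
    case (Cons x w)
    then have x: "x \<in> X" and w: "w \<in> lists X" by auto
    have "word_prod G (concat (map \<phi> (x # w))) = word_prod G (\<phi> x) \<otimes>\<^bsub>G\<^esub> word_prod G (concat (map \<phi>
        w))"
      using word_prod_append[OF mon setY[OF \<phi>(1)[OF x]] setY[OF \<phi>s[OF w]]] by simp
    also have "\<dots> = cls ([x] @ w)"
      using Cons.IH \<phi>(2)[OF x] mult_presented[of "[x]" w] x w by (simp add: G_def)
    finally show ?case by simp
  qed
  have canon: "(w, concat (map \<phi> (concat (map \<rho> w)))) \<in> word_cong Y T" if "w \<in> lists Y" for w
    using that
  proof (induction w)
    case Nil
    show ?case by (simp add: word_cong_refl)
  next
    case (Cons B w)
    then show ?case
      using word_cong_append[OF gen[of B]] by fastforce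
  qed
  have "word_prod G u = word_prod G v \<longleftrightarrow> (u, v) \<in> word_cong Y T" if u: "u \<in> lists Y" and v:
      "v \<in> lists Y" for u v
  proof
    assume "word_prod G u = word_prod G v"
    then have "(concat (map \<rho> u), concat (map \<rho> v)) \<in> word_cong X S"
      using prod[OF u] prod[OF v] cls_eq_iff[OF \<rho>s[OF u] \<rho>s[OF v]] by metis
    then have *: "(concat (map \<phi> (concat (map \<rho> u))), concat (map \<phi> (concat (map \<rho> v)))) \<in>
        word_cong Y T"
      using word_cong_morphism[OF \<phi>(1) rels] by blast
    show "(u, v) \<in> word_cong Y T"
      using canon[OF u] * word_cong_sym[OF canon[OF v]] word_cong_trans by metis
  next
    assume "(u, v) \<in> word_cong Y T"
    then show "word_prod G u = word_prod G v"
    proof (rule word_cong_invariant)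
      fix p q u v assume pq: "p \<in> lists Y" "q \<in> lists Y" and uv: "(u, v) \<in> T"
      have "u \<in> lists Y" "v \<in> lists Y"
        using T uv by auto
      then show "word_prod G (p @ u @ q) = word_prod G (p @ v @ q)"
        using sound[OF uv] pq setY by (simp add: word_prod_append[OF mon])
    qed
  qed
  moreover have "word_prod G ` lists Y = carrier G"
  proof
    show "word_prod G ` lists Y \<subseteq> carrier G"
      using word_prod_closed[OF mon setY] by blast
    show "carrier G \<subseteq> word_prod G ` lists Y"
    proof
      fix B assume "B \<in> carrier G"
      then obtain w where "w \<in> lists X" "B = cls w"
        unfolding G_def carrier_presented by blast
      then show "B \<in> word_prod G ` lists Y"
        using inv[of w] \<phi>s[of w] by (metis imageI)
    qed
  qed
  ultimately show ?thesis
    using YG T unfolding defining_relations_def by blast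
qed

end

section \<open>Inversions and reduced products of permutations\<close>

text \<open>Hiding the interval keeps the simplifier from rewriting it.\<close>
definition perm :: "nat \<Rightarrow> (nat \<Rightarrow> nat) \<Rightarrow> bool" where
  "perm n a \<longleftrightarrow> a permutes {1..n}"

lemma perm_inverses: "perm n a \<Longrightarrow> a (pinv a i) = i" "perm n a \<Longrightarrow> pinv a (a i) = i"
  by (simp_all add: perm_def permutes_inverses)

lemma perm_inj: "perm n a \<Longrightarrow> inj a"
  by (simp add: perm_def permutes_inj)

lemma perm_in_image: "perm n a \<Longrightarrow> a i \<in> {1..n} \<longleftrightarrow> i \<in> {1..n}"
  unfolding perm_def by (rule permutes_in_image)

lemma perm_not_in: "perm n a \<Longrightarrow> i \<notin> {1..n} \<Longrightarrow> a i = i"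
  unfolding perm_def by (rule permutes_not_in)

lemma pinv_pinv: "perm n a \<Longrightarrow> pinv (pinv a) = a"
  unfolding perm_def by (rule permutes_inv_inv)

text \<open>For a permutation the relation is symmetric in the two points, so a pair needs no
  reordering when it is transported along a permutation. This is what makes the rule
  \<open>inverts_pmult\<close> for products free of case distinctions.\<close>
definition inverts :: "(nat \<Rightarrow> nat) \<Rightarrow> nat \<Rightarrow> nat \<Rightarrow> bool" where
  "inverts a p q \<longleftrightarrow> (p < q) \<noteq> (a p < a q)"

text \<open>Products for which lengths add up, see \<open>reduced_prod_iff_inv_count\<close>.\<close>
definition reduced_prod :: "(nat \<Rightarrow> nat) \<Rightarrow> (nat \<Rightarrow> nat) \<Rightarrow> bool" where
  "reduced_prod a b \<longleftrightarrow> (\<forall>p q. \<not> (inverts a p q \<and> inverts b (a p) (a q)))"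

definition weak_le :: "(nat \<Rightarrow> nat) \<Rightarrow> (nat \<Rightarrow> nat) \<Rightarrow> bool" where
  "weak_le a b \<longleftrightarrow> (\<forall>p q. inverts a p q \<longrightarrow> inverts b p q)"

text \<open>Pairs are counted in both orders, so this is twice the Coxeter length.\<close>
definition inv_count :: "(nat \<Rightarrow> nat) \<Rightarrow> nat" where
  "inv_count a = card {(p, q). inverts a p q}"

lemma pmult_apply [simp]: "(a \<cdot> b) i = b (a i)"
  by (simp add: pmult_def)

lemma pmult_assoc: "a \<cdot> b \<cdot> c = a \<cdot> (b \<cdot> c)"
  by (simp add: fun_eq_iff)

lemma pmult_id [simp]: "id \<cdot> a = a" "a \<cdot> id = a"
  by (simp_all add: fun_eq_iff)

lemma perm_pmult [intro]: "perm n a \<Longrightarrow> perm n b \<Longrightarrow> perm n (a \<cdot> b)"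
  by (simp add: perm_def pmult_def permutes_compose)

lemma perm_id [simp, intro]: "perm n id"
  by (simp add: perm_def permutes_id)

lemma perm_pinv [intro]: "perm n a \<Longrightarrow> perm n (pinv a)"
  by (simp add: perm_def permutes_inv)

lemma pmult_pinv:
  assumes "perm n a"
  shows "a \<cdot> pinv a = id" "pinv a \<cdot> a = id"
  using perm_inverses[OF assms] by (simp_all add: fun_eq_iff)

lemma pmult_pinv_cancel:
  assumes "perm n a"
  shows "a \<cdot> (pinv a \<cdot> b) = b" "pinv a \<cdot> (a \<cdot> b) = b" "b \<cdot> a \<cdot> pinv a = b" "b \<cdot> pinv a \<cdot> a = b"
  using perm_inverses[OF assms] by (simp_all add: fun_eq_iff)

lemma pinv_unique:
  assumes "perm n a" "b \<cdot> a = id"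
  shows "pinv a = b"
  using pmult_pinv_cancel(3)[OF assms(1), of b] assms(2) by simp

lemma pinv_pmult:
  assumes "perm n a" "perm n b"
  shows "pinv (a \<cdot> b) = pinv b \<cdot> pinv a"
  using assms by (intro pinv_unique[OF perm_pmult])
      (simp_all add: pmult_assoc pmult_pinv_cancel pmult_pinv)

lemma perm_lt_iff:
  assumes "perm n a" "p \<noteq> q"
  shows "a p < a q \<longleftrightarrow> \<not> a q < a p"
  using assms by (metis inj_eq linorder_neqE_nat not_less_iff_gr_or_eq perm_inj)

lemma inverts_pmult: "inverts (a \<cdot> b) p q \<longleftrightarrow> (inverts a p q \<noteq> inverts b (a p) (a q))"
  by (auto simp: inverts_def)

lemma inverts_id [simp]: "\<not> inverts id p q"
  by (simp add: inverts_def)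

lemma inverts_pinv: "perm n a \<Longrightarrow> inverts (pinv a) (a p) (a q) \<longleftrightarrow> inverts a p q"
  by (auto simp: inverts_def perm_inverses)

lemma inverts_sym:
  assumes "perm n a"
  shows "inverts a p q \<longleftrightarrow> inverts a q p"
  using perm_lt_iff[OF assms, of p q] by (cases "p = q") (auto simp: inverts_def)

lemma inverts_range:
  assumes "perm n a" "inverts a p q"
  shows "p \<in> {1..n}" "q \<in> {1..n}" "p \<noteq> q"
proof -
  have out: "a i = i" if "i \<notin> {1..n}" for i
    using perm_not_in[OF assms(1) that] .
  have inr: "a i \<in> {1..n} \<longleftrightarrow> i \<in> {1..n}" for i
    using perm_in_image[OF assms(1)] .
  show "p \<noteq> q" using assms(2) by (auto simp: inverts_def)
  have keep: "a i < a j \<longleftrightarrow> i < j" if "i \<notin> {1..n} \<or> j \<notin> {1..n}" for i j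
    using out[of i] out[of j] inr[of i] inr[of j] that
    by (cases "i \<in> {1..n}"; cases "j \<in> {1..n}") auto
  show "p \<in> {1..n}" "q \<in> {1..n}"
    using assms(2) keep[of p q] unfolding inverts_def by blast+
qed

lemma finite_inverts: "perm n a \<Longrightarrow> finite {(p, q). inverts a p q}"
  by (rule finite_subset[of _ "{1..n} \<times> {1..n}"]) (use inverts_range in blast, simp)

text \<open>The permutation and its inverse are strictly increasing maps of the naturals, so
  neither of them decreases any number.\<close>
lemma no_inversions_imp_id:
  assumes "perm n a" "\<And>p q. \<not> inverts a p q"
  shows "a = id"
proof -
  have le: "b i \<ge> i" if "\<And>p q. \<not> inverts b p q" for b i
  proof -
    have "strict_mono b"
      using that by (auto simp: strict_mono_def inverts_def)
    then show ?thesis by (rule strict_mono_imp_increasing)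
  qed
  have "\<not> inverts (pinv a) p q" for p q
    using assms(2)[of "pinv a p" "pinv a q"] inverts_pinv[OF perm_pinv[OF assms(1)], of p q]
    by (simp add: pinv_pinv[OF assms(1)])
  then have "pinv a (a i) \<ge> a i" "a i \<ge> i" for i
    using le assms(2) by blast+
  then have "a i = i" for i
    using perm_inverses(2)[OF assms(1), of i] by (metis le_antisym)
  then show ?thesis
    by auto
qed

lemma inv_count_id [simp]: "inv_count id = 0"
  by (simp add: inv_count_def)

lemma inv_count_eq_0:
  assumes a: "perm n a"
  shows "inv_count a = 0 \<longleftrightarrow> a = id"
proof
  assume "inv_count a = 0"
  then have "{(p, q). inverts a p q} = {}"
    unfolding inv_count_def using finite_inverts[OF a] by (metis (no_types, lifting) card_0_eq)
  then show "a = id"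
    by (intro no_inversions_imp_id[OF a]) blast
qed simp

text \<open>The pairs inverted by \<open>a \<cdot> b\<close> form the symmetric difference of those inverted by \<open>a\<close>
  and the preimages of those inverted by \<open>b\<close>.\<close>
lemma inv_count_pmult:
  assumes "perm n a" "perm n b"
  shows "inv_count (a \<cdot> b) + 2 * card {(p, q). inverts a p q \<and> inverts b (a p) (a q)} = inv_count
      a + inv_count b"
proof -
  define A where "A = {(p, q). inverts a p q}"
  define B where "B = {(p, q). inverts b (a p) (a q)}"
  have finA: "finite A"
    unfolding A_def by (rule finite_inverts[OF assms(1)])
  have bij: "bij_betw (map_prod a a) B {(p, q). inverts b p q}"
    using perm_inverses[OF assms(1)]
    by (intro bij_betw_byWitness[where f' = "map_prod (pinv a) (pinv a)"]) (auto simp: B_def)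
  have cardB: "card B = inv_count b"
    unfolding inv_count_def by (rule bij_betw_same_card[OF bij])
  have finB: "finite B"
    using bij finite_inverts[OF assms(2)] bij_betw_finite by blast
  have Un: "{(p, q). inverts (a \<cdot> b) p q} = (A - A \<inter> B) \<union> (B - A \<inter> B)"
    unfolding A_def B_def inverts_pmult by blast
  have "inv_count (a \<cdot> b) = card (A - A \<inter> B) + card (B - A \<inter> B)"
    unfolding inv_count_def Un using finA finB by (intro card_Un_disjoint) auto
  moreover have "card (A - A \<inter> B) + card (A \<inter> B) = card A"
      "card (B - A \<inter> B) + card (A \<inter> B) = card B"
    using card_mono[OF finA, of "A \<inter> B"] card_mono[OF finB, of "A \<inter> B"] finA finB
    by (simp_all add: card_Diff_subset)
  moreover have "card A = inv_count a"
    unfolding A_def inv_count_def ..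
  ultimately have "inv_count (a \<cdot> b) + 2 * card (A \<inter> B) = inv_count a + inv_count b"
    using cardB by linarith
  moreover have "A \<inter> B = {(p, q). inverts a p q \<and> inverts b (a p) (a q)}"
    unfolding A_def B_def by blast
  ultimately show ?thesis
    by (simp only:)
qed

lemma reduced_prod_iff_inv_count:
  assumes "perm n a" "perm n b"
  shows "reduced_prod a b \<longleftrightarrow> inv_count (a \<cdot> b) = inv_count a + inv_count b"
proof -
  define C where "C = {(p, q). inverts a p q \<and> inverts b (a p) (a q)}"
  have "finite C"
    unfolding C_def by (rule finite_subset[OF _ finite_inverts[OF assms(1)]]) blast
  moreover have "reduced_prod a b \<longleftrightarrow> C = {}"
    unfolding reduced_prod_def C_def by blast
  ultimately have "reduced_prod a b \<longleftrightarrow> card C = 0"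
    by simp
  then show ?thesis
    using inv_count_pmult[OF assms] unfolding C_def[symmetric] by linarith
qed

lemma reduced_prod_id [simp]: "reduced_prod id a" "reduced_prod a id"
  by (simp_all add: reduced_prod_def)

text \<open>Both sides say that the sets of pairs inverted in the first, second and third step of
  \<open>a \<cdot> b \<cdot> c\<close> are pairwise disjoint.\<close>
lemma reduced_prod_assoc:
  assumes "perm n a"
  shows "reduced_prod a b \<and> reduced_prod (a \<cdot> b) c \<longleftrightarrow> reduced_prod b c \<and> reduced_prod a (b \<cdot> c)"
proof -
  have surj: "(\<forall>p q. P (a p) (a q)) \<longleftrightarrow> (\<forall>p q. P p q)" for P
    using perm_inverses(1)[OF assms] by metis
  have "reduced_prod b c \<longleftrightarrow> (\<forall>p q. \<not> (inverts b (a p) (a q) \<and> inverts c (b (a p)) (b (a q))))"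
    unfolding reduced_prod_def by (rule surj[symmetric])
  then show ?thesis
    unfolding reduced_prod_def inverts_pmult pmult_apply by blast
qed

lemma reduced_prod_pinv:
  assumes "perm n a" "perm n b"
  shows "reduced_prod (pinv b) (pinv a) \<longleftrightarrow> reduced_prod a b"
proof -
  have surj: "(\<forall>p q. P (b (a p)) (b (a q))) \<longleftrightarrow> (\<forall>p q. P p q)" for P
    using perm_inverses(1)[OF assms(1)] perm_inverses(1)[OF assms(2)] by metis
  show ?thesis
    unfolding reduced_prod_def
    by (subst surj[symmetric])
       (use assms in \<open>auto simp: inverts_pinv[OF assms(1)] inverts_pinv[OF assms(2)] perm_inverses\<close>)
qed

lemma weak_le_pmult: "weak_le a (a \<cdot> b) \<longleftrightarrow> reduced_prod a b"
  by (auto simp: weak_le_def reduced_prod_def inverts_pmult)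

lemma inversions_eq:
  assumes "perm n a"
  shows "inversions n a = {(p, q). p < q \<and> inverts a p q}"
proof -
  have "1 \<le> p \<and> p < q \<and> q \<le> n \<and> a q < a p \<longleftrightarrow> p < q \<and> inverts a p q" for p q
  proof (cases "p < q")
    case True
    then have "inverts a p q \<longleftrightarrow> a q < a p"
      using perm_lt_iff[OF assms, of p q] by (simp add: inverts_def)
    then show ?thesis
      using True inverts_range(1,2)[OF assms, of p q] by (cases "inverts a p q") simp_all
  qed simp
  then show ?thesis
    unfolding inversions_def by blast
qed

lemma weak_le_iff_lt:
  assumes "perm n a" "perm n b"
  shows "weak_le a b \<longleftrightarrow> (\<forall>p q. p < q \<longrightarrow> inverts a p q \<longrightarrow> inverts b p q)"
  using inverts_sym[OF assms(1)] inverts_sym[OF assms(2)] inverts_range(3)[OF assms(1)]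
  unfolding weak_le_def by (metis linorder_neqE_nat)

lemma weak_le_iff:
  assumes "perm n a" "perm n b"
  shows "inversions n a \<subseteq> inversions n b \<longleftrightarrow> weak_le a b"
  unfolding weak_le_iff_lt[OF assms] inversions_eq[OF assms(1)] inversions_eq[OF assms(2)] by blast

section \<open>The weak order is a meet-semilattice\<close>

text \<open>Each point is sent to its rank with respect to the linear order \<open>L\<close>.\<close>
lemma order_realized_by_perm:
  fixes L :: "nat \<Rightarrow> nat \<Rightarrow> bool"
  assumes irr: "\<And>i. \<not> L i i" and tr: "\<And>i j k. L i j \<Longrightarrow> L j k \<Longrightarrow> L i k"
    and tot: "\<And>i j. i \<noteq> j \<Longrightarrow> L i j \<or> L j i"
  shows "\<exists>c. perm n c \<and> (\<forall>i\<in>{1..n}. \<forall>j\<in>{1..n}. c i < c j \<longleftrightarrow> L i j)"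
proof -
  define c where "c i = (if i \<in> {1..n} then Suc (card {j\<in>{1..n}. L j i}) else i)" for i
  have lt: "c i < c j" if "i \<in> {1..n}" "j \<in> {1..n}" "L i j" for i j
  proof -
    have "{k\<in>{1..n}. L k i} \<subset> {k\<in>{1..n}. L k j}"
      using that irr tr by blast
    then have "card {k\<in>{1..n}. L k i} < card {k\<in>{1..n}. L k j}"
      by (intro psubset_card_mono) auto
    then show ?thesis
      using that by (simp add: c_def)
  qed
  have iff: "c i < c j \<longleftrightarrow> L i j" if "i \<in> {1..n}" "j \<in> {1..n}" for i j
    using lt[OF that] lt[OF that(2,1)] tot[of i j] by (cases "i = j") (auto simp: irr)
  have "c i \<in> {1..n}" if "i \<in> {1..n}" for i
  proof -
    have "{j\<in>{1..n}. L j i} \<subset> {1..n}"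
      using that irr by blast
    then have "card {j\<in>{1..n}. L j i} < card {1..n}"
      by (intro psubset_card_mono) simp_all
    then show ?thesis
      using that by (simp add: c_def)
  qed
  moreover have "inj_on c {1..n}"
    using iff tot by (metis inj_onI less_irrefl)
  ultimately have "bij_betw c {1..n} {1..n}"
    by (metis bij_betw_def endo_inj_surj finite_atLeastAtMost image_subsetI)
  then have "perm n c"
    unfolding perm_def by (rule bij_imp_permutes) (auto simp: c_def)
  then show ?thesis
    using iff by blast
qed

text \<open>A lower bound of \<open>a\<close> and \<open>b\<close> preserves the order of every pair that is kept by \<open>a\<close> or
  by \<open>b\<close>, and hence of every pair in the transitive closure \<open>T\<close> of these. It remains to see
  that the pairs outside \<open>T\<close> are the inversions of a permutation, that is, that reversing
  them turns the usual order into a linear order \<open>L\<close>. This amounts to \<open>T\<close> being transitive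
  and co-transitive. The latter holds because a point between the ends of a chain is one of
  its vertices or lies between the ends of one link, and the pairs kept by a single
  permutation are co-transitive.\<close>
lemma weak_order_meet_exists:
  assumes a: "perm n a" and b: "perm n b"
  obtains c where "perm n c" "weak_le c a" "weak_le c b"
    "\<And>d. perm n d \<Longrightarrow> weak_le d a \<Longrightarrow> weak_le d b \<Longrightarrow> weak_le d c"
proof -
  define N where "N f = {(i, j). i < j \<and> f i < (f j :: nat)}" for f :: "nat \<Rightarrow> nat"
  define T where "T = (N a \<union> N b)\<^sup>+"
  have trT: "(i, k) \<in> T" if "(i, j) \<in> T" "(j, k) \<in> T" for i j k
    using that unfolding T_def by (rule trancl_trans)
  have N_inv: "(i, j) \<in> N f \<longleftrightarrow> i < j \<and> \<not> inverts f i j" if "perm n f" for i j f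
    by (auto simp: N_def inverts_def)
  have lt: "i < j" if "(i, j) \<in> T" for i j
    using that unfolding T_def by (induction rule: trancl_induct) (auto simp: N_def)
  have cotr1: "(i, j) \<in> N f \<or> (j, k) \<in> N f" if "(i, k) \<in> N f" "i < j" "j < k" for f i j k
    using that by (auto simp: N_def)
  have base: "N a \<union> N b \<subseteq> T"
    unfolding T_def by auto
  (* Induction along the chain: j lies below, on, or above its last but one vertex. *)
  have cotr: "(i, j) \<in> T \<or> (j, k) \<in> T" if "(i, k) \<in> T" "i < j" "j < k" for i j k
    using that(1,3) unfolding T_def
  proof (induction arbitrary: rule: trancl_induct)
    case (base y)
    then show ?case
      using cotr1[of i y a j] cotr1[of i y b j] that(2) by auto
  next
    case (step y z)
    have yz: "(y, z) \<in> (N a \<union> N b)\<^sup>+" using step(2) by auto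
    consider "j < y" | "j = y" | "y < j" by linarith
    then show ?case
    proof cases
      case 1
      then show ?thesis using step.IH yz by (meson trancl_trans)
    next
      case 2
      then show ?thesis using step by auto
    next
      case 3
      then have "(y, j) \<in> N a \<union> N b \<or> (j, z) \<in> N a \<union> N b"
        using cotr1[of y z a j] cotr1[of y z b j] step by auto
      then show ?thesis using step(1) by (auto intro: trancl_into_trancl)
    qed
  qed
  (* The pairs in T keep their order and all others are reversed. *)
  define L where "L i j \<longleftrightarrow> (i, j) \<in> T \<or> j < i \<and> (j, i) \<notin> T" for i j
  have trL: "L i k" if "L i j" "L j k" for i j k
  proof -
    consider "i < j" "j < k" | "i < k" "k < j" | "k < i" "i < j" | "j < i" "i < k" | "j < k" "k < i"
      | "k < j" "j < i" | "i = j" | "j = k" | "i = k" by linarith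
    then show ?thesis
    proof cases
      case 1 then show ?thesis using that trT[of i j k] unfolding L_def by auto
    next
      case 2 then show ?thesis using that cotr[of i j k] lt[of j k] unfolding L_def by auto
    next
      case 3 then show ?thesis using that trT[of k i j] lt[of j k] unfolding L_def by auto
    next
      case 4 then show ?thesis using that cotr[of j k i] lt[of i j] unfolding L_def by auto
    next
      case 5 then show ?thesis using that trT[of j k i] lt[of i j] unfolding L_def by auto
    next
      case 6 then show ?thesis using that cotr[of k i j] lt[of i j] lt[of j k] unfolding L_def
          by auto
    next
      case 7 then show ?thesis using that by simp
    next
      case 8 then show ?thesis using that by simp
    next
      case 9 then show ?thesis using that lt[of i j] lt[of j i] unfolding L_def by auto
    qed
  qed
  have irrL: "\<not> L i i" for i
    using lt unfolding L_def by blast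
  have totL: "L i j \<or> L j i" if "i \<noteq> j" for i j
    using that unfolding L_def by (metis linorder_neqE_nat)
  obtain c where c: "perm n c"
    and cL: "\<And>i j. i \<in> {1..n} \<Longrightarrow> j \<in> {1..n} \<Longrightarrow> c i < c j \<longleftrightarrow> L i j"
  proof -
    have "\<exists>c. perm n c \<and> (\<forall>i\<in>{1..n}. \<forall>j\<in>{1..n}. c i < c j \<longleftrightarrow> L i j)"
      by (rule order_realized_by_perm) (fact irrL, fact trL, fact totL)
    then show thesis
      using that by (elim exE conjE) blast
  qed
  have cT: "inverts c i j \<longleftrightarrow> (i, j) \<notin> T" if "i < j" for i j
  proof (cases "i \<in> {1..n} \<and> j \<in> {1..n}")
    case True
    then show ?thesis
      using cL[of i j] that by (simp add: L_def inverts_def)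
  next
    case False
    then have "\<not> inverts c i j" "\<not> inverts a i j"
      using inverts_range[OF c, of i j] inverts_range[OF a, of i j] by blast+
    then show ?thesis
      using that N_inv[OF a, of i j] base by blast
  qed
  have cab: "weak_le c a" "weak_le c b"
    using cT base N_inv[OF a] N_inv[OF b] weak_le_iff_lt[OF c a] weak_le_iff_lt[OF c b] by blast+
  have "weak_le d c" if d: "perm n d" "weak_le d a" "weak_le d b" for d
  proof -
    have "(i, j) \<in> N d" if ij: "(i, j) \<in> N a \<union> N b" for i j
    proof -
      have "i < j" "\<not> inverts a i j \<or> \<not> inverts b i j"
        using ij N_inv[OF a, of i j] N_inv[OF b, of i j] by auto
      moreover have "\<not> inverts d i j"
        using calculation(2) d(2,3) unfolding weak_le_def by blast
      ultimately show ?thesis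
        using N_inv[OF d(1)] by simp
    qed
    then have "N a \<union> N b \<subseteq> N d"
      by auto
    moreover have "trans (N d)"
      by (auto simp: trans_def N_def)
    ultimately have "T \<subseteq> N d"
      unfolding T_def by (metis trancl_id trancl_mono_subset)
    then have "\<not> inverts d i j" if "(i, j) \<in> T" for i j
      using that N_inv[OF d(1), of i j] by blast
    then show ?thesis
      unfolding weak_le_iff_lt[OF d(1) c] using cT by blast
  qed
  then show thesis
    by (rule that[OF c cab])
qed

lemma perm_lattice_meet:
  fixes a b :: "nat \<Rightarrow> nat"
  assumes a: "perm n a" and b: "perm n b"
  defines "c \<equiv> a \<sqinter>\<^bsub>perm_lattice n\<^esub> b"
  shows "perm n c" "weak_le c a" "weak_le c b"
    "\<And>d. perm n d \<Longrightarrow> weak_le d a \<Longrightarrow> weak_le d b \<Longrightarrow> weak_le d c"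
proof -
  have carrier: "carrier (perm_lattice n) = {a. perm n a}"
    by (simp add: perm_lattice_def perm_def)
  have le: "le (perm_lattice n) d e \<longleftrightarrow> weak_le d e" if "perm n d" "perm n e" for d e
    using weak_le_iff[OF that] by (simp add: perm_lattice_def)
  have Lower: "Lower (perm_lattice n) {a, b} = {d. perm n d \<and> weak_le d a \<and> weak_le d b}"
  proof (rule Set.set_eqI)
    fix d
    show "d \<in> Lower (perm_lattice n) {a, b} \<longleftrightarrow> d \<in> {d. perm n d \<and> weak_le d a \<and> weak_le d b}"
      using a b le[OF _ a, of d] le[OF _ b, of d] unfolding Lower_def carrier by blast
  qed
  have gr: "greatest (perm_lattice n) d (Lower (perm_lattice n) {a, b}) \<longleftrightarrow>
      perm n d \<and> weak_le d a \<and> weak_le d b \<and>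
      (\<forall>e. perm n e \<longrightarrow> weak_le e a \<longrightarrow> weak_le e b \<longrightarrow> weak_le e d)" for d
    unfolding greatest_def Lower carrier using le[of _ d] by blast
  have "\<exists>d. greatest (perm_lattice n) d (Lower (perm_lattice n) {a, b})"
    unfolding gr by (rule weak_order_meet_exists[OF a b]) blast
  then have "greatest (perm_lattice n) c (Lower (perm_lattice n) {a, b})"
    unfolding c_def meet_def Lattice.inf_def by (rule someI_ex)
  then show "perm n c" "weak_le c a" "weak_le c b"
    "\<And>d. perm n d \<Longrightarrow> weak_le d a \<Longrightarrow> weak_le d b \<Longrightarrow> weak_le d c"
    unfolding gr by blast+
qed

section \<open>Greedy tails\<close>

lemma perm_omega: "perm n (omega n)"
  unfolding perm_def
proof (rule bij_imp_permutes)
  show "bij_betw (omega n) {1..n} {1..n}"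
    by (rule bij_betw_byWitness[where f' = "omega n"]) (auto simp: omega_def)
qed (simp only: omega_def if_False)

lemma omega_omega: "omega n \<cdot> omega n = id"
  by (auto simp: fun_eq_iff omega_def)

lemma inverts_omega: "inverts (omega n) p q \<longleftrightarrow> p \<in> {1..n} \<and> q \<in> {1..n} \<and> p \<noteq> q"
  by (auto simp: inverts_def omega_def)

text \<open>The factor \<open>x\<close> can be split off on the right without loss of length. This is the weak
  order on inverses, see \<open>suffix_iff_weak_le\<close>.\<close>
definition suffix :: "nat \<Rightarrow> (nat \<Rightarrow> nat) \<Rightarrow> (nat \<Rightarrow> nat) \<Rightarrow> bool" where
  "suffix n x a \<longleftrightarrow> (\<exists>u. perm n u \<and> a = u \<cdot> x \<and> reduced_prod u x)"

text \<open>The longest suffix \<open>x\<close> of \<open>a\<close> for which \<open>x \<cdot> b\<close> is reduced, by \<open>tail_properties\<close>.\<close>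
definition tail :: "nat \<Rightarrow> (nat \<Rightarrow> nat) \<Rightarrow> (nat \<Rightarrow> nat) \<Rightarrow> nat \<Rightarrow> nat" where
  "tail n a b = pinv (pinv a \<sqinter>\<^bsub>perm_lattice n\<^esub> (b \<cdot> omega n))"

lemma weak_le_pinv:
  assumes "perm n a" "perm n x"
  shows "weak_le (pinv x) (pinv a) \<longleftrightarrow> reduced_prod (a \<cdot> pinv x) x"
proof -
  have "pinv a = pinv x \<cdot> (pinv (a \<cdot> pinv x))"
    using pinv_pmult[OF assms(1) perm_pinv[OF assms(2)]]
        by (simp add: pinv_pinv[OF assms(2)] pmult_pinv_cancel[OF assms(2)])
  then show ?thesis
    using weak_le_pmult[of "pinv x" "pinv (a \<cdot> pinv x)"] reduced_prod_pinv[of n "a \<cdot> pinv x" x]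
        assms
    by (metis perm_pmult perm_pinv)
qed

lemma suffix_iff_weak_le:
  assumes "perm n a" "perm n x"
  shows "suffix n x a \<longleftrightarrow> weak_le (pinv x) (pinv a)"
proof -
  have "a = u \<cdot> x \<longleftrightarrow> u = a \<cdot> pinv x" for u
    using pmult_pinv_cancel(3,4)[OF assms(2)] by metis
  moreover have "perm n (a \<cdot> pinv x)"
    using assms by auto
  ultimately show ?thesis
    using weak_le_pinv[OF assms] unfolding suffix_def by metis
qed

text \<open>Multiplying by \<open>\<omega>\<close> complements the set of inversions, so to be below \<open>b \<cdot> \<omega>\<close> means to
  have no inversion in common with \<open>b\<close>.\<close>
lemma weak_le_omega:
  assumes "perm n x" "perm n b"
  shows "weak_le (pinv x) (b \<cdot> omega n) \<longleftrightarrow> reduced_prod x b"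
proof -
  have surj: "(\<forall>p q. P (x p) (x q)) \<longleftrightarrow> (\<forall>p q. P p q)" for P
    using perm_inverses(1)[OF assms(1)] by metis
  have *: "inverts (b \<cdot> omega n) p q \<longleftrightarrow> \<not> inverts b p q" if "inverts (pinv x) p q" for p q
  proof -
    have "p \<in> {1..n}" "q \<in> {1..n}" "p \<noteq> q"
      using inverts_range[OF perm_pinv[OF assms(1)] that] .
    moreover have "b p \<noteq> b q"
      using \<open>p \<noteq> q\<close> perm_inj[OF assms(2)] by (simp add: inj_eq)
    ultimately have "inverts (omega n) (b p) (b q)"
      unfolding inverts_omega using perm_in_image[OF assms(2)] by blast
    then show ?thesis
      by (simp add: inverts_pmult)
  qed
  have "weak_le (pinv x) (b \<cdot> omega n) \<longleftrightarrow> (\<forall>p q. \<not> (inverts (pinv x) p q \<and> inverts b p q))"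
    using * by (auto simp: weak_le_def)
  also have "\<dots> \<longleftrightarrow> (\<forall>p q. \<not> (inverts (pinv x) (x p) (x q) \<and> inverts b (x p) (x q)))"
    by (rule surj[symmetric])
  also have "\<dots> \<longleftrightarrow> reduced_prod x b"
    by (simp add: reduced_prod_def inverts_pinv[OF assms(1)])
  finally show ?thesis .
qed

lemma bowtie_eq: "bowtie_op n a b = tail n a b \<cdot> b"
  by (simp add: bowtie_op_def tail_def)

lemma tail_perm:
  assumes "perm n a" "perm n b"
  shows "perm n (tail n a b)"
  unfolding tail_def by (intro perm_pinv perm_lattice_meet(1) perm_pmult perm_omega assms)

lemma asymp_eq:
  assumes "perm n a" "perm n b"
  shows "asymp_op n a b = a \<cdot> pinv (tail n a b)"
  unfolding asymp_op_def tail_def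
  by (subst pinv_pinv[OF perm_lattice_meet(1)[OF perm_pinv[OF assms(1)] perm_pmult[OF assms(2)
      perm_omega]]]) (rule refl)

lemma tail_properties:
  assumes "perm n a" "perm n b"
  shows suffix_tail: "suffix n (tail n a b) a"
    and reduced_prod_tail: "reduced_prod (tail n a b) b"
    and tail_greatest: "\<And>z. perm n z \<Longrightarrow> suffix n z a \<Longrightarrow> reduced_prod z b \<Longrightarrow> suffix n z (tail n a b)"
proof -
  have ai: "perm n (pinv a)" and bo: "perm n (b \<cdot> omega n)"
    using assms perm_omega by auto
  note meet = perm_lattice_meet[OF ai bo]
  have c: "pinv (tail n a b) = pinv a \<sqinter>\<^bsub>perm_lattice n\<^esub> (b \<cdot> omega n)"
    unfolding tail_def using pinv_pinv[OF meet(1)] .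
  note t = tail_perm[OF assms]
  show "suffix n (tail n a b) a"
    using suffix_iff_weak_le[OF assms(1) t] meet(2) c by simp
  show "reduced_prod (tail n a b) b"
    using weak_le_omega[OF t assms(2)] meet(3) c by simp
  show "suffix n z (tail n a b)" if "perm n z" "suffix n z a" "reduced_prod z b" for z
    using suffix_iff_weak_le[OF t that(1)] meet(4)[of "pinv z"] c weak_le_omega[OF that(1) assms(2)]
      suffix_iff_weak_le[OF assms(1) that(1)] that perm_pinv by simp
qed

lemma suffix_antisym:
  assumes "perm n x" "perm n y" "suffix n x y" "suffix n y x"
  shows "x = y"
proof -
  obtain u v where u: "perm n u" "y = u \<cdot> x" "reduced_prod u x" and v: "perm n v" "x = v \<cdot> y"
      "reduced_prod v y"
    using assms(3,4) unfolding suffix_def by blast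
  have "inv_count y = inv_count u + inv_count x" "inv_count x = inv_count v + inv_count y"
    using reduced_prod_iff_inv_count[OF u(1) assms(1)]
        reduced_prod_iff_inv_count[OF v(1) assms(2)] u(2,3) v(2,3) by metis+
  then have "u = id"
    using inv_count_eq_0[OF u(1)] by linarith
  then show ?thesis
    using u(2) by simp
qed

lemma asymp_properties:
  assumes "perm n a" "perm n b"
  shows "perm n (asymp_op n a b)" "a = asymp_op n a b \<cdot> tail n a b"
      "reduced_prod (asymp_op n a b) (tail n a b)"
proof -
  note t = tail_perm[OF assms]
  show "perm n (asymp_op n a b)" "a = asymp_op n a b \<cdot> tail n a b"
    using t assms by (auto simp: asymp_eq pmult_pinv_cancel[OF t])
  show "reduced_prod (asymp_op n a b) (tail n a b)"
    using suffix_tail[OF assms] suffix_iff_weak_le[OF assms(1) t] weak_le_pinv[OF assms(1) t]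
    by (simp add: asymp_eq assms)
qed

lemma bowtie_perm: "perm n a \<Longrightarrow> perm n b \<Longrightarrow> perm n (bowtie_op n a b)"
  by (auto simp: bowtie_eq intro: tail_perm)

lemma inv_count_asymp_bowtie:
  assumes "perm n a" "perm n b"
  shows "inv_count (asymp_op n a b) + inv_count (bowtie_op n a b) = inv_count a + inv_count b"
proof -
  note t = tail_perm[OF assms] and s = asymp_properties[OF assms]
  have "inv_count a = inv_count (asymp_op n a b) + inv_count (tail n a b)"
    using reduced_prod_iff_inv_count[OF s(1) t] s(2,3) by simp
  moreover have "inv_count (bowtie_op n a b) = inv_count (tail n a b) + inv_count b"
    using reduced_prod_iff_inv_count[OF t assms(2)] reduced_prod_tail[OF assms]
        by (simp add: bowtie_eq)
  ultimately show ?thesis by simp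
qed

lemma asymp_bowtie_prod:
  assumes "perm n a" "perm n b"
  shows "asymp_op n a b \<cdot> bowtie_op n a b = a \<cdot> b"
  using asymp_properties(2)[OF assms] by (simp add: bowtie_eq flip: pmult_assoc)

lemma tail_eqI:
  assumes "perm n a" "perm n b" "perm n x" "suffix n x a" "reduced_prod x b"
    and "\<And>z. perm n z \<Longrightarrow> suffix n z a \<Longrightarrow> reduced_prod z b \<Longrightarrow> suffix n z x"
  shows "tail n a b = x"
proof (rule suffix_antisym[OF tail_perm[OF assms(1,2)] assms(3)])
  show "suffix n (tail n a b) x"
    using assms(6)[OF tail_perm[OF assms(1,2)]] suffix_tail[OF assms(1,2)]
        reduced_prod_tail[OF assms(1,2)] .
  show "suffix n x (tail n a b)"
    using tail_greatest[OF assms(1-5)] .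
qed

lemma suffix_pmult:
  assumes "perm n a" "perm n x" "perm n b" "reduced_prod a b" "reduced_prod x b"
  shows "suffix n (x \<cdot> b) (a \<cdot> b) \<longleftrightarrow> suffix n x a"
proof
  assume "suffix n x a"
  then obtain u where "perm n u" "a = u \<cdot> x" "reduced_prod u x"
    unfolding suffix_def by blast
  moreover have "reduced_prod u (x \<cdot> b)"
    using reduced_prod_assoc[of n u x b] assms(4) calculation by blast
  ultimately show "suffix n (x \<cdot> b) (a \<cdot> b)"
    unfolding suffix_def by (intro exI[of _ u]) (simp add: pmult_assoc)
next
  assume "suffix n (x \<cdot> b) (a \<cdot> b)"
  then obtain u where u: "perm n u" "a \<cdot> b = u \<cdot> (x \<cdot> b)" "reduced_prod u (x \<cdot> b)"
    unfolding suffix_def by blast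
  then have "a \<cdot> b \<cdot> pinv b = u \<cdot> x \<cdot> b \<cdot> pinv b"
    by (simp add: pmult_assoc)
  then have "a = u \<cdot> x"
    by (simp add: pmult_pinv_cancel(3)[OF assms(3)])
  then show "suffix n x a"
    using u reduced_prod_assoc[of n u x b] assms(5) unfolding suffix_def by blast
qed

text \<open>Let \<open>y\<close> be the longest suffix of \<open>x \<cdot> b = a \<bowtie> b\<close> with \<open>y \<cdot> c\<close> reduced. It contains the
  suffix \<open>b\<close>, since \<open>b \<cdot> c\<close> is reduced, so \<open>y = y' \<cdot> b\<close>, and \<open>y'\<close> is the longest suffix of
  \<open>a\<close> with \<open>y' \<cdot> b \<cdot> c\<close> reduced.\<close>
lemma bowtie_action:
  assumes a: "perm n a" and b: "perm n b" and c: "perm n c" and bc: "reduced_prod b c"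
  shows "bowtie_op n (bowtie_op n a b) c = bowtie_op n a (b \<cdot> c)"
proof -
  define x where "x = tail n a b"
  define y where "y = tail n (x \<cdot> b) c"
  define z where "z = tail n a (b \<cdot> c)"
  have bcp: "perm n (b \<cdot> c)" using b c by auto
  have x: "perm n x" and xb: "reduced_prod x b" using tail_perm[OF a b] reduced_prod_tail[OF a b]
      by (auto simp: x_def)
  have xbp: "perm n (x \<cdot> b)" using x b by auto
  have y: "perm n y" and yc: "reduced_prod y c" using tail_perm[OF xbp c]
      reduced_prod_tail[OF xbp c] by (auto simp: y_def)
  have z: "perm n z" and zbc: "reduced_prod z (b \<cdot> c)" using tail_perm[OF a bcp]
      reduced_prod_tail[OF a bcp] by (auto simp: z_def)
  have zb: "reduced_prod z b" and zb_c: "reduced_prod (z \<cdot> b) c"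
    using reduced_prod_assoc[OF z, of b c] bc zbc by auto
  have "suffix n z x"
    unfolding x_def using suffix_tail[OF a bcp] by (intro tail_greatest[OF a b z] zb)
        (simp add: z_def)
  then have "suffix n (z \<cdot> b) (x \<cdot> b)"
    using suffix_pmult[OF x z b xb zb] by simp
  then have 1: "suffix n (z \<cdot> b) y"
    unfolding y_def using zb_c z b by (intro tail_greatest[OF xbp c]) auto
  have "suffix n b (x \<cdot> b)"
    using x xb by (auto simp: suffix_def)
  then have "suffix n b y"
    unfolding y_def using bc b by (intro tail_greatest[OF xbp c]) auto
  then obtain y' where y': "perm n y'" "y = y' \<cdot> b" "reduced_prod y' b"
    unfolding suffix_def by blast
  have "suffix n y (x \<cdot> b)"
    using suffix_tail[OF xbp c] by (simp add: y_def)
  then have "suffix n y' x"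
    using suffix_pmult[OF x y'(1) b xb y'(3)] y'(2) by simp
  moreover have "suffix n x a"
    using suffix_tail[OF a b] by (simp add: x_def)
  ultimately have "suffix n y' a"
    using suffix_iff_weak_le[OF x y'(1)] suffix_iff_weak_le[OF a x] suffix_iff_weak_le[OF a y'(1)]
    unfolding weak_le_def by blast
  moreover have "reduced_prod y' (b \<cdot> c)"
    using reduced_prod_assoc[OF y'(1), of b c] y' yc by auto
  ultimately have "suffix n y' z"
    unfolding z_def by (intro tail_greatest[OF a bcp y'(1)])
  then have 2: "suffix n y (z \<cdot> b)"
    using suffix_pmult[OF z y'(1) b zb y'(3)] y'(2) by simp
  have "y = z \<cdot> b"
    using suffix_antisym[OF y _ 2 1] z b by auto
  then show ?thesis
    by (simp add: bowtie_eq pmult_assoc flip: x_def y_def z_def)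
qed

text \<open>Multiplied on the right by \<open>a \<bowtie> (b \<cdot> c)\<close>, both sides of the equation give \<open>a \<cdot> b \<cdot> c\<close>,
  by \<open>bowtie_action\<close>. The product is reduced by comparing lengths, because a pair \<open>a \<asymp> b\<close>,
  \<open>a \<bowtie> b\<close> has the same total length as \<open>a\<close>, \<open>b\<close>.\<close>
lemma asymp_cocycle:
  assumes a: "perm n a" and b: "perm n b" and c: "perm n c" and bc: "reduced_prod b c"
  shows "reduced_prod (asymp_op n a b) (asymp_op n (bowtie_op n a b) c)"
    and "asymp_op n a b \<cdot> asymp_op n (bowtie_op n a b) c = asymp_op n a (b \<cdot> c)"
proof -
  define e where "e = bowtie_op n a b"
  define f where "f = bowtie_op n e c"
  have bcp: "perm n (b \<cdot> c)" using b c by auto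
  have e: "perm n e" using bowtie_perm[OF a b] by (simp add: e_def)
  have f: "perm n f" using bowtie_perm[OF e c] by (simp add: f_def)
  have f_eq: "f = bowtie_op n a (b \<cdot> c)"
    using bowtie_action[OF a b c bc] by (simp add: e_def f_def)
  note p = asymp_properties(1)[OF a b] asymp_properties(1)[OF e c] asymp_properties(1)[OF a bcp]
  have "asymp_op n a b \<cdot> asymp_op n e c \<cdot> f = asymp_op n a b \<cdot> (e \<cdot> c)"
    using asymp_bowtie_prod[OF e c] by (simp add: pmult_assoc f_def)
  also have "\<dots> = a \<cdot> (b \<cdot> c)"
    unfolding e_def asymp_bowtie_prod[OF a b] pmult_assoc[symmetric] ..
  also have "\<dots> = asymp_op n a (b \<cdot> c) \<cdot> f"
    using asymp_bowtie_prod[OF a bcp] by (simp add: f_eq)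
  finally have "asymp_op n a b \<cdot> asymp_op n e c \<cdot> f \<cdot> pinv f = asymp_op n a (b \<cdot> c) \<cdot> f \<cdot> pinv f"
    by simp
  then show eq: "asymp_op n a b \<cdot> asymp_op n (bowtie_op n a b) c = asymp_op n a (b \<cdot> c)"
    by (simp add: pmult_pinv_cancel(3)[OF f] e_def)
  have "inv_count (asymp_op n a b) + inv_count (asymp_op n e c) = inv_count (asymp_op n a (b \<cdot> c))"
    using inv_count_asymp_bowtie[OF a b] inv_count_asymp_bowtie[OF e c]
        inv_count_asymp_bowtie[OF a bcp]
      reduced_prod_iff_inv_count[OF b c] bc by (simp add: e_def f_def flip: f_eq)
  then show "reduced_prod (asymp_op n a b) (asymp_op n (bowtie_op n a b) c)"
    using eq reduced_prod_iff_inv_count[OF p(1,2)] by (simp add: e_def)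
qed

lemma tail_id_left: "perm n b \<Longrightarrow> tail n id b = id"
proof (rule tail_eqI)
  show "suffix n z id" if "suffix n z id" for z using that .
qed (auto simp: suffix_def)

lemma tail_id_right: "perm n a \<Longrightarrow> tail n a id = a"
  by (rule tail_eqI) (auto simp: suffix_def intro: exI[of _ id])

text \<open>A pair inverted by both factors would not be inverted by \<open>\<omega>\<close>.\<close>
lemma reduced_prod_if_prod_omega:
  assumes "perm n x" "perm n y" "x \<cdot> y = omega n"
  shows "reduced_prod x y"
  unfolding reduced_prod_def
proof (intro allI notI)
  fix p q assume *: "inverts x p q \<and> inverts y (x p) (x q)"
  then have "\<not> inverts (omega n) p q"
    using inverts_pmult[of x y p q] assms(3) by simp
  then show False
    using inverts_range[OF assms(1)] * unfolding inverts_omega by blast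
qed

lemma tail_omega_right: "perm n a \<Longrightarrow> tail n a (omega n) = id"
proof (rule tail_eqI)
  fix z assume z: "perm n z" "reduced_prod z (omega n)"
  have "\<not> inverts z p q" for p q
  proof
    assume i: "inverts z p q"
    have "inverts (omega n) (z p) (z q)"
      unfolding inverts_omega using inverts_range[OF z(1) i] perm_in_image[OF z(1)]
          perm_inj[OF z(1)]
      by (metis injD)
    then show False using z(2) i by (auto simp: reduced_prod_def)
  qed
  then show "suffix n z id"
    using no_inversions_imp_id[OF z(1)] by (auto simp: suffix_def)
qed (auto simp: suffix_def perm_omega)

text \<open>Every permutation is a suffix of \<open>\<omega>\<close>, so the tail is the full complement of \<open>b\<close> in
  \<open>\<omega>\<close>.\<close>
lemma tail_omega_left:
  assumes b: "perm n b"
  shows "tail n (omega n) b = omega n \<cdot> pinv b"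
proof (rule tail_eqI)
  note w = perm_omega[of n]
  define x where "x = omega n \<cdot> pinv b"
  show x: "perm n (omega n \<cdot> pinv b)" using w b by auto
  have xb: "x \<cdot> b = omega n"
    using b by (simp add: x_def pmult_pinv_cancel)
  then show "reduced_prod (omega n \<cdot> pinv b) b"
    using reduced_prod_if_prod_omega[OF x b] by (simp add: x_def)
  have suf: "suffix n z (omega n)" if "perm n z" for z
  proof -
    have "reduced_prod (omega n \<cdot> pinv z) z"
      using that w by (intro reduced_prod_if_prod_omega) (auto simp: pmult_pinv_cancel)
    then show ?thesis
      using that w unfolding suffix_def
      by (intro exI[of _ "omega n \<cdot> pinv z"]) (auto simp: pmult_pinv_cancel)
  qed
  show "suffix n (omega n \<cdot> pinv b) (omega n)" using suf[OF x] .
  show "suffix n z (omega n \<cdot> pinv b)" if z: "perm n z" "reduced_prod z b" for z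
  proof -
    have "suffix n (z \<cdot> b) (x \<cdot> b)"
      unfolding xb using z b by (intro suf) auto
    then show ?thesis
      using suffix_pmult[of n x z b] x z b xb reduced_prod_if_prod_omega[OF x b]
          by (simp add: x_def)
  qed
qed (use b perm_omega in auto)

text \<open>The first four equations make the rules with a trivial factor improper. The last two
  are the relation \<open>\<Omega> R\<^sub>a = R\<^bsub>\<omega>a\<omega>\<^esub> \<Omega>\<close>.\<close>
lemma asymp_bowtie_special:
  assumes "perm n a"
  shows "asymp_op n id a = id" "bowtie_op n id a = a" "asymp_op n a id = id" "bowtie_op n a id = a"
    "asymp_op n a (omega n) = a" "bowtie_op n a (omega n) = omega n"
    "asymp_op n (omega n) a = omega n \<cdot> a \<cdot> omega n" "bowtie_op n (omega n) a = omega n"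
proof -
  note w = perm_omega[of n] and i = perm_id[of n]
  have winv: "pinv (omega n) = omega n"
    using pinv_unique[OF w omega_omega] .
  have idinv: "pinv id = (id :: nat \<Rightarrow> nat)"
    by (rule pinv_unique[OF i]) simp
  show "asymp_op n id a = id" "bowtie_op n id a = a"
    using tail_id_left[OF assms] asymp_eq[OF i assms] by (simp_all add: bowtie_eq idinv)
  show "asymp_op n a id = id" "bowtie_op n a id = a"
    using tail_id_right[OF assms] asymp_eq[OF assms i] pmult_pinv[OF assms]
        by (simp_all add: bowtie_eq)
  show "asymp_op n a (omega n) = a" "bowtie_op n a (omega n) = omega n"
    using tail_omega_right[OF assms] asymp_eq[OF assms w] by (simp_all add: bowtie_eq idinv)
  show "asymp_op n (omega n) a = omega n \<cdot> a \<cdot> omega n" "bowtie_op n (omega n) a = omega n"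
    using tail_omega_left[OF assms] asymp_eq[OF w assms] pinv_pmult[OF w perm_pinv[OF assms]]
    by (simp_all add: bowtie_eq winv pinv_pinv[OF assms] pmult_pinv[OF assms] pmult_assoc)
qed

section \<open>Pushing permutations into a sequence\<close>

(* As a rewrite rule, pmult_apply also unfolds products that have been eta-expanded by matching. *)
declare pmult_apply [simp del]

text \<open>The last letter of the sequence comes first in the list. The list may be thought of as
  continued by identities, which is why pushing the identity into the empty list has no
  effect.\<close>
fun push :: "nat \<Rightarrow> (nat \<Rightarrow> nat) \<Rightarrow> (nat \<Rightarrow> nat) list \<Rightarrow> (nat \<Rightarrow> nat) list" where
  "push n c [] = (if c = id then [] else [c])"
| "push n c (b # s) = bowtie_op n b c # push n (asymp_op n b c) s"

definition proper_perms :: "nat \<Rightarrow> (nat \<Rightarrow> nat) list \<Rightarrow> bool" where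
  "proper_perms n s \<longleftrightarrow> (\<forall>a\<in>set s. perm n a \<and> a \<noteq> id)"

lemma proper_perms_simps [simp]:
  "proper_perms n []"
  "proper_perms n (a # s) \<longleftrightarrow> perm n a \<and> a \<noteq> id \<and> proper_perms n s"
  by (auto simp: proper_perms_def)

lemma bowtie_neq_id:
  assumes a: "perm n a" and b: "perm n b" and "a \<noteq> id"
  shows "bowtie_op n a b \<noteq> id"
proof
  assume *: "bowtie_op n a b = id"
  have "inv_count (bowtie_op n a b) = inv_count (tail n a b) + inv_count b"
    using reduced_prod_iff_inv_count[OF tail_perm[OF a b] b] reduced_prod_tail[OF a b]
        by (simp add: bowtie_eq)
  then have "b = id"
    using inv_count_eq_0[OF b] unfolding * by simp
  then show False
    using * asymp_bowtie_special(4)[OF a] \<open>a \<noteq> id\<close> by simp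
qed

lemma push_proper: "perm n c \<Longrightarrow> proper_perms n s \<Longrightarrow> proper_perms n (push n c s)"
  by (induction s arbitrary: c) (simp_all add: bowtie_perm bowtie_neq_id asymp_properties(1))

lemma reduced_prod_imp_asymp_bowtie:
  assumes "perm n a" "perm n b" "reduced_prod a b"
  shows "asymp_op n a b = id" "bowtie_op n a b = a \<cdot> b"
proof -
  have "tail n a b = a"
  proof (rule tail_eqI[OF assms(1,2,1) _ assms(3)])
    show "suffix n a a"
      unfolding suffix_def by (intro exI[of _ id]) simp
  qed
  then show "asymp_op n a b = id" "bowtie_op n a b = a \<cdot> b"
    using asymp_eq[OF assms(1,2)] pmult_pinv[OF assms(1)] by (simp_all add: bowtie_eq)
qed

lemma push_id: "proper_perms n s \<Longrightarrow> push n id s = s"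
  by (induction s) (simp_all add: asymp_bowtie_special)

text \<open>At every position the entry changes by the right action \<open>\<bowtie>\<close>. By the cocycle property
  of \<open>\<asymp>\<close>, the two permutations that are carried on for \<open>b\<close> and \<open>c\<close> form again a reduced
  product, whose value is the one carried on for \<open>b \<cdot> c\<close>. The statement concerns all
  sequences, greedy or not.\<close>
lemma push_pmult:
  assumes "perm n b" "perm n c" "reduced_prod b c" "proper_perms n s"
  shows "push n c (push n b s) = push n (b \<cdot> c) s"
  using assms
proof (induction s arbitrary: b c)
  case Nil
  consider "b = id" | "b \<noteq> id" by blast
  then show ?case
  proof cases
    case 2
    have "inv_count (b \<cdot> c) = inv_count b + inv_count c"
      using reduced_prod_iff_inv_count[OF Nil(1,2)] Nil(3) by simp
    then have "b \<cdot> c \<noteq> id"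
      using 2 inv_count_eq_0[OF Nil(1)] by auto
    then show ?thesis
      using 2 reduced_prod_imp_asymp_bowtie[OF Nil(1-3)] by (simp)
  qed (simp del: id_apply)
next
  case (Cons a s)
  then have a: "perm n a" by simp
  note b = Cons.prems(1) and c = Cons.prems(2) and bc = Cons.prems(3)
  show ?case
    using bowtie_action[OF a b c bc] asymp_cocycle[OF a b c bc] Cons.prems(4)
      Cons.IH[OF asymp_properties(1)[OF a b] asymp_properties(1)[OF bowtie_perm[OF a b] c]]
    by (simp)
qed

text \<open>Splitting \<open>a\<close> as \<open>(a \<asymp> b) \<cdot> x\<close> and joining \<open>x\<close> with \<open>b\<close> are two instances of
  \<open>push_pmult\<close>.\<close>
lemma push_rule:
  assumes "perm n a" "perm n b" "proper_perms n s"
  shows "push n (bowtie_op n a b) (push n (asymp_op n a b) s) = push n b (push n a s)"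
proof -
  note t = tail_perm[OF assms(1,2)] and p = asymp_properties[OF assms(1,2)]
  have "push n (bowtie_op n a b) (push n (asymp_op n a b) s)
      = push n b (push n (tail n a b) (push n (asymp_op n a b) s))"
    using push_pmult[OF t assms(2) reduced_prod_tail[OF assms(1,2)] push_proper[OF p(1) assms(3)]]
    by (simp add: bowtie_eq)
  also have "push n (tail n a b) (push n (asymp_op n a b) s) = push n a s"
    using push_pmult[OF p(1) t p(3) assms(3)] p(2) by simp
  finally show ?thesis .
qed

section \<open>States: sequences followed by inverse powers of \<open>\<Omega>\<close>\<close>

text \<open>Conjugation by \<open>\<omega>\<close>, the effect of the flip on permutations.\<close>
definition twist :: "nat \<Rightarrow> (nat \<Rightarrow> nat) \<Rightarrow> nat \<Rightarrow> nat" where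
  "twist n a = omega n \<cdot> a \<cdot> omega n"

lemma twist_perm [intro]: "perm n a \<Longrightarrow> perm n (twist n a)"
  unfolding twist_def by (intro perm_pmult perm_omega)

lemma twist_twist [simp]: "twist n (twist n a) = a"
proof -
  have "twist n (twist n a) = (omega n \<cdot> omega n) \<cdot> a \<cdot> (omega n \<cdot> omega n)"
    unfolding twist_def by (simp only: pmult_assoc)
  then show ?thesis by (simp add: omega_omega)
qed

lemma twist_pmult: "twist n (a \<cdot> b) = twist n a \<cdot> twist n b"
proof -
  have "twist n a \<cdot> twist n b = omega n \<cdot> a \<cdot> (omega n \<cdot> omega n) \<cdot> b \<cdot> omega n"
    unfolding twist_def by (simp only: pmult_assoc)
  then show ?thesis by (simp add: omega_omega twist_def pmult_assoc)
qed

lemma twist_id [simp]: "twist n id = id"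
  by (simp add: twist_def omega_omega)

lemma twist_omega [simp]: "twist n (omega n) = omega n"
  by (simp add: twist_def omega_omega)

lemma twist_eq_id_iff [simp]: "twist n a = id \<longleftrightarrow> a = id"
  by (metis twist_id twist_twist)

lemma inverts_twist:
  assumes "perm n a"
  shows "inverts (twist n a) p q \<longleftrightarrow> inverts a (omega n p) (omega n q)"
proof -
  note w = perm_omega[of n]
  have rng: "omega n p \<in> {1..n} \<longleftrightarrow> p \<in> {1..n}" "omega n q \<in> {1..n} \<longleftrightarrow> q \<in> {1..n}"
    "a (omega n p) \<in> {1..n} \<longleftrightarrow> omega n p \<in> {1..n}" "a (omega n q) \<in> {1..n} \<longleftrightarrow> omega n q \<in> {1..n}"
    using perm_in_image[OF w] perm_in_image[OF assms] by blast+
  have inj: "a (omega n p) = a (omega n q) \<longleftrightarrow> p = q"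
    using perm_inj[OF assms] perm_inj[OF w] by (simp add: inj_eq)
  have "inverts (omega n) (a (omega n p)) (a (omega n q)) \<longleftrightarrow> inverts (omega n) p q"
    unfolding inverts_omega using rng inj by blast
  then show ?thesis
    unfolding twist_def inverts_pmult pmult_apply by blast
qed

lemma reduced_prod_twist:
  assumes "perm n a" "perm n b" "reduced_prod a b"
  shows "reduced_prod (twist n a) (twist n b)"
  unfolding reduced_prod_def
proof (intro allI)
  fix p q
  have "omega n (twist n a p) = a (omega n p)" for p
    using omega_omega[of n] by (simp add: twist_def fun_eq_iff pmult_apply)
  then show "\<not> (inverts (twist n a) p q \<and> inverts (twist n b) (twist n a p) (twist n a q))"
    using assms(3) unfolding reduced_prod_def inverts_twist[OF assms(1)]
        inverts_twist[OF assms(2)] by simp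
qed

definition twists :: "nat \<Rightarrow> nat \<Rightarrow> (nat \<Rightarrow> nat) \<Rightarrow> nat \<Rightarrow> nat" where
  "twists n m = (twist n ^^ m)"

lemma twists_simps: "twists n 0 a = a" "twists n (Suc m) a = twist n (twists n m a)"
  by (simp_all add: twists_def)

lemma twists_twist: "twists n m (twist n a) = twist n (twists n m a)"
  by (simp add: twists_def funpow_swap1)

lemma twists_perm: "perm n a \<Longrightarrow> perm n (twists n m a)"
  by (induction m) (auto simp: twists_simps)

lemma twists_pmult: "twists n m (a \<cdot> b) = twists n m a \<cdot> twists n m b"
  by (induction m) (simp_all add: twists_simps twist_pmult)

lemma twists_omega: "twists n m (omega n) = omega n"
  by (induction m) (auto simp: twists_simps)

lemma twists_id: "twists n m id = id"
  by (induction m) (simp_all add: twists_simps del: id_apply)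

lemma reduced_prod_twists: "perm n a \<Longrightarrow> perm n b \<Longrightarrow> reduced_prod a b \<Longrightarrow> reduced_prod (twists n m a)
    (twists n m b)"
  by (induction m) (auto simp: twists_simps intro: reduced_prod_twist twists_perm)

text \<open>The pair \<open>(s, m)\<close> stands for the letters of \<open>s\<close>, last letter first, followed by \<open>m\<close>
  times \<open>\<Omega>\<^sup>-\<^sup>1\<close>.\<close>
type_synonym state = "(nat \<Rightarrow> nat) list \<times> nat"

fun cancel :: "nat \<Rightarrow> (nat \<Rightarrow> nat) list \<Rightarrow> nat \<Rightarrow> state" where
  "cancel n (b # s) (Suc m) = (if b = omega n then cancel n s m else (b # s, Suc m))"
| "cancel n [] m = ([], m)"
| "cancel n s 0 = (s, 0)"

text \<open>On its way to the sequence the permutation passes every letter \<open>\<Omega>\<^sup>-\<^sup>1\<close> and is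
  conjugated each time.\<close>
definition act :: "nat \<Rightarrow> (nat \<Rightarrow> nat) \<Rightarrow> state \<Rightarrow> state" where
  "act n c x = cancel n (push n (twists n (snd x) c) (fst x)) (snd x)"

definition act_inv :: "nat \<Rightarrow> state \<Rightarrow> state" where
  "act_inv n x = cancel n (fst x) (Suc (snd x))"

lemma omega_neq_id: "n \<ge> 2 \<Longrightarrow> omega n \<noteq> id"
  by (auto simp: omega_def fun_eq_iff intro!: exI[of _ 1])

lemma push_omega_omega: "perm n c \<Longrightarrow> push n c (omega n # s) = omega n # push n (twist n c) s"
  by (simp add: asymp_bowtie_special twist_def)

lemma push_omega_push:
  assumes "perm n c" "proper_perms n s"
  shows "push n (omega n) (push n c s) = push n (twist n c) (push n (omega n) s)"
  using push_rule[OF perm_omega twist_perm[OF assms(1)] assms(2)]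
    asymp_bowtie_special(7,8)[OF twist_perm[OF assms(1)]]
  by (simp add: twist_def[symmetric])

text \<open>A sequence in which every entry is stable when \<open>\<Omega>\<close> is pushed through it. Not every
  sequence has this property, but for \<open>n \<ge> 2\<close> those built from the empty one do, because it
  is kept by pushing and cancelling.\<close>
definition omega_central :: "nat \<Rightarrow> (nat \<Rightarrow> nat) list \<Rightarrow> bool" where
  "omega_central n s \<longleftrightarrow> proper_perms n s \<and> push n (omega n) s = omega n # s"

lemma omega_central_push:
  assumes "omega_central n s" "perm n c"
  shows "omega_central n (push n c s)"
proof -
  have s: "proper_perms n s" and w: "push n (omega n) s = omega n # s"
    using assms(1) by (simp_all add: omega_central_def)
  have "push n (omega n) (push n c s) = omega n # push n c s"
    using push_omega_push[OF assms(2) s] push_omega_omega[OF twist_perm[OF assms(2)], of s]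
    unfolding w by simp
  then show ?thesis
    using push_proper[OF assms(2) s] by (simp add: omega_central_def)
qed

lemma omega_central_cancel:
  "omega_central n s \<Longrightarrow> omega_central n (fst (cancel n s m))"
proof (induction n s m rule: cancel.induct)
  case (1 n b s m)
  show ?case
  proof (cases "b = omega n")
    case True
    have "proper_perms n s" "omega n # push n (twist n (omega n)) s = omega n # omega n # s"
      using 1(2) push_omega_omega[OF perm_omega, of n s] unfolding True omega_central_def
          by simp_all
    then have "omega_central n s"
      by (simp add: omega_central_def)
    then show ?thesis using True 1(1) by simp
  qed (use 1(2) in simp)
qed simp_all

lemma cancel_cancel: "cancel n (fst (cancel n s m)) (snd (cancel n s m)) = cancel n s m"
  by (induction n s m rule: cancel.induct) simp_all

text \<open>Cancellation can be postponed: a permutation pushed against the last entry \<open>\<omega>\<close> passes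
  it and is conjugated once, just as by the letter \<open>\<Omega>\<^sup>-\<^sup>1\<close> that would have been cancelled
  with it.\<close>
lemma act_cancel:
  assumes "perm n c"
  shows "act n c (cancel n s m) = cancel n (push n (twists n m c) s) m"
  using assms
proof (induction n s m rule: cancel.induct)
  case (1 n b s m)
  show ?case
  proof (cases "b = omega n")
    case True
    have "push n (twists n (Suc m) c) (omega n # s) = omega n # push n (twists n m c) s"
      using push_omega_omega[OF twists_perm[OF 1(2)], of "Suc m" s] by (simp add: twists_simps)
    then show ?thesis
      using 1 True by simp
  qed (simp add: act_def)
qed (simp_all add: act_def)

lemma act_inv_cancel: "act_inv n (cancel n s m) = cancel n s (Suc m)"
proof (induction n s m rule: cancel.induct)
  case (1 n b s m)
  then show ?case by (cases "b = omega n") (simp_all add: act_inv_def)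
qed (simp_all add: act_inv_def)

text \<open>For \<open>n \<ge> 2\<close>, an invariant of the states that can be reached from the empty one. On
  such states \<open>\<Omega>\<close> and \<open>\<Omega>\<^sup>-\<^sup>1\<close> act as inverses of each other.\<close>
definition valid_state :: "nat \<Rightarrow> state \<Rightarrow> bool" where
  "valid_state n x \<longleftrightarrow> omega_central n (fst x) \<and> cancel n (fst x) (snd x) = x"

lemma valid_act: "valid_state n x \<Longrightarrow> perm n c \<Longrightarrow> valid_state n (act n c x)"
  unfolding valid_state_def act_def
  by (intro conjI omega_central_cancel omega_central_push twists_perm cancel_cancel) auto

lemma valid_act_inv: "valid_state n x \<Longrightarrow> valid_state n (act_inv n x)"
  unfolding valid_state_def act_inv_def by (intro conjI omega_central_cancel cancel_cancel) auto

lemma valid_init: "n \<ge> 2 \<Longrightarrow> valid_state n ([], 0)"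
  using omega_neq_id by (simp add: valid_state_def omega_central_def)

lemma act_pmult:
  assumes "perm n b" "perm n c" "reduced_prod b c" "valid_state n x"
  shows "act n c (act n b x) = act n (b \<cdot> c) x"
proof -
  have "proper_perms n (fst x)"
    using assms(4) by (simp add: valid_state_def omega_central_def)
  then show ?thesis
    using push_pmult[OF twists_perm[OF assms(1)] twists_perm[OF assms(2)] reduced_prod_twists[OF
        assms(1-3)]]
      act_cancel[OF assms(2)]
    unfolding act_def[of n b] act_def[of n "b \<cdot> c"] by (simp add: twists_pmult)
qed

lemma act_asymp_bowtie:
  assumes "perm n a" "perm n b" "valid_state n x"
  shows "act n (bowtie_op n a b) (act n (asymp_op n a b) x) = act n b (act n a x)"
proof -
  note t = tail_perm[OF assms(1,2)] and p = asymp_properties[OF assms(1,2)]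
  have "act n (bowtie_op n a b) (act n (asymp_op n a b) x)
      = act n b (act n (tail n a b) (act n (asymp_op n a b) x))"
    using act_pmult[OF t assms(2) reduced_prod_tail[OF assms(1,2)] valid_act[OF assms(3) p(1)]]
    by (simp add: bowtie_eq)
  also have "act n (tail n a b) (act n (asymp_op n a b) x) = act n a x"
    using act_pmult[OF p(1) t p(3) assms(3)] p(2) by simp
  finally show ?thesis .
qed

lemma act_id: "valid_state n x \<Longrightarrow> act n id x = x"
  by (simp add: act_def valid_state_def omega_central_def twists_id push_id)

lemma act_act_inv:
  assumes "perm n a"
  shows "act n a (act_inv n x) = act_inv n (act n (twist n a) x)"
proof -
  have "act n a (act_inv n x) = cancel n (push n (twists n (Suc (snd x)) a) (fst x)) (Suc (snd x))"
    unfolding act_inv_def by (rule act_cancel[OF assms])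
  also have "\<dots> = act_inv n (act n (twist n a) x)"
    unfolding act_def act_inv_cancel twists_simps twists_twist ..
  finally show ?thesis .
qed

lemma act_inv_act_omega:
  assumes "valid_state n x"
  shows "act_inv n (act n (omega n) x) = x" "act n (omega n) (act_inv n x) = x"
proof -
  have *: "cancel n (push n (omega n) (fst x)) (Suc (snd x)) = x"
    using assms by (simp add: valid_state_def omega_central_def)
  show "act_inv n (act n (omega n) x) = x"
    unfolding act_def act_inv_cancel twists_omega by (rule *)
  show "act n (omega n) (act_inv n x) = x"
    unfolding act_inv_def act_cancel[OF perm_omega] twists_omega by (rule *)
qed

section \<open>Reduced braid words\<close>

definition swap :: "nat \<Rightarrow> nat \<Rightarrow> nat" where
  "swap i = transpose i (i + 1)"

lemma word_perm_Cons: "word_perm (x # w) = swap (fst x) \<cdot> word_perm w"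
  by (simp add: swap_def)

declare word_perm.simps(2) [simp del] word_perm_Cons [simp]

lemma swap_perm: "i \<in> {1..<n} \<Longrightarrow> perm n (swap i)"
  unfolding perm_def swap_def by (rule permutes_swap_id) auto

lemma swap_left [simp]: "swap i i = i + 1"
  by (simp add: swap_def)

lemma swap_right [simp]: "swap i (i + 1) = i" "swap i (Suc i) = i"
  by (simp_all add: swap_def)

lemma swap_other: "p \<noteq> i \<Longrightarrow> p \<noteq> i + 1 \<Longrightarrow> swap i p = p"
  by (simp add: swap_def)

lemma swap_involution [simp]: "swap i (swap i p) = p"
  by (simp add: swap_def)

lemma swap_swap: "swap i \<cdot> (swap i \<cdot> a) = a" "swap i \<cdot> swap i = id"
  by (simp_all add: fun_eq_iff pmult_apply)

lemma inverts_swap: "inverts (swap i) p q \<longleftrightarrow> {p, q} = {i, i + 1}"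
proof -
  have "inverts (swap i) p q \<longleftrightarrow> p = i \<and> q = i + 1 \<or> p = i + 1 \<and> q = i"
    unfolding inverts_def swap_def transpose_def by (auto split: if_splits)
  then show ?thesis by (auto simp: doubleton_eq_iff)
qed

lemma reduced_prod_swap:
  assumes "perm n b"
  shows "reduced_prod (swap i) b \<longleftrightarrow> \<not> inverts b i (i + 1)"
proof -
  have "reduced_prod (swap i) b \<longleftrightarrow>
      \<not> inverts b (swap i i) (swap i (i + 1)) \<and> \<not> inverts b (swap i (i + 1)) (swap i i)"
    unfolding reduced_prod_def inverts_swap doubleton_eq_iff by blast
  then show ?thesis
    using inverts_sym[OF assms, of i "i + 1"] by simp
qed

lemma inv_count_swap: "i \<in> {1..<n} \<Longrightarrow> inv_count (swap i) = 2"
proof -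
  have "{(p, q). inverts (swap i) p q} = {(i, i + 1), (i + 1, i)}"
    unfolding inverts_swap doubleton_eq_iff by auto
  then show ?thesis
    unfolding inv_count_def by simp
qed

abbreviation sigmas :: "nat \<Rightarrow> braid_word set" where
  "sigmas n \<equiv> lists ({1..<n} \<times> {True})"

lemma word_perm_perm: "w \<in> lists (braid_letters n) \<Longrightarrow> perm n (word_perm w)"
  by (induction w) (auto simp: braid_letters_def intro!: perm_pmult swap_perm)

lemma sigmas_subset: "w \<in> sigmas n \<Longrightarrow> w \<in> lists (braid_letters n)"
  by (auto simp: braid_letters_def in_lists_conv_set)

lemma word_perm_append: "word_perm (u @ v) = word_perm u \<cdot> word_perm v"
  by (induction u) (simp_all add: pmult_assoc del: id_apply)

definition reduced_word :: "nat \<Rightarrow> braid_word \<Rightarrow> bool" where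
  "reduced_word n w \<longleftrightarrow> w \<in> sigmas n \<and> inv_count (word_perm w) = 2 * length w"

lemma reduced_perm: "reduced_word n w \<Longrightarrow> perm n (word_perm w)"
  by (simp add: reduced_word_def word_perm_perm sigmas_subset)

text \<open>Each letter changes the number of inverted pairs, counted in both orders, by two.\<close>
lemma inv_count_word_perm_le: "w \<in> sigmas n \<Longrightarrow> inv_count (word_perm w) \<le> 2 * length w"
proof (induction w)
  case (Cons x w)
  then have x: "fst x \<in> {1..<n}" and w: "w \<in> sigmas n" by auto
  show ?case
    using inv_count_pmult[OF swap_perm[OF x] word_perm_perm[OF sigmas_subset[OF w]]]
        inv_count_swap[OF x] Cons.IH[OF w]
    by simp
qed simp

lemma reduced_Nil [simp]: "reduced_word n []"
  by (simp add: reduced_word_def)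

lemma reduced_Cons:
  "reduced_word n ((i, s) # w) \<longleftrightarrow> s \<and> i \<in> {1..<n} \<and> reduced_word n w \<and> reduced_prod (swap i)
      (word_perm w)"
proof (cases "s \<and> i \<in> {1..<n} \<and> w \<in> sigmas n")
  case True
  then have i: "i \<in> {1..<n}" and w: "w \<in> sigmas n" by auto
  note p = swap_perm[OF i] word_perm_perm[OF sigmas_subset[OF w]]
  have "inv_count (swap i \<cdot> word_perm w) \<le> 2 + inv_count (word_perm w)"
    using inv_count_pmult[OF p] inv_count_swap[OF i] by simp
  then show ?thesis
    using True inv_count_word_perm_le[OF w] reduced_prod_iff_inv_count[OF p] inv_count_swap[OF i]
    unfolding reduced_word_def by auto
qed (auto simp: reduced_word_def)

lemma reduced_append:
  assumes "reduced_word n u" "reduced_word n v" "reduced_prod (word_perm u) (word_perm v)"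
  shows "reduced_word n (u @ v)"
  using assms reduced_prod_iff_inv_count[OF reduced_perm[OF assms(1)] reduced_perm[OF assms(2)]]
  by (simp add: reduced_word_def word_perm_append)

text \<open>Otherwise the permutation is strictly increasing.\<close>
lemma descent_exists:
  assumes a: "perm n a" and "a \<noteq> id"
  obtains i where "i \<in> {1..<n}" "inverts a i (i + 1)"
proof -
  have "\<exists>i\<in>{1..<n}. inverts a i (i + 1)"
  proof (rule ccontr)
    assume no: "\<not> ?thesis"
    have "a i < a (Suc i)" for i
    proof (cases "i \<in> {1..<n}")
      case True
      then show ?thesis
        using no by (auto simp: inverts_def)
    next
      case False
      then have "i \<notin> {1..n} \<or> Suc i \<notin> {1..n}" by auto
      then have "\<not> inverts a i (Suc i)"
        using inverts_range(1,2)[OF a] by blast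
      then show ?thesis by (simp add: inverts_def)
    qed
    then have "strict_mono a"
      by (simp add: strict_mono_Suc_iff)
    then have "\<not> inverts a p q" for p q
      by (simp add: inverts_def strict_mono_less)
    then show False
      using no_inversions_imp_id[OF a] \<open>a \<noteq> id\<close> by blast
  qed
  then show thesis using that by blast
qed

lemma reduced_word_exists:
  assumes "perm n a"
  obtains w where "reduced_word n w" "word_perm w = a"
proof -
  have "\<exists>w. reduced_word n w \<and> word_perm w = a"
    using assms
  proof (induction "inv_count a" arbitrary: a rule: less_induct)
    case less
    show ?case
    proof (cases "a = id")
      case True
      then show ?thesis by (intro exI[of _ "[]"]) simp
    next
      case False
      then obtain i where i: "i \<in> {1..<n}" "inverts a i (i + 1)"
        using descent_exists[OF less.prems] by blast
      define b where "b = swap i \<cdot> a"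
      have b: "perm n b"
        unfolding b_def by (intro perm_pmult swap_perm i less.prems)
      have sb: "swap i \<cdot> b = a"
        unfolding b_def by (rule swap_swap)
      have "inverts b i (i + 1) \<longleftrightarrow> \<not> inverts a (i + 1) i"
        unfolding b_def inverts_pmult inverts_swap by simp
      then have rd: "reduced_prod (swap i) b"
        using reduced_prod_swap[OF b] i(2) inverts_sym[OF less.prems, of i "i + 1"] by simp
      then have "inv_count a = 2 + inv_count b"
        using reduced_prod_iff_inv_count[OF swap_perm[OF i(1)] b] inv_count_swap[OF i(1)] sb by simp
      then obtain w where "reduced_word n w" "word_perm w = b"
        using less.hyps[of b] b by auto
      then show ?thesis
        using i(1) rd sb by (intro exI[of _ "(i, True) # w"]) (simp add: reduced_Cons)
    qed
  qed
  then show thesis using that by blast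
qed

lemma crossings_Cons:
  "crossings (x # w) p q =
     (if {p, q} = {fst x, fst x + 1} then 1 else 0) + crossings w (swap (fst x) p) (swap (fst x) q)"
proof -
  define P where "P k \<longleftrightarrow> {word_perm (take k (x # w)) p, word_perm (take k (x # w)) q} =
    {fst ((x # w) ! k), fst ((x # w) ! k) + 1}" for k
  have "{k. k < length (x # w) \<and> P k} =
      (if P 0 then {0} else {}) \<union> Suc ` {k. k < length w \<and> P (Suc k)}"
    by (auto simp: less_Suc_eq_0_disj)
  then have "card {k. k < length (x # w) \<and> P k} =
      card (if P 0 then {0 :: nat} else {}) + card (Suc ` {k. k < length w \<and> P (Suc k)})"
    by (simp only:) (intro card_Un_disjoint; auto)
  also have "card (Suc ` {k. k < length w \<and> P (Suc k)}) = card {k. k < length w \<and> P (Suc k)}"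
    by (rule card_image) simp
  finally have "crossings (x # w) p q = card (if P 0 then {0 :: nat} else {}) + card {k. k <
      length w \<and> P (Suc k)}"
    unfolding crossings_def P_def by blast
  moreover have "card {k. k < length w \<and> P (Suc k)} = crossings w (swap (fst x) p) (swap (fst x) q)"
    unfolding crossings_def P_def by (simp add: pmult_apply)
  moreover have "P 0 \<longleftrightarrow> {p, q} = {fst x, fst x + 1}"
    by (simp add: P_def)
  ultimately show ?thesis by simp
qed

text \<open>Each crossing of two strands exchanges their relative position.\<close>
lemma odd_crossings: "odd (crossings w p q) \<longleftrightarrow> inverts (word_perm w) p q"
proof (induction w arbitrary: p q)
  case Nil
  show ?case by (simp add: crossings_def inverts_def)
next
  case (Cons x w)
  then show ?case
    unfolding crossings_Cons word_perm_Cons inverts_pmult inverts_swap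
    by (cases "{p, q} = {fst x, fst x + 1}") simp_all
qed

text \<open>A first letter \<open>\<sigma>\<^sub>i\<close> adds one crossing of the strands \<open>i\<close> and \<open>i + 1\<close>. The rest of the
  word may not cross these strands again. As it crosses them at most once, parity decides:
  it must not invert them.\<close>
lemma non_repeating_iff_reduced:
  assumes "w \<in> sigmas n"
  shows "(\<forall>p\<in>{1..n}. \<forall>q\<in>{1..n}. p \<noteq> q \<longrightarrow> crossings w p q \<le> 1) \<longleftrightarrow> reduced_word n w"
  using assms
proof (induction w)
  case Nil
  show ?case by (simp add: crossings_def)
next
  case (Cons x w)
  obtain i where x: "x = (i, True)" and i: "i \<in> {1..<n}" and w: "w \<in> sigmas n"
    using Cons.hyps by (cases x) auto
  have i1: "i \<in> {1..n}" "i + 1 \<in> {1..n}" using i by auto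
  note s = swap_perm[OF i] and p = word_perm_perm[OF sigmas_subset[OF w]]
  define nr where "nr v \<longleftrightarrow> (\<forall>p\<in>{1..n}. \<forall>q\<in>{1..n}. p \<noteq> q \<longrightarrow> crossings v p q \<le> 1)" for v
  have c: "crossings (x # w) p q =
      (if {p, q} = {i, i + 1} then 1 else 0) + crossings w (swap i p) (swap i q)" for p q
    using crossings_Cons[of x w p q] by (simp add: x)
  have in_s: "swap i p \<in> {1..n} \<longleftrightarrow> p \<in> {1..n}" for p
    by (rule perm_in_image[OF s])
  have inj_s: "swap i p = swap i q \<longleftrightarrow> p = q" for p q
    using perm_inj[OF s] by (simp add: inj_eq)
  have "nr (x # w) \<longleftrightarrow> nr w \<and> \<not> inverts (word_perm w) i (i + 1)"
  proof
    assume *: "nr (x # w)"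
    have "nr w"
      unfolding nr_def
    proof (intro ballI impI)
      fix p q assume "p \<in> {1..n}" "q \<in> {1..n}" "p \<noteq> q"
      then have "crossings (x # w) (swap i p) (swap i q) \<le> 1"
        using * in_s[of p] in_s[of q] inj_s[of p q] unfolding nr_def by blast
      then show "crossings w p q \<le> 1"
        using c[of "swap i p" "swap i q"] by simp
    qed
    moreover have "crossings (x # w) i (i + 1) \<le> 1"
      using * i1 unfolding nr_def by simp
    then have "crossings w (i + 1) i = 0"
      using c[of i "i + 1"] by simp
    then have "\<not> inverts (word_perm w) (i + 1) i"
      unfolding odd_crossings[symmetric] by simp
    ultimately show "nr w \<and> \<not> inverts (word_perm w) i (i + 1)"
      using inverts_sym[OF p, of i "i + 1"] by simp
  next
    assume *: "nr w \<and> \<not> inverts (word_perm w) i (i + 1)"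
    have zero: "crossings w (swap i p) (swap i q) = 0" if "{p, q} = {i, i + 1}" for p q
    proof -
      have pq: "swap i p = i + 1 \<and> swap i q = i \<or> swap i p = i \<and> swap i q = i + 1"
        using that unfolding doubleton_eq_iff by auto
      then have "even (crossings w (swap i p) (swap i q))"
        using * inverts_sym[OF p, of i "i + 1"] odd_crossings[of w i "i + 1"]
            odd_crossings[of w "i + 1" i]
        by (elim disjE conjE) simp_all
      moreover have "crossings w (swap i p) (swap i q) \<le> 1"
        using * pq i1 unfolding nr_def by auto
      ultimately show ?thesis
        by (metis One_nat_def le_Suc_eq le_zero_eq odd_one)
    qed
    show "nr (x # w)"
      unfolding nr_def
    proof (intro ballI impI)
      fix p q assume pq: "p \<in> {1..n}" "q \<in> {1..n}" "p \<noteq> q"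
      then have "crossings w (swap i p) (swap i q) \<le> 1"
        using * in_s[of p] in_s[of q] inj_s[of p q] unfolding nr_def by blast
      then show "crossings (x # w) p q \<le> 1"
        using c[of p q] zero[of p q] by (cases "{p, q} = {i, i + 1}") simp_all
    qed
  qed
  then show ?case
    using Cons.IH i reduced_prod_swap[OF p, of i] unfolding x reduced_Cons nr_def by simp
qed

section \<open>Matsumoto's theorem\<close>

lemma braid_relations_in_lists:
  "(u, v) \<in> braid_relations n \<Longrightarrow> u \<in> lists (braid_letters n) \<and> v \<in> lists (braid_letters n)"
  by (auto simp: braid_relations_def braid_letters_def)

abbreviation bcong :: "nat \<Rightarrow> (braid_word \<times> braid_word) set" where
  "bcong n \<equiv> word_cong (braid_letters n) (braid_relations n)"

lemma bcong_rule: "(u, v) \<in> braid_relations n \<Longrightarrow> (u, v) \<in> bcong n"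
  using word_cong_rule[of u v "braid_relations n"] braid_relations_in_lists[of u v n] by simp

lemma bcong_far:
  assumes "i \<in> {1..<n}" "j \<in> {1..<n}" "i + 1 < j"
  shows "([(i, True), (j, True)], [(j, True), (i, True)]) \<in> bcong n"
proof (rule bcong_rule)
  have "\<bar>int i - int j\<bar> > 1" using assms(3) by simp
  then show "([(i, True), (j, True)], [(j, True), (i, True)]) \<in> braid_relations n"
    using assms(1,2) unfolding braid_relations_def by blast
qed

lemma bcong_braid:
  assumes "i \<in> {1..<n}" "i + 1 \<in> {1..<n}"
  shows "([(i, True), (i + 1, True), (i, True)], [(i + 1, True), (i, True), (i + 1, True)]) \<in>
      bcong n"
  unfolding braid_relations_def
  by (rule bcong_rule[unfolded braid_relations_def], rule UnI2, rule CollectI, intro exI[of _ i]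
      conjI refl assms)

lemma bcong_refl: "w \<in> sigmas n \<Longrightarrow> (w, w) \<in> bcong n"
  by (intro word_cong_refl sigmas_subset)

lemma swap_far:
  assumes "i + 1 < j"
  shows "swap i \<cdot> swap j = swap j \<cdot> swap i"
proof
  fix x
  consider "x = i" | "x = i + 1" | "x = j" | "x = j + 1" | "x \<notin> {i, i + 1, j, j + 1}" by blast
  then show "(swap i \<cdot> swap j) x = (swap j \<cdot> swap i) x"
    using assms by cases (simp_all add: pmult_apply swap_other)
qed

lemma swap_braid_eq:
  "swap i \<cdot> (swap (i + 1) \<cdot> swap i) = transpose i (i + 2)"
  "swap (i + 1) \<cdot> (swap i \<cdot> swap (i + 1)) = transpose i (i + 2)"
proof -
  have "(swap i \<cdot> (swap (i + 1) \<cdot> swap i)) x = transpose i (i + 2) x \<and>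
    (swap (i + 1) \<cdot> (swap i \<cdot> swap (i + 1))) x = transpose i (i + 2) x" for x
  proof -
    consider "x = i" | "x = i + 1" | "x = i + 2" | "x \<notin> {i, i + 1, i + 2}" by blast
    then show ?thesis
      by cases (simp_all add: pmult_apply swap_def)
  qed
  then show "swap i \<cdot> (swap (i + 1) \<cdot> swap i) = transpose i (i + 2)"
    "swap (i + 1) \<cdot> (swap i \<cdot> swap (i + 1)) = transpose i (i + 2)"
    by blast+
qed

lemma inverts_swap_far:
  assumes "i + 1 < j" "inverts (swap i \<cdot> swap j) p q"
  shows "{p, q} = {i, i + 1} \<or> {p, q} = {j, j + 1}"
proof (cases "{p, q} = {i, i + 1}")
  case False
  then have "{swap i p, swap i q} = {j, j + 1}"
    using assms(2) unfolding inverts_pmult inverts_swap by blast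
  moreover have "swap i r = t \<longleftrightarrow> r = swap i t" for r t
    by (metis swap_involution)
  moreover have "swap i j = j" "swap i (j + 1) = j + 1"
    using assms(1) by (simp_all add: swap_other)
  ultimately show ?thesis
    unfolding doubleton_eq_iff by metis
qed simp

lemma inverts_swap_braid:
  assumes "inverts (swap i \<cdot> (swap (i + 1) \<cdot> swap i)) p q"
  shows "{p, q} = {i, i + 1} \<or> {p, q} = {i + 1, i + 2} \<or> {p, q} = {i, i + 2}"
proof -
  have "p \<noteq> q"
    using assms by (auto simp: inverts_def)
  moreover have "p \<in> {i..i+2} \<and> q \<in> {i..i+2}"
    using assms unfolding inverts_def swap_braid_eq
    by (auto simp: transpose_def split: if_splits)
  ultimately have "p \<noteq> q" "p = i \<or> p = i + 1 \<or> p = i + 2" "q = i \<or> q = i + 1 \<or> q = i + 2"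
    by auto
  then show ?thesis
    unfolding doubleton_eq_iff by blast
qed

text \<open>Let the first letters \<open>\<sigma>\<^sub>i\<close> and \<open>\<sigma>\<^sub>j\<close> be different. The common permutation \<open>a\<close> inverts
  both \<open>i, i + 1\<close> and \<open>j, j + 1\<close>, hence all pairs that the longest element \<open>s\<close> of the
  subgroup generated by the two transpositions inverts, and \<open>a = s \<cdot> b\<close> is a reduced
  product. Put the two reduced words of \<open>s\<close> in front of a reduced word of \<open>b\<close>. The two words
  so obtained differ by one defining relation, and each of them has its first letter in
  common with one of the given words, so that the induction hypothesis applies to the rests.\<close>
lemma reduced_words_congruent:
  assumes "reduced_word n u" "reduced_word n v" "word_perm u = word_perm v"
  shows "(u, v) \<in> bcong n"
  using assms
proof (induction "length u" arbitrary: u v rule: less_induct)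
  case less
  have "length v = length u"
    using less.prems by (simp add: reduced_word_def)
  show ?case
  proof (cases u)
    case Nil
    then show ?thesis
      using \<open>length v = length u\<close> by (simp add: word_cong_refl)
  next
    case (Cons x u')
    then obtain y v' where v: "v = y # v'"
      using \<open>length v = length u\<close> by (cases v) auto
    obtain i where x: "x = (i, True)"
      using less.prems(1) unfolding Cons by (cases x) (auto simp: reduced_Cons)
    obtain j where y: "y = (j, True)"
      using less.prems(2) unfolding v by (cases y) (auto simp: reduced_Cons)
    (* Different first letters, in one of the two possible orders. *)
    have key: "((i, True) # u', (j, True) # v') \<in> bcong n"
      if ij: "i < j" and len: "length u' < length u" "length v' < length u"
        and u: "reduced_word n ((i, True) # u')" and v: "reduced_word n ((j, True) # v')"
        and eq: "word_perm ((i, True) # u') = word_perm ((j, True) # v')"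
      for i j u' v'
    proof -
      define a where "a = word_perm ((i, True) # u')"
      have i: "i \<in> {1..<n}" and u': "reduced_word n u'" and ru:
          "reduced_prod (swap i) (word_perm u')"
        using u by (simp_all add: reduced_Cons)
      have j: "j \<in> {1..<n}" and v': "reduced_word n v'" and rv:
          "reduced_prod (swap j) (word_perm v')"
        using v by (simp_all add: reduced_Cons)
      have a: "perm n a"
        unfolding a_def by (rule reduced_perm[OF u])
      have au: "a = swap i \<cdot> word_perm u'" and av: "a = swap j \<cdot> word_perm v'"
        using eq by (simp_all add: a_def)
      have invi: "inverts a i (i + 1)" and invj: "inverts a j (j + 1)"
        using weak_le_pmult[of "swap i" "word_perm u'"] weak_le_pmult[of "swap j" "word_perm v'"]
            ru rv
        unfolding au[symmetric] av[symmetric] weak_le_def inverts_swap by auto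
      have pu: "word_perm u' = swap i \<cdot> a" and pv: "word_perm v' = swap j \<cdot> a"
        by (subst au, simp add: swap_swap) (subst av, simp add: swap_swap)
      show ?thesis
      proof (cases "i + 1 < j")
        case True
        define s where "s = swap i \<cdot> swap j"
        have s: "perm n s"
          unfolding s_def by (intro perm_pmult swap_perm i j)
        define b where "b = pinv s \<cdot> a"
        have b: "perm n b"
          unfolding b_def by (intro perm_pmult perm_pinv s a)
        have sb: "s \<cdot> b = a"
          unfolding b_def by (rule pmult_pinv_cancel(1)[OF s])
        have "weak_le s a"
          unfolding weak_le_def
        proof (intro allI impI)
          fix p q assume "inverts s p q"
          then have "{p, q} = {i, i + 1} \<or> {p, q} = {j, j + 1}"
            using inverts_swap_far[OF True] by (simp add: s_def)
          then show "inverts a p q"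
            using invi invj inverts_sym[OF a] unfolding doubleton_eq_iff by blast
        qed
        then have "reduced_prod s b"
          using weak_le_pmult[of s b] sb by simp
        moreover have "reduced_prod (swap i) (swap j)"
          using reduced_prod_swap[OF swap_perm[OF j], of i] True unfolding inverts_swap
              doubleton_eq_iff by simp
        moreover have "reduced_prod (swap j) (swap i)"
          using reduced_prod_swap[OF swap_perm[OF i], of j] True unfolding inverts_swap
              doubleton_eq_iff by simp
        ultimately have rb: "reduced_prod (swap j) b" "reduced_prod (swap i) b"
          using reduced_prod_assoc[OF swap_perm[OF i], of "swap j" b]
              reduced_prod_assoc[OF swap_perm[OF j], of "swap i" b]
            swap_far[OF True] unfolding s_def by simp_all
        obtain w where w: "reduced_word n w" "word_perm w = b"
          using reduced_word_exists[OF b] .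
        have "swap i \<cdot> a = swap j \<cdot> b" "swap j \<cdot> a = swap i \<cdot> b"
          unfolding sb[symmetric] s_def using swap_far[OF True]
              by (simp_all add: pmult_assoc swap_swap)
            (metis pmult_assoc swap_swap(1))
        then have cu: "(u', (j, True) # w) \<in> bcong n" and cv: "(v', (i, True) # w) \<in> bcong n"
          using w rb i j pu pv u' v' len by (auto intro!: less.hyps simp: reduced_Cons)
        have sw: "w \<in> sigmas n" using w(1) by (simp add: reduced_word_def)
        have si: "[(i, True)] \<in> sigmas n" and sj: "[(j, True)] \<in> sigmas n" using i j by auto
        have "([(i, True)] @ u', [(i, True)] @ (j, True) # w) \<in> bcong n"
          by (intro word_cong_append cu bcong_refl si)
        also have "([(i, True)] @ (j, True) # w, [(j, True)] @ (i, True) # w) \<in> bcong n"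
          using word_cong_append[OF bcong_far[OF i j True] bcong_refl[OF sw]] by simp
        also have "([(j, True)] @ (i, True) # w, [(j, True)] @ v') \<in> bcong n"
          by (intro word_cong_append word_cong_sym[OF cv] bcong_refl sj)
        finally show ?thesis by simp
      next
        case False
        then have ji: "j = i + 1" using ij by simp
        define s where "s = swap i \<cdot> (swap j \<cdot> swap i)"
        have s': "s = swap j \<cdot> (swap i \<cdot> swap j)"
          unfolding s_def ji swap_braid_eq ..
        have s: "perm n s"
          unfolding s_def by (intro perm_pmult swap_perm i j)
        define b where "b = pinv s \<cdot> a"
        have b: "perm n b"
          unfolding b_def by (intro perm_pmult perm_pinv s a)
        have sb: "s \<cdot> b = a"
          unfolding b_def by (rule pmult_pinv_cancel(1)[OF s])
        have "inverts a i (i + 2)"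
          using invi invj unfolding ji inverts_def by simp
        have "weak_le s a"
          unfolding weak_le_def
        proof (intro allI impI)
          fix p q assume "inverts s p q"
          then have "{p, q} = {i, i + 1} \<or> {p, q} = {i + 1, i + 2} \<or> {p, q} = {i, i + 2}"
            using inverts_swap_braid by (simp add: s_def ji)
          then show "inverts a p q"
            using invi invj \<open>inverts a i (i + 2)\<close> inverts_sym[OF a] unfolding ji doubleton_eq_iff
            by (metis add.assoc one_add_one)
        qed
        then have sbr: "reduced_prod s b"
          using weak_le_pmult[of s b] sb by simp
        have ns: "\<not> inverts (swap j) i (i + 1)" "\<not> inverts (swap i) (i + 1) (i + 2)"
          "swap j i = i" "swap j (i + 1) = i + 2" "swap i (i + 1) = i" "swap i (i + 2) = i + 2"
          "\<not> inverts (swap i) i (i + 2)" "\<not> inverts (swap j) i (i + 2)"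
          unfolding inverts_swap doubleton_eq_iff ji by (simp_all add: swap_def)
        have "reduced_prod (swap i) (swap j)" "reduced_prod (swap j) (swap i)"
          using reduced_prod_swap[OF swap_perm[OF j], of i]
              reduced_prod_swap[OF swap_perm[OF i], of j] ns
          unfolding ji by simp_all
        moreover have "reduced_prod (swap i) (swap j \<cdot> swap i)"
            "reduced_prod (swap j) (swap i \<cdot> swap j)"
          using reduced_prod_swap[OF perm_pmult[OF swap_perm[OF j] swap_perm[OF i]], of i]
            reduced_prod_swap[OF perm_pmult[OF swap_perm[OF i] swap_perm[OF j]], of j] ns
          unfolding inverts_pmult ji by simp_all
        ultimately have rb: "reduced_prod (swap i) b" "reduced_prod (swap j) (swap i \<cdot> b)"
            "reduced_prod (swap j) b" "reduced_prod (swap i) (swap j \<cdot> b)"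
          using sbr reduced_prod_assoc[OF swap_perm[OF i], of "swap j \<cdot> swap i" b]
              reduced_prod_assoc[OF swap_perm[OF j], of "swap i" b]
            reduced_prod_assoc[OF swap_perm[OF j], of "swap i \<cdot> swap j" b]
                reduced_prod_assoc[OF swap_perm[OF i], of "swap j" b]
          unfolding s_def[symmetric] s'[symmetric] by blast+
        obtain w where w: "reduced_word n w" "word_perm w = b"
          using reduced_word_exists[OF b] .
        have sw: "w \<in> sigmas n" using w(1) by (simp add: reduced_word_def)
        have pu': "swap i \<cdot> a = swap j \<cdot> (swap i \<cdot> b)"
          unfolding sb[symmetric] s_def by (simp only: pmult_assoc swap_swap)
        have pv': "swap j \<cdot> a = swap i \<cdot> (swap j \<cdot> b)"
          unfolding sb[symmetric] s' by (simp only: pmult_assoc swap_swap)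
        have ru: "reduced_word n ((j, True) # (i, True) # w)" and rv:
            "reduced_word n ((i, True) # (j, True) # w)"
          using rb w i j by (simp_all add: reduced_Cons)
        have cu: "(u', (j, True) # (i, True) # w) \<in> bcong n" and cv:
            "(v', (i, True) # (j, True) # w) \<in> bcong n"
          using ru rv pu pu' pv pv' u' v' len w(2) by (auto intro!: less.hyps)
        have si: "[(i, True)] \<in> sigmas n" and sj: "[(j, True)] \<in> sigmas n" using i j by auto
        have "([(i, True)] @ u', [(i, True)] @ (j, True) # (i, True) # w) \<in> bcong n"
          by (intro word_cong_append cu bcong_refl si)
        also have "([(i, True)] @ (j, True) # (i, True) # w, [(j, True)] @ (i, True) # (j, True) #
            w) \<in> bcong n"
          using word_cong_append[OF bcong_braid[of i n] bcong_refl[OF sw]] i j by (simp add: ji)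
        also have "([(j, True)] @ (i, True) # (j, True) # w, [(j, True)] @ v') \<in> bcong n"
          by (intro word_cong_append word_cong_sym[OF cv] bcong_refl sj)
        finally show ?thesis by simp
      qed
    qed
    have lens: "length u' < length u" "length v' < length u"
      using Cons v \<open>length v = length u\<close> by simp_all
    consider "i < j" | "j < i" | "i = j" by linarith
    then show ?thesis
    proof cases
      case 1
      show ?thesis
        using key[OF 1 lens] less.prems unfolding Cons v x y by blast
    next
      case 2
      show ?thesis
        using word_cong_sym[OF key[OF 2 lens(2,1)]] less.prems unfolding Cons v x y by simp
    next
      case 3
      have "swap i \<cdot> (swap i \<cdot> word_perm u') = swap i \<cdot> (swap i \<cdot> word_perm v')"
        using less.prems(3) unfolding Cons v x y 3 by simp
      then have eq: "word_perm u' = word_perm v'"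
        by (simp only: swap_swap)
      have "reduced_word n u'" "reduced_word n v'"
        using less.prems(1,2) unfolding Cons v x y by (simp_all add: reduced_Cons)
      then have "(u', v') \<in> bcong n"
        using less.hyps[OF lens(1) _ _ eq] by blast
      moreover have "[(j, True)] \<in> sigmas n"
        using less.prems(2) unfolding v y by (simp add: reduced_Cons)
      ultimately show ?thesis
        using word_cong_append[OF bcong_refl] unfolding Cons v x y 3 by fastforce
    qed
  qed
qed

section \<open>The braid group\<close>

lemma carrier_Br: "carrier (Br n) = braid_of n ` lists (braid_letters n)"
  unfolding Br_def braid_of_def by (rule carrier_presented)

lemma one_Br: "\<one>\<^bsub>Br n\<^esub> = braid_of n []"
  unfolding Br_def braid_of_def by (rule one_presented)

lemma mult_Br:
  assumes "u \<in> lists (braid_letters n)" "v \<in> lists (braid_letters n)"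
  shows "braid_of n u \<otimes>\<^bsub>Br n\<^esub> braid_of n v = braid_of n (u @ v)"
  unfolding Br_def braid_of_def using assms by (rule mult_presented)

lemma braid_of_eq_iff:
  assumes "u \<in> lists (braid_letters n)" "v \<in> lists (braid_letters n)"
  shows "braid_of n u = braid_of n v \<longleftrightarrow> (u, v) \<in> bcong n"
  unfolding braid_of_def using assms by (rule cls_eq_iff)

definition inverse_word :: "braid_word \<Rightarrow> braid_word" where
  "inverse_word w = rev (map (\<lambda>(i, s). (i, \<not> s)) w)"

lemma inverse_word_simps:
  "inverse_word [] = []" "inverse_word ((i, s) # w) = inverse_word w @ [(i, \<not> s)]"
  by (simp_all add: inverse_word_def)

lemma inverse_inverse_word [simp]: "inverse_word (inverse_word w) = w"
  by (simp add: inverse_word_def rev_map case_prod_unfold o_def)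

lemma inverse_word_in_lists: "w \<in> lists (braid_letters n) \<Longrightarrow> inverse_word w \<in> lists (braid_letters
    n)"
  by (auto simp: inverse_word_def braid_letters_def in_lists_conv_set)

lemma append_inverse_word:
  assumes "w \<in> lists (braid_letters n)"
  shows "(w @ inverse_word w, []) \<in> bcong n"
  using assms
proof (induction w)
  case Nil
  show ?case by (simp add: inverse_word_simps word_cong_refl)
next
  case (Cons x w)
  obtain i s where x: "x = (i, s)" by (cases x)
  then have i: "i \<in> {1..<n}" using Cons.hyps by (auto simp: braid_letters_def)
  have l: "[(i, s)] \<in> lists (braid_letters n)" for s using i by (simp add: braid_letters_def)
  have "([(i, s)] @ (w @ inverse_word w) @ [(i, \<not> s)], [(i, s)] @ [] @ [(i, \<not> s)]) \<in> bcong n"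
    by (intro word_cong_context Cons.IH l)
  also have "([(i, s)] @ [] @ [(i, \<not> s)], []) \<in> bcong n"
  proof (rule bcong_rule)
    show "([(i, s)] @ [] @ [(i, \<not> s)], []) \<in> braid_relations n"
      unfolding braid_relations_def
      by (rule UnI1, rule UnI1, rule CollectI, intro exI[of _ i] exI[of _ s]) (use i in simp)
  qed
  finally show ?case
    by (simp add: x inverse_word_simps)
qed

lemma monoid_Br: "monoid (Br n)"
  unfolding Br_def by (rule monoid_presented)

lemma braid_of_inverse:
  assumes "w \<in> lists (braid_letters n)"
  shows "braid_of n (inverse_word w) \<otimes>\<^bsub>Br n\<^esub> braid_of n w = \<one>\<^bsub>Br n\<^esub>"
proof -
  note iw = inverse_word_in_lists[OF assms]
  have "(inverse_word w @ w, []) \<in> bcong n"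
    using append_inverse_word[OF iw] by simp
  then show ?thesis
    unfolding mult_Br[OF iw assms] one_Br using iw assms by (subst braid_of_eq_iff) simp_all
qed

lemma group_Br: "group (Br n)"
proof (rule monoid.group_l_invI[OF monoid_Br])
  fix x assume "x \<in> carrier (Br n)"
  then obtain w where "w \<in> lists (braid_letters n)" "x = braid_of n w"
    unfolding carrier_Br by blast
  then show "\<exists>y\<in>carrier (Br n). y \<otimes>\<^bsub>Br n\<^esub> x = \<one>\<^bsub>Br n\<^esub>"
    using braid_of_inverse[of w n] inverse_word_in_lists[of w n] unfolding carrier_Br by blast
qed

lemma inv_braid_of:
  assumes "w \<in> lists (braid_letters n)"
  shows "inv\<^bsub>Br n\<^esub> (braid_of n w) = braid_of n (inverse_word w)"
proof -
  have "braid_of n w \<in> carrier (Br n)" "braid_of n (inverse_word w) \<in> carrier (Br n)"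
    using assms inverse_word_in_lists[OF assms] unfolding carrier_Br by simp_all
  then show ?thesis
    using group.inv_equality[OF group_Br braid_of_inverse[OF assms]] by blast
qed

lemma braid_relations_cases:
  assumes "(u, v) \<in> braid_relations n"
  obtains (inverse) i s where "i \<in> {1..<n}" "u = [(i, s), (i, \<not> s)]" "v = []"
  | (far) i j where "i \<in> {1..<n}" "j \<in> {1..<n}" "\<bar>int i - int j\<bar> > 1"
      "u = [(i, True), (j, True)]" "v = [(j, True), (i, True)]"
  | (braid) i where "i \<in> {1..<n}" "i + 1 \<in> {1..<n}"
      "u = [(i, True), (i + 1, True), (i, True)]" "v = [(i + 1, True), (i, True), (i + 1, True)]"
proof -
  note that' = that
  consider "(u, v) \<in> {([(i, s), (i, \<not> s)], []) | i s. i \<in> {1..<n}}"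
    | "(u, v) \<in> {([(i, True), (j, True)], [(j, True), (i, True)]) | i j.
        i \<in> {1..<n} \<and> j \<in> {1..<n} \<and> \<bar>int i - int j\<bar> > 1}"
    | "(u, v) \<in> {([(i, True), (i + 1, True), (i, True)], [(i + 1, True), (i, True), (i + 1,
        True)]) | i.
        i \<in> {1..<n} \<and> i + 1 \<in> {1..<n}}"
    using assms unfolding braid_relations_def by (elim UnE)
  then show thesis
  proof cases
    case 1
    then show ?thesis by (elim CollectE exE conjE Pair_inject) (rule that'(1))
  next
    case 2
    then show ?thesis by (elim CollectE exE conjE Pair_inject) (rule that'(2))
  next
    case 3
    then show ?thesis by (elim CollectE exE conjE Pair_inject) (rule that'(3))
  qed
qed

lemma swap_braid: "swap i \<cdot> (swap (i + 1) \<cdot> swap i) = swap (i + 1) \<cdot> (swap i \<cdot> swap (i + 1))"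
  by (simp only: swap_braid_eq)

lemma word_perm_cong: "(u, v) \<in> bcong n \<Longrightarrow> word_perm u = word_perm v"
proof (erule word_cong_invariant)
  fix p q u v assume "(u, v) \<in> braid_relations n"
  then have "word_perm u = word_perm v"
  proof (cases rule: braid_relations_cases)
    case (far i j)
    then have "i + 1 < j \<or> j + 1 < i" by linarith
    then show ?thesis
      using swap_far[of i j] swap_far[of j i] unfolding far by auto
  next
    case (braid i)
    then show ?thesis
      using swap_braid[of i] by simp
  qed (simp add: swap_swap)
  then show "word_perm (p @ u @ q) = word_perm (p @ v @ q)"
    by (simp add: word_perm_append)
qed

text \<open>Tells \<open>\<Omega>\<^sup>-\<^sup>1\<close> from the positive braids.\<close>
definition exponent_sum :: "braid_word \<Rightarrow> int" where
  "exponent_sum w = (\<Sum>x\<leftarrow>w. if snd x then 1 else -1)"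

lemma exponent_sum_cong: "(u, v) \<in> bcong n \<Longrightarrow> exponent_sum u = exponent_sum v"
proof (erule word_cong_invariant)
  fix p q u v assume "(u, v) \<in> braid_relations n"
  then show "exponent_sum (p @ u @ q) = exponent_sum (p @ v @ q)"
    by (cases rule: braid_relations_cases) (simp_all add: exponent_sum_def)
qed

lemma exponent_sum_inverse_word: "exponent_sum (inverse_word w) = - exponent_sum w"
  by (induction w) (auto simp: exponent_sum_def inverse_word_simps)

lemma exponent_sum_sigmas: "w \<in> sigmas n \<Longrightarrow> exponent_sum w = int (length w)"
  by (induction w) (auto simp: exponent_sum_def)

section \<open>Permutation braids\<close>

lemma reduced_in_lists: "reduced_word n w \<Longrightarrow> w \<in> lists (braid_letters n)"
  using sigmas_subset[of w n] unfolding reduced_word_def by simp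

lemma braid_perm_braid_of:
  assumes "w \<in> lists (braid_letters n)"
  shows "braid_perm (braid_of n w) = word_perm w"
proof -
  have "word_perm ` braid_of n w = {word_perm w}"
  proof
    show "word_perm ` braid_of n w \<subseteq> {word_perm w}"
      unfolding braid_of_def by (intro image_subsetI) (simp add: word_perm_cong[symmetric])
    have "w \<in> braid_of n w"
      using word_cong_refl[OF assms] unfolding braid_of_def by simp
    then show "{word_perm w} \<subseteq> word_perm ` braid_of n w"
      by blast
  qed
  then show ?thesis
    by (simp add: braid_perm_def)
qed

lemma non_repeating_braids_eq: "non_repeating_braids n = {braid_of n w | w. reduced_word n w}"
proof -
  have "w \<in> sigmas n \<and> (\<forall>p\<in>{1..n}. \<forall>q\<in>{1..n}. p \<noteq> q \<longrightarrow> crossings w p q \<le> 1) \<longleftrightarrow> reduced_word n w" for w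
    using non_repeating_iff_reduced[of w n] reduced_word_def[of n w] by blast
  then show ?thesis
    unfolding non_repeating_braids_def by simp
qed

lemma non_repeating_reduced_word:
  assumes "B \<in> non_repeating_braids n"
  obtains w where "reduced_word n w" "B = braid_of n w"
  using assms unfolding non_repeating_braids_eq by blast

text \<open>That the definite description in \<open>perm_braid\<close> denotes is Matsumoto's theorem.\<close>
lemma perm_braid_word_perm:
  assumes w: "reduced_word n w"
  shows "perm_braid n (word_perm w) = braid_of n w"
  unfolding perm_braid_def
proof (rule the_equality)
  show "braid_of n w \<in> non_repeating_braids n \<and> braid_perm (braid_of n w) = word_perm w"
    using w braid_perm_braid_of[OF reduced_in_lists[OF w]] unfolding non_repeating_braids_eq
        by blast
next
  fix B assume B: "B \<in> non_repeating_braids n \<and> braid_perm B = word_perm w"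
  then obtain v where v: "reduced_word n v" "B = braid_of n v"
    unfolding non_repeating_braids_eq by blast
  then have "word_perm v = word_perm w"
    using B braid_perm_braid_of[OF reduced_in_lists[OF v(1)]] by simp
  then show "B = braid_of n w"
    using reduced_words_congruent[OF v(1) w] v(2)
      braid_of_eq_iff[OF reduced_in_lists[OF v(1)] reduced_in_lists[OF w]] by simp
qed

lemma perm_braid_obtain:
  assumes "perm n a"
  obtains w where "reduced_word n w" "word_perm w = a" "perm_braid n a = braid_of n w"
proof -
  obtain w where w: "reduced_word n w" "word_perm w = a"
    using reduced_word_exists[OF assms] .
  then show thesis
    using that[OF w] perm_braid_word_perm[OF w(1)] by simp
qed

lemma braid_perm_perm_braid:
  assumes "perm n a"
  shows "braid_perm (perm_braid n a) = a"
proof -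
  obtain w where w: "reduced_word n w" "word_perm w = a" "perm_braid n a = braid_of n w"
    using perm_braid_obtain[OF assms] .
  show ?thesis
    using braid_perm_braid_of[OF reduced_in_lists[OF w(1)]] w(2,3) by simp
qed

lemma perm_braid_non_repeating:
  assumes "perm n a"
  shows "perm_braid n a \<in> non_repeating_braids n"
proof -
  obtain w where w: "reduced_word n w" "word_perm w = a" "perm_braid n a = braid_of n w"
    using perm_braid_obtain[OF assms] .
  then show ?thesis
    unfolding non_repeating_braids_eq by blast
qed

lemma non_repeating_braid_cases:
  assumes "B \<in> non_repeating_braids n"
  obtains a where "perm n a" "B = perm_braid n a"
proof -
  obtain w where w: "reduced_word n w" "B = braid_of n w"
    using assms unfolding non_repeating_braids_eq by blast
  then show thesis
    using that[OF reduced_perm[OF w(1)]] perm_braid_word_perm[OF w(1)] by simp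
qed

lemma perm_braid_closed:
  assumes "perm n a"
  shows "perm_braid n a \<in> carrier (Br n)"
proof -
  obtain w where w: "reduced_word n w" "word_perm w = a" "perm_braid n a = braid_of n w"
    using perm_braid_obtain[OF assms] .
  show ?thesis
    unfolding carrier_Br w(3) by (rule imageI[OF reduced_in_lists[OF w(1)]])
qed

lemma perm_braid_id: "perm_braid n id = \<one>\<^bsub>Br n\<^esub>"
  using perm_braid_word_perm[of n "[]"] by (simp add: one_Br)

lemma perm_braid_mult:
  assumes "perm n a" "perm n b" "reduced_prod a b"
  shows "perm_braid n a \<otimes>\<^bsub>Br n\<^esub> perm_braid n b = perm_braid n (a \<cdot> b)"
proof -
  obtain u where u: "reduced_word n u" "word_perm u = a" "perm_braid n a = braid_of n u"
    using perm_braid_obtain[OF assms(1)] .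
  obtain v where v: "reduced_word n v" "word_perm v = b" "perm_braid n b = braid_of n v"
    using perm_braid_obtain[OF assms(2)] .
  have "reduced_word n (u @ v)"
    using reduced_append[OF u(1) v(1)] assms(3) u(2) v(2) by simp
  then have "perm_braid n (a \<cdot> b) = braid_of n (u @ v)"
    using perm_braid_word_perm[of n "u @ v"] by (simp add: word_perm_append u(2) v(2))
  then show ?thesis
    using mult_Br[OF reduced_in_lists[OF u(1)] reduced_in_lists[OF v(1)]] u(3) v(3) by simp
qed

lemma perm_braid_inj: "perm n a \<Longrightarrow> perm n b \<Longrightarrow> perm_braid n a = perm_braid n b \<longleftrightarrow> a = b"
  using braid_perm_perm_braid[of n a] braid_perm_perm_braid[of n b] by metis

lemma perm_braid_asymp_bowtie:
  assumes "perm n a" "perm n b"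
  shows "perm_braid n (asymp_op n a b) \<otimes>\<^bsub>Br n\<^esub> perm_braid n (bowtie_op n a b) =
    perm_braid n a \<otimes>\<^bsub>Br n\<^esub> perm_braid n b"
proof -
  interpret group "Br n" by (rule group_Br)
  note t = tail_perm[OF assms] and p = asymp_properties[OF assms]
  have "perm_braid n (bowtie_op n a b) = perm_braid n (tail n a b) \<otimes>\<^bsub>Br n\<^esub> perm_braid n b"
    using perm_braid_mult[OF t assms(2) reduced_prod_tail[OF assms]] by (simp add: bowtie_eq)
  moreover have "perm_braid n a = perm_braid n (asymp_op n a b) \<otimes>\<^bsub>Br n\<^esub> perm_braid n (tail n a b)"
    using perm_braid_mult[OF p(1) t p(3)] unfolding p(2)[symmetric] by (rule sym)
  ultimately show ?thesis
    using perm_braid_closed[OF p(1)] perm_braid_closed[OF t] perm_braid_closed[OF assms(2)]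
    by (simp add: m_assoc)
qed

text \<open>With \<open>c = a\<^sup>-\<^sup>1 \<cdot> \<omega>\<close>, both \<open>a \<cdot> c\<close> and \<open>c \<cdot> twist n a\<close> are reduced factorizations of
  \<open>\<omega>\<close>, so that \<open>R\<^sub>a \<Omega>\<close> and \<open>\<Omega> R\<^bsub>twist n a\<^esub>\<close> are both equal to \<open>R\<^sub>a R\<^sub>c R\<^bsub>twist n a\<^esub>\<close>.\<close>
lemma Garside_commute:
  assumes a: "perm n a"
  shows "perm_braid n a \<otimes>\<^bsub>Br n\<^esub> Garside n = Garside n \<otimes>\<^bsub>Br n\<^esub> perm_braid n (twist n a)"
proof -
  interpret group "Br n" by (rule group_Br)
  note w = perm_omega[of n]
  define c where "c = pinv a \<cdot> omega n"
  have c: "perm n c"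
    unfolding c_def by (intro perm_pmult perm_pinv a w)
  have ac: "a \<cdot> c = omega n"
    unfolding c_def by (rule pmult_pinv_cancel(1)[OF a])
  have "c \<cdot> twist n a = pinv a \<cdot> (omega n \<cdot> omega n) \<cdot> a \<cdot> omega n"
    unfolding c_def twist_def by (simp only: pmult_assoc)
  also have "\<dots> = omega n"
    by (simp add: omega_omega pmult_pinv(2)[OF a])
  finally have ct: "c \<cdot> twist n a = omega n" .
  have 1: "perm_braid n a \<otimes>\<^bsub>Br n\<^esub> perm_braid n c = Garside n"
    using perm_braid_mult[OF a c reduced_prod_if_prod_omega[OF a c ac]] ac
        by (simp add: Garside_def)
  have 2: "perm_braid n c \<otimes>\<^bsub>Br n\<^esub> perm_braid n (twist n a) = Garside n"
    using perm_braid_mult[OF c twist_perm[OF a] reduced_prod_if_prod_omega[OF c twist_perm[OF a]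
        ct]] ct
    by (simp add: Garside_def)
  show ?thesis
    using m_assoc[OF perm_braid_closed[OF a] perm_braid_closed[OF c] perm_braid_closed[OF
        twist_perm[OF a]]]
    unfolding 1 2 by simp
qed

lemma Garside_closed: "Garside n \<in> carrier (Br n)"
  unfolding Garside_def by (rule perm_braid_closed[OF perm_omega])

lemma inv_Garside_commute:
  assumes a: "perm n a"
  shows "inv\<^bsub>Br n\<^esub> Garside n \<otimes>\<^bsub>Br n\<^esub> perm_braid n a =
    perm_braid n (twist n a) \<otimes>\<^bsub>Br n\<^esub> inv\<^bsub>Br n\<^esub> Garside n"
proof -
  interpret group "Br n" by (rule group_Br)
  note closed = Garside_closed[of n] perm_braid_closed[OF a] perm_braid_closed[OF twist_perm[OF a]]
  have "inv\<^bsub>Br n\<^esub> Garside n \<otimes>\<^bsub>Br n\<^esub> (perm_braid n a \<otimes>\<^bsub>Br n\<^esub> Garside n) = perm_braid n (twist n a)"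
    unfolding Garside_commute[OF a] using closed by (simp add: m_assoc[symmetric])
  then have "inv\<^bsub>Br n\<^esub> Garside n \<otimes>\<^bsub>Br n\<^esub> perm_braid n a \<otimes>\<^bsub>Br n\<^esub> Garside n = perm_braid n (twist n
      a)"
    using closed by (simp add: m_assoc)
  then show ?thesis
    using inv_solve_right[OF m_closed[OF inv_closed[OF closed(1)] closed(2)] closed(3) closed(1)]
        closed
    by simp
qed

text \<open>A non-repeating braid has exponent sum at least zero, but that of \<open>\<Omega>\<^sup>-\<^sup>1\<close> is negative.\<close>
lemma inv_Garside_not_non_repeating:
  assumes "n \<ge> 2"
  shows "inv\<^bsub>Br n\<^esub> Garside n \<notin> non_repeating_braids n"
proof
  assume "inv\<^bsub>Br n\<^esub> Garside n \<in> non_repeating_braids n"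
  then obtain v where v: "reduced_word n v" "inv\<^bsub>Br n\<^esub> Garside n = braid_of n v"
    by (rule non_repeating_reduced_word)
  obtain w where w: "reduced_word n w" "word_perm w = omega n"
      "perm_braid n (omega n) = braid_of n w"
    using perm_braid_obtain[OF perm_omega[of n]] .
  note wl = reduced_in_lists[OF w(1)]
  have "braid_of n v = braid_of n (inverse_word w)"
    using v(2) inv_braid_of[OF wl] w(3) by (simp add: Garside_def)
  then have "(v, inverse_word w) \<in> bcong n"
    using braid_of_eq_iff[OF reduced_in_lists[OF v(1)] inverse_word_in_lists[OF wl]] by simp
  then have "exponent_sum v = - exponent_sum w"
    using exponent_sum_cong[of v "inverse_word w"] exponent_sum_inverse_word[of w] by simp
  moreover have "v \<in> sigmas n" "w \<in> sigmas n"
    using v(1) w(1) unfolding reduced_word_def by simp_all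
  ultimately have "int (length v) = - int (length w)"
    using exponent_sum_sigmas[of v n] exponent_sum_sigmas[of w n] by simp
  then have "length w = 0" by linarith
  then have "w = []" by simp
  then show False
    using w(2) omega_neq_id[OF assms] by (simp del: id_apply)
qed

section \<open>The flip\<close>

definition flip_letter :: "nat \<Rightarrow> nat \<times> bool \<Rightarrow> nat \<times> bool" where
  "flip_letter n = (\<lambda>(i, s). (n - i, s))"

lemma flip_letter_simps [simp]: "flip_letter n (i, s) = (n - i, s)"
  by (simp add: flip_letter_def)

lemma flip_letter_in: "x \<in> braid_letters n \<Longrightarrow> flip_letter n x \<in> braid_letters n"
  by (auto simp: braid_letters_def)

lemma flip_letter_involution: "x \<in> braid_letters n \<Longrightarrow> flip_letter n (flip_letter n x) = x"
  by (auto simp: braid_letters_def)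

lemma flip_word_involution:
  "w \<in> lists (braid_letters n) \<Longrightarrow> map (flip_letter n) (map (flip_letter n) w) = w"
  by (induction w) (auto simp: flip_letter_involution)

lemma flip_cong:
  assumes "(u, v) \<in> bcong n"
  shows "(map (flip_letter n) u, map (flip_letter n) v) \<in> bcong n"
proof -
  have cm: "concat (map (\<lambda>x. [flip_letter n x]) w) = map (flip_letter n) w" for w
    by (induction w) simp_all
  have "(concat (map (\<lambda>x. [flip_letter n x]) u), concat (map (\<lambda>x. [flip_letter n x]) v)) \<in> bcong n"
  proof (rule word_cong_morphism[OF _ _ assms])
    show "[flip_letter n x] \<in> lists (braid_letters n)" if "x \<in> braid_letters n" for x
      using flip_letter_in[OF that] by simp
  next
    fix u v assume "(u, v) \<in> braid_relations n"
    then have "(map (flip_letter n) u, map (flip_letter n) v) \<in> bcong n"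
    proof (cases rule: braid_relations_cases)
      case (inverse i s)
      have "([(n - i, s), (n - i, \<not> s)], []) \<in> bcong n"
        using append_inverse_word[of "[(n - i, s)]" n] flip_letter_in[of "(i, s)" n] inverse(1)
        by (simp add: inverse_word_simps) (simp add: braid_letters_def)
      then show ?thesis unfolding inverse(2,3) by simp
    next
      case (far i j)
      have "n - i \<in> {1..<n}" "n - j \<in> {1..<n}" "n - i + 1 < n - j \<or> n - j + 1 < n - i"
        using far(1-3) by auto
      then have "([(n - i, True), (n - j, True)], [(n - j, True), (n - i, True)]) \<in> bcong n"
        using bcong_far[of "n - i" n "n - j"] word_cong_sym[OF bcong_far[of "n - j" n "n - i"]]
            by blast
      then show ?thesis
        unfolding far(4,5) by simp
    next
      case (braid i)
      define k where "k = n - (i + 1)"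
      have "k \<in> {1..<n}" "k + 1 \<in> {1..<n}" "n - i = k + 1" "n - Suc i = k"
        using braid(1,2) by (auto simp: k_def)
      then show ?thesis
        using word_cong_sym[OF bcong_braid[of k n]] unfolding braid(3,4) by simp
    qed
    then show "(concat (map (\<lambda>x. [flip_letter n x]) u), concat (map (\<lambda>x. [flip_letter n x]) v)) \<in>
        bcong n"
      unfolding cm .
  qed
  then show ?thesis unfolding cm .
qed

lemma flip_braid_of:
  assumes "w \<in> lists (braid_letters n)"
  shows "flip n (braid_of n w) = braid_of n (map (flip_letter n) w)"
proof
  show "flip n (braid_of n w) \<subseteq> braid_of n (map (flip_letter n) w)"
    unfolding flip_def braid_of_def flip_letter_def[symmetric]
    by (intro image_subsetI) (simp add: flip_cong)
  show "braid_of n (map (flip_letter n) w) \<subseteq> flip n (braid_of n w)"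
  proof
    fix y assume "y \<in> braid_of n (map (flip_letter n) w)"
    then have y: "(map (flip_letter n) w, y) \<in> bcong n"
      by (simp add: braid_of_def)
    then have "(w, map (flip_letter n) y) \<in> bcong n"
      using flip_cong[OF y] flip_word_involution[OF assms] by simp
    moreover have "y = map (flip_letter n) (map (flip_letter n) y)"
      using flip_word_involution[OF word_cong_in_lists(2)[OF y]] by simp
    ultimately show "y \<in> flip n (braid_of n w)"
      unfolding flip_def braid_of_def flip_letter_def[symmetric]
      by (intro image_eqI[of y _ "map (flip_letter n) y"]) simp_all
  qed
qed

lemma twist_swap:
  assumes "i \<in> {1..<n}"
  shows "twist n (swap i) = swap (n - i)"
proof
  fix x
  consider "x = n - i" | "x = n - i + 1" | "x \<noteq> n - i" "x \<noteq> n - i + 1" "x \<in> {1..n}" | "x \<notin> {1..n}"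
    by blast
  then show "twist n (swap i) x = swap (n - i) x"
  proof cases
    case 1
    then have "omega n x = i + 1" "omega n i = n - i + 1"
      using assms by (auto simp: omega_def)
    then show ?thesis using 1 by (simp add: twist_def pmult_apply)
  next
    case 2
    then have "omega n x = i" "omega n (i + 1) = n - i"
      using assms by (auto simp: omega_def)
    then show ?thesis using 2 by (simp add: twist_def pmult_apply)
  next
    case 3
    then have "omega n x \<noteq> i" "omega n x \<noteq> i + 1" "omega n (omega n x) = x"
      using assms by (auto simp: omega_def)
    then show ?thesis using 3 by (simp add: twist_def pmult_apply swap_other)
  next
    case 4
    then have "omega n x = x" "x \<noteq> i" "x \<noteq> i + 1" "x \<noteq> n - i" "x \<noteq> n - i + 1"
      using assms by (auto simp: omega_def)
    then show ?thesis by (simp add: twist_def pmult_apply swap_other)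
  qed
qed

lemma flip_reduced:
  assumes "reduced_word n w"
  shows "reduced_word n (map (flip_letter n) w) \<and> word_perm (map (flip_letter n) w) = twist n
      (word_perm w)"
  using assms
proof (induction w)
  case Nil
  show ?case by (simp del: id_apply)
next
  case (Cons x w)
  obtain i s where x: "x = (i, s)" by (cases x)
  have i: "i \<in> {1..<n}" and s: s and w: "reduced_word n w" and r:
      "reduced_prod (swap i) (word_perm w)"
    using Cons.prems unfolding x reduced_Cons by blast+
  have "reduced_prod (swap (n - i)) (twist n (word_perm w))"
    using reduced_prod_twist[OF swap_perm[OF i] reduced_perm[OF w] r]
        by (simp add: twist_swap[OF i])
  moreover have "n - i \<in> {1..<n}" using i by auto
  ultimately show ?case
    using Cons.IH[OF w] s by (simp add: x reduced_Cons twist_pmult twist_swap[OF i])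
qed

lemma flip_perm_braid:
  assumes "perm n a"
  shows "flip n (perm_braid n a) = perm_braid n (twist n a)"
proof -
  obtain w where w: "reduced_word n w" "word_perm w = a" "perm_braid n a = braid_of n w"
    using perm_braid_obtain[OF assms] .
  show ?thesis
    using flip_braid_of[OF reduced_in_lists[OF w(1)]] flip_reduced[OF w(1)] w(2,3)
      perm_braid_word_perm[of n "map (flip_letter n) w"] by simp
qed

section \<open>The letters and the relations\<close>

definition letters_of :: "nat \<Rightarrow> (nat \<Rightarrow> nat) \<Rightarrow> braid list" where
  "letters_of n a = (if a = id then [] else [perm_braid n a])"

lemma to_word_perm_braid: "perm n a \<Longrightarrow> to_word n (perm_braid n a) = letters_of n a"
  using perm_braid_inj[of n a id] perm_braid_id[of n]
      by (simp add: to_word_def letters_of_def del: id_apply)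

lemma letters_of_id [simp]: "letters_of n id = []"
  by (simp add: letters_of_def)

abbreviation Omega_inv :: "nat \<Rightarrow> braid" where
  "Omega_inv n \<equiv> inv\<^bsub>Br n\<^esub> (Garside n)"

lemma gens_eq: "gens n = {perm_braid n a | a. perm n a \<and> a \<noteq> id} \<union> {Omega_inv n}"
proof -
  have "non_repeating_braids n - {\<one>\<^bsub>Br n\<^esub>} = {perm_braid n a | a. perm n a \<and> a \<noteq> id}"
  proof (intro equalityI subsetI)
    fix B assume B: "B \<in> non_repeating_braids n - {\<one>\<^bsub>Br n\<^esub>}"
    then obtain a where a: "perm n a" "B = perm_braid n a"
      using non_repeating_braid_cases[of B n] by blast
    then have "a \<noteq> id"
      using B perm_braid_id[of n] by auto
    then show "B \<in> {perm_braid n a | a. perm n a \<and> a \<noteq> id}"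
      using a by blast
  next
    fix B assume "B \<in> {perm_braid n a | a. perm n a \<and> a \<noteq> id}"
    then obtain a where a: "perm n a" "a \<noteq> id" "B = perm_braid n a"
      by blast
    then show "B \<in> non_repeating_braids n - {\<one>\<^bsub>Br n\<^esub>}"
      using perm_braid_non_repeating[OF a(1)] perm_braid_inj[OF a(1) perm_id] perm_braid_id[of n]
      by (simp del: id_apply)
  qed
  then show ?thesis by (simp add: gens_def)
qed

lemma letters_of_in: "perm n a \<Longrightarrow> letters_of n a \<in> lists (gens n)"
  unfolding letters_of_def gens_eq by auto

lemma Omega_inv_in: "[Omega_inv n] \<in> lists (gens n)"
  unfolding gens_eq by simp

lemma Garside_letters:
  assumes "n \<ge> 2"
  shows "letters_of n (omega n) = [Garside n]"
  using omega_neq_id[OF assms] by (simp add: letters_of_def Garside_def del: id_apply)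

lemma GS_mult:
  assumes "perm n a" "perm n b"
  shows "(letters_of n a @ letters_of n b,
    letters_of n (asymp_op n a b) @ letters_of n (bowtie_op n a b)) \<in> GS_relations n"
  unfolding GS_relations_def
  by (rule UnI1, rule UnI1, rule CollectI, rule exI[of _ a], rule exI[of _ b])
     (use assms to_word_perm_braid[OF assms(1)] to_word_perm_braid[OF assms(2)]
        to_word_perm_braid[OF asymp_properties(1)[OF assms]]
            to_word_perm_braid[OF bowtie_perm[OF assms]]
      in \<open>simp add: perm_def\<close>)

lemma GS_flip:
  assumes "perm n a"
  shows "(Omega_inv n # letters_of n a, letters_of n (twist n a) @ [Omega_inv n]) \<in> GS_relations n"
  unfolding GS_relations_def
  by (rule UnI1, rule UnI2, rule CollectI, rule exI[of _ a])
     (use assms to_word_perm_braid[OF assms] to_word_perm_braid[OF twist_perm[OF assms]]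
        flip_perm_braid[OF assms] in \<open>simp add: perm_def\<close>)

lemma GS_cancel: "([Garside n, Omega_inv n], []) \<in> GS_relations n"
    "([Omega_inv n, Garside n], []) \<in> GS_relations n"
  unfolding GS_relations_def to_word_perm_braid[OF perm_id] by (simp_all del: id_apply)

lemma GS_cases:
  assumes "(u, v) \<in> GS_relations n"
  obtains (mult) a b where "perm n a" "perm n b" "u = letters_of n a @ letters_of n b"
      "v = letters_of n (asymp_op n a b) @ letters_of n (bowtie_op n a b)"
  | (flip) a where "perm n a" "u = Omega_inv n # letters_of n a"
      "v = letters_of n (twist n a) @ [Omega_inv n]"
  | (cancel) "u = [Garside n, Omega_inv n] \<or> u = [Omega_inv n, Garside n]" "v = []"
proof -
  note that' = that
  consider (1) "(u, v) \<in> {(to_word n (perm_braid n a) @ to_word n (perm_braid n b),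
       to_word n (perm_braid n (asymp_op n a b)) @ to_word n (perm_braid n (bowtie_op n a b)))
      | a b. a permutes {1..n} \<and> b permutes {1..n}}"
    | (2) "(u, v) \<in> {([Omega_inv n] @ to_word n (perm_braid n a),
       to_word n (flip n (perm_braid n a)) @ [Omega_inv n]) | a. a permutes {1..n}}"
    | (3) "(u, v) \<in> {([Garside n, Omega_inv n], to_word n (perm_braid n id)),
      ([Omega_inv n, Garside n], to_word n (perm_braid n id))}"
    using assms unfolding GS_relations_def by (elim UnE)
  then show thesis
  proof cases
    case 1
    then obtain a b where ab: "perm n a" "perm n b"
      and uv: "u = to_word n (perm_braid n a) @ to_word n (perm_braid n b)"
        "v = to_word n (perm_braid n (asymp_op n a b)) @ to_word n (perm_braid n (bowtie_op n a b))"
      unfolding perm_def by blast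
    show ?thesis
      using that'(1)[OF ab] uv to_word_perm_braid ab asymp_properties(1)[OF ab] bowtie_perm[OF ab]
          by simp
  next
    case 2
    then obtain a where a: "perm n a" and uv: "u = [Omega_inv n] @ to_word n (perm_braid n a)"
        "v = to_word n (flip n (perm_braid n a)) @ [Omega_inv n]"
      unfolding perm_def by blast
    show ?thesis
      using that'(2)[OF a] uv to_word_perm_braid[OF a] to_word_perm_braid[OF twist_perm[OF a]]
        flip_perm_braid[OF a] by simp
  next
    case 3
    then show ?thesis
      using that'(3) to_word_perm_braid[OF perm_id[of n]] by (auto simp del: id_apply)
  qed
qed

lemma GS_in_lists:
  assumes "n \<ge> 2" "(u, v) \<in> GS_relations n"
  shows "u \<in> lists (gens n)" "v \<in> lists (gens n)"
proof -
  have G: "[Garside n] \<in> lists (gens n)"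
    using letters_of_in[OF perm_omega[of n]] Garside_letters[OF assms(1)] by simp
  from assms(2) have "u \<in> lists (gens n) \<and> v \<in> lists (gens n)"
  proof (cases rule: GS_cases)
    case (mult a b)
    then show ?thesis
      using letters_of_in asymp_properties(1)[OF mult(1,2)] bowtie_perm[OF mult(1,2)] by simp
  next
    case (flip a)
    then show ?thesis
      using letters_of_in[OF flip(1)] letters_of_in[OF twist_perm[OF flip(1)]] Omega_inv_in[of n]
          by simp
  next
    case cancel
    then show ?thesis
      using G Omega_inv_in[of n] by auto
  qed
  then show "u \<in> lists (gens n)" "v \<in> lists (gens n)" by auto
qed

abbreviation gcong :: "nat \<Rightarrow> (braid list \<times> braid list) set" where
  "gcong n \<equiv> word_cong (gens n) (GS_relations n)"

lemma gcong_rule: "n \<ge> 2 \<Longrightarrow> (u, v) \<in> GS_relations n \<Longrightarrow> (u, v) \<in> gcong n"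
  using word_cong_rule[of u v "GS_relations n" "gens n"] GS_in_lists[of n u v] by simp

text \<open>If \<open>a \<cdot> b\<close> is reduced, then the second letter absorbs all of \<open>a\<close>.\<close>
lemma gcong_mult:
  assumes "n \<ge> 2" "perm n a" "perm n b" "reduced_prod a b"
  shows "(letters_of n a @ letters_of n b, letters_of n (a \<cdot> b)) \<in> gcong n"
  using gcong_rule[OF assms(1) GS_mult[OF assms(2,3)]]
      reduced_prod_imp_asymp_bowtie[OF assms(2-4)] by simp

lemma gcong_Garside:
  assumes "n \<ge> 2"
  shows "(letters_of n (omega n) @ [Omega_inv n], []) \<in> gcong n"
  using gcong_rule[OF assms GS_cancel(1)] by (simp add: Garside_letters[OF assms])

section \<open>The relations present the braid group\<close>

lemma word_prod_letters_of:
  assumes "perm n a"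
  shows "word_prod (Br n) (letters_of n a) = perm_braid n a"
proof -
  interpret group "Br n" by (rule group_Br)
  show ?thesis
  proof (cases "a = id")
    case True
    then show ?thesis
      using perm_braid_id[of n] by (simp add: word_prod_def)
  next
    case False
    then show ?thesis
      using perm_braid_closed[OF assms] by (simp add: letters_of_def word_prod_def)
  qed
qed

lemma gens_subset: "gens n \<subseteq> carrier (Br n)"
proof -
  interpret group "Br n" by (rule group_Br)
  show ?thesis
    using perm_braid_closed Garside_closed[of n] by (auto simp: gens_eq)
qed

lemma word_prod_append_gens:
  assumes "u \<in> lists (gens n)" "v \<in> lists (gens n)"
  shows "word_prod (Br n) (u @ v) = word_prod (Br n) u \<otimes>\<^bsub>Br n\<^esub> word_prod (Br n) v"
proof -
  have "set u \<subseteq> carrier (Br n)" "set v \<subseteq> carrier (Br n)"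
    using assms gens_subset[of n] by (auto simp: in_lists_conv_set)
  then show ?thesis
    by (rule word_prod_append[OF monoid_Br])
qed

lemma word_prod_singleton:
  assumes "B \<in> carrier (Br n)"
  shows "word_prod (Br n) [B] = B"
proof -
  interpret group "Br n" by (rule group_Br)
  show ?thesis using assms by (simp add: word_prod_def)
qed

lemma GS_relations_hold:
  assumes n: "n \<ge> 2" and "(u, v) \<in> GS_relations n"
  shows "word_prod (Br n) u = word_prod (Br n) v"
proof -
  interpret group "Br n" by (rule group_Br)
  note Oi = word_prod_singleton[OF inv_closed[OF Garside_closed[of n]]]
  from assms(2) show ?thesis
  proof (cases rule: GS_cases)
    case (mult a b)
    note ab = mult(1,2)
    note p = asymp_properties(1)[OF ab] bowtie_perm[OF ab]
    show ?thesis
      unfolding mult(3,4) word_prod_append_gens[OF letters_of_in[OF ab(1)] letters_of_in[OF ab(2)]]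
        word_prod_append_gens[OF letters_of_in[OF p(1)] letters_of_in[OF p(2)]]
        word_prod_letters_of[OF ab(1)] word_prod_letters_of[OF ab(2)]
        word_prod_letters_of[OF p(1)] word_prod_letters_of[OF p(2)]
      by (rule perm_braid_asymp_bowtie[OF ab, symmetric])
  next
    case (flip a)
    have "word_prod (Br n) u = Omega_inv n \<otimes>\<^bsub>Br n\<^esub> perm_braid n a"
      using word_prod_append_gens[OF Omega_inv_in letters_of_in[OF flip(1)]] Oi
        word_prod_letters_of[OF flip(1)] by (simp add: flip(2))
    moreover have "word_prod (Br n) v = perm_braid n (twist n a) \<otimes>\<^bsub>Br n\<^esub> Omega_inv n"
      using word_prod_append_gens[OF letters_of_in[OF twist_perm[OF flip(1)]] Omega_inv_in] Oi
        word_prod_letters_of[OF twist_perm[OF flip(1)]] by (simp add: flip(3))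
    ultimately show ?thesis
      using inv_Garside_commute[OF flip(1)] by simp
  next
    case cancel
    then show ?thesis
      using Garside_closed[of n] by (auto simp: word_prod_def)
  qed
qed

text \<open>The generator \<open>\<sigma>\<^sub>i\<close> is a non-repeating braid, and \<open>\<sigma>\<^sub>i\<^sup>-\<^sup>1\<close> is obtained from the
  reduced factorization of \<open>\<omega>\<close> that starts with \<open>s\<^sub>i\<close>. For \<open>n = 2\<close> the other factor is
  trivial and has the empty word.\<close>
definition sigma_image :: "nat \<Rightarrow> nat \<times> bool \<Rightarrow> braid list" where
  "sigma_image n x = (if snd x then letters_of n (swap (fst x))
     else letters_of n (swap (fst x) \<cdot> omega n) @ [Omega_inv n])"

lemma sigma_image_in: "x \<in> braid_letters n \<Longrightarrow> sigma_image n x \<in> lists (gens n)"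
  using letters_of_in[OF swap_perm[of "fst x" n]] Omega_inv_in[of n]
    letters_of_in[OF perm_pmult[OF swap_perm[of "fst x" n] perm_omega[of n]]]
  by (auto simp: sigma_image_def braid_letters_def)

lemma sigma_image_reduced:
  assumes n: "n \<ge> 2" and "reduced_word n w"
  shows "(concat (map (sigma_image n) w), letters_of n (word_perm w)) \<in> gcong n"
  using assms(2)
proof (induction w)
  case Nil
  show ?case by (simp add: word_cong_refl del: id_apply)
next
  case (Cons x w)
  obtain i s where x: "x = (i, s)" by (cases x)
  have i: "i \<in> {1..<n}" and s: s and w: "reduced_word n w" and r:
      "reduced_prod (swap i) (word_perm w)"
    using Cons.prems unfolding x reduced_Cons by blast+
  have "(letters_of n (swap i) @ concat (map (sigma_image n) w),
      letters_of n (swap i) @ letters_of n (word_perm w)) \<in> gcong n"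
    by (intro word_cong_append Cons.IH[OF w] word_cong_refl letters_of_in swap_perm i)
  also have "(letters_of n (swap i) @ letters_of n (word_perm w), letters_of n (swap i \<cdot> word_perm
      w)) \<in> gcong n"
    by (intro gcong_mult n swap_perm i reduced_perm[OF w] r)
  finally show ?case
    using s by (simp add: x sigma_image_def[of n "(i, True)"])
qed

lemma far_reduced:
  assumes "i \<in> {1..<n}" "j \<in> {1..<n}" "\<bar>int i - int j\<bar> > 1"
  shows "reduced_word n [(i, True), (j, True)]"
proof -
  have "\<not> inverts (swap j) i (i + 1)"
    using assms(3) unfolding inverts_swap doubleton_eq_iff by auto
  then show ?thesis
    using assms reduced_prod_swap[OF swap_perm[OF assms(2)], of i]
        by (simp add: reduced_Cons del: id_apply)
qed

lemma braid_reduced: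
  assumes i: "i \<in> {1..<n}" and j: "i + 1 \<in> {1..<n}"
  shows "reduced_word n [(i, True), (i + 1, True), (i, True)]"
      "reduced_word n [(i + 1, True), (i, True), (i + 1, True)]"
proof -
  have ns: "\<not> inverts (swap (i + 1)) i (i + 1)" "\<not> inverts (swap i) (i + 1) (i + 2)"
    "swap (i + 1) i = i" "swap (i + 1) (i + 1) = i + 2" "swap i (i + 1) = i"
        "swap i (i + 2) = i + 2"
    "\<not> inverts (swap i) i (i + 2)" "\<not> inverts (swap (i + 1)) i (i + 2)"
    unfolding inverts_swap doubleton_eq_iff by (simp_all add: swap_def)
  have "reduced_prod (swap i) (swap (i + 1))" "reduced_prod (swap (i + 1)) (swap i)"
    using reduced_prod_swap[OF swap_perm[OF j], of i]
        reduced_prod_swap[OF swap_perm[OF i], of "i + 1"] ns by simp_all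
  moreover have "reduced_prod (swap i) (swap (i + 1) \<cdot> swap i)"
      "reduced_prod (swap (i + 1)) (swap i \<cdot> swap (i + 1))"
    using reduced_prod_swap[OF perm_pmult[OF swap_perm[OF j] swap_perm[OF i]], of i]
      reduced_prod_swap[OF perm_pmult[OF swap_perm[OF i] swap_perm[OF j]], of "i + 1"] ns
    unfolding inverts_pmult by simp_all
  ultimately show "reduced_word n [(i, True), (i + 1, True), (i, True)]"
    "reduced_word n [(i + 1, True), (i, True), (i + 1, True)]"
    using i j by (simp_all add: reduced_Cons del: id_apply)
qed

text \<open>The two sides of a commutation or braid relation are reduced words of the same
  permutation. Those of the inverse relations lead to reduced factorizations of \<open>\<omega>\<close>.\<close>
lemma sigma_image_relations:
  assumes n: "n \<ge> 2" and "(u, v) \<in> braid_relations n"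
  shows "(concat (map (sigma_image n) u), concat (map (sigma_image n) v)) \<in> gcong n"
proof -
  have same: ?thesis if "reduced_word n u" "reduced_word n v" "word_perm u = word_perm v"
    using sigma_image_reduced[OF n that(1)] word_cong_sym[OF sigma_image_reduced[OF n that(2)]]
    unfolding that(3) by (rule word_cong_trans)
  from assms(2) show ?thesis
  proof (cases rule: braid_relations_cases)
    case (inverse i s)
    define b where "b = swap i \<cdot> omega n"
    note si = swap_perm[OF inverse(1)] and w = perm_omega[of n]
    have b: "perm n b" unfolding b_def by (intro perm_pmult si w)
    have sb: "swap i \<cdot> b = omega n" unfolding b_def by (rule swap_swap)
    have "b \<cdot> twist n (swap i) = swap i \<cdot> (omega n \<cdot> omega n) \<cdot> swap i \<cdot> omega n"
      unfolding b_def twist_def by (simp only: pmult_assoc)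
    then have bt: "b \<cdot> twist n (swap i) = omega n"
      by (simp add: omega_omega swap_swap pmult_assoc)
    note t = twist_perm[OF si]
    have Oi: "([Omega_inv n], [Omega_inv n]) \<in> gcong n"
      by (intro word_cong_refl Omega_inv_in)
    show ?thesis
    proof (cases s)
      case True
      have "((letters_of n (swap i) @ letters_of n b) @ [Omega_inv n], letters_of n (omega n) @
          [Omega_inv n]) \<in> gcong n"
        using gcong_mult[OF n si b reduced_prod_if_prod_omega[OF si b sb]] sb
            by (intro word_cong_append Oi) simp
      also note gcong_Garside[OF n]
      finally show ?thesis
        using True unfolding inverse(2,3) by (simp add: sigma_image_def b_def)
    next
      case False
      have "(letters_of n b @ (Omega_inv n # letters_of n (swap i)),
          letters_of n b @ (letters_of n (twist n (swap i)) @ [Omega_inv n])) \<in> gcong n"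
        by (intro word_cong_append word_cong_refl letters_of_in b gcong_rule[OF n] GS_flip si)
      also have "(letters_of n b @ (letters_of n (twist n (swap i)) @ [Omega_inv n]),
          letters_of n (omega n) @ [Omega_inv n]) \<in> gcong n"
        using word_cong_append[OF gcong_mult[OF n b t reduced_prod_if_prod_omega[OF b t bt]] Oi]
            bt by simp
      also note gcong_Garside[OF n]
      finally show ?thesis
        using False unfolding inverse(2,3) by (simp add: sigma_image_def b_def)
    qed
  next
    case (far i j)
    have "word_perm u = word_perm v"
      by (rule word_perm_cong[OF bcong_rule[OF assms(2)]])
    moreover have "\<bar>int j - int i\<bar> > 1" using far(3) by linarith
    ultimately show ?thesis
      using same far_reduced[OF far(1-3)] far_reduced[OF far(2,1)] unfolding far(4,5) by blast
  next
    case (braid i)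
    have "word_perm u = word_perm v"
      by (rule word_perm_cong[OF bcong_rule[OF assms(2)]])
    then show ?thesis
      using same braid_reduced[OF braid(1,2)] unfolding braid(3,4) by blast
  qed
qed

lemma word_prod_sigma_image:
  assumes x: "x \<in> braid_letters n"
  shows "word_prod (Br n) (sigma_image n x) = braid_of n [x]"
proof -
  interpret group "Br n" by (rule group_Br)
  obtain i s where xi: "x = (i, s)" by (cases x)
  then have i: "i \<in> {1..<n}" using x by (auto simp: braid_letters_def)
  note si = swap_perm[OF i] and w = perm_omega[of n]
  define b where "b = swap i \<cdot> omega n"
  have b: "perm n b" unfolding b_def by (intro perm_pmult si w)
  have sb: "swap i \<cdot> b = omega n" unfolding b_def by (rule swap_swap)
  have red1: "reduced_word n [(i, True)]"
    using i by (simp add: reduced_Cons del: id_apply)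
  have g: "perm_braid n (swap i) = braid_of n [(i, True)]"
    using perm_braid_word_perm[OF red1] by (simp del: id_apply)
  show ?thesis
  proof (cases s)
    case True
    then show ?thesis
      using word_prod_letters_of[OF si] g by (simp add: sigma_image_def xi)
  next
    case False
    have e: "perm_braid n (swap i) \<otimes>\<^bsub>Br n\<^esub> perm_braid n b = Garside n"
      using perm_braid_mult[OF si b reduced_prod_if_prod_omega[OF si b sb]] sb
          by (simp add: Garside_def)
    note c = perm_braid_closed[OF si] perm_braid_closed[OF b] Garside_closed[of n]
    have "word_prod (Br n) (sigma_image n x) = perm_braid n b \<otimes>\<^bsub>Br n\<^esub> Omega_inv n"
      using False word_prod_append_gens[OF letters_of_in[OF b] Omega_inv_in]
          word_prod_letters_of[OF b]
        word_prod_singleton[OF inv_closed[OF c(3)]]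
      by (simp add: sigma_image_def xi b_def)
    also have "\<dots> = inv\<^bsub>Br n\<^esub> perm_braid n (swap i)"
      unfolding e[symmetric] inv_mult_group[OF c(1,2)] using c by (simp add: m_assoc[symmetric])
    also have "\<dots> = braid_of n [(i, False)]"
      unfolding g using inv_braid_of[OF reduced_in_lists[OF red1]] by (simp add: inverse_word_simps)
    finally show ?thesis
      using False by (simp add: xi)
  qed
qed

definition braid_rep :: "nat \<Rightarrow> braid \<Rightarrow> braid_word" where
  "braid_rep n B = (if B = Omega_inv n
     then inverse_word (SOME w. reduced_word n w \<and> braid_of n w = Garside n)
     else SOME w. reduced_word n w \<and> braid_of n w = B)"

lemma braid_rep_properties:
  assumes n: "n \<ge> 2" and "B \<in> gens n"
  shows "braid_rep n B \<in> lists (braid_letters n)" "braid_of n (braid_rep n B) = B"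
    "([B], concat (map (sigma_image n) (braid_rep n B))) \<in> gcong n"
proof -
  have some: "reduced_word n w \<and> braid_of n w = perm_braid n a"
    if a: "perm n a" and w: "w = (SOME w. reduced_word n w \<and> braid_of n w = perm_braid n a)" for a w
  proof -
    obtain v where "reduced_word n v" "word_perm v = a" "perm_braid n a = braid_of n v"
      using perm_braid_obtain[OF a] .
    then have "\<exists>w. reduced_word n w \<and> braid_of n w = perm_braid n a" by auto
    then show ?thesis
      unfolding w by (rule someI_ex)
  qed
  have img: "(concat (map (sigma_image n) w), letters_of n a) \<in> gcong n"
    if "reduced_word n w" "braid_of n w = perm_braid n a" "perm n a" for w a
  proof -
    have "word_perm w = a"
      using braid_perm_braid_of[OF reduced_in_lists[OF that(1)]] braid_perm_perm_braid[OF that(3)]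
          that(2) by simp
    then show ?thesis
      using sigma_image_reduced[OF n that(1)] by simp
  qed
  show "braid_rep n B \<in> lists (braid_letters n)" "braid_of n (braid_rep n B) = B"
    "([B], concat (map (sigma_image n) (braid_rep n B))) \<in> gcong n"
  proof (atomize (full), cases "B = Omega_inv n")
    case True
    define w where "w = (SOME w. reduced_word n w \<and> braid_of n w = Garside n)"
    have w: "reduced_word n w" "braid_of n w = perm_braid n (omega n)"
      using some[OF perm_omega, of w] by (simp_all add: w_def Garside_def)
    note wl = reduced_in_lists[OF w(1)]
    have rep: "braid_rep n B = inverse_word w"
      by (simp add: braid_rep_def True w_def)
    have 1: "(concat (map (sigma_image n) w), [Garside n]) \<in> gcong n"
      using img[OF w perm_omega] Garside_letters[OF n] by simp
    have "(w @ inverse_word w, []) \<in> bcong n"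
      by (rule append_inverse_word[OF wl])
    from word_cong_morphism[OF sigma_image_in sigma_image_relations[OF n] this]
    have 2: "(concat (map (sigma_image n) w) @ concat (map (sigma_image n) (inverse_word w)), [])
        \<in> gcong n"
      by simp
    define I where "I = concat (map (sigma_image n) (inverse_word w))"
    have I: "(I, I) \<in> gcong n"
      unfolding I_def by (intro word_cong_refl concat_map_in_lists[OF sigma_image_in
          inverse_word_in_lists[OF wl]])
    have O: "([Omega_inv n], [Omega_inv n]) \<in> gcong n"
      by (intro word_cong_refl Omega_inv_in)
    have "([Omega_inv n] @ [], [Omega_inv n] @ (concat (map (sigma_image n) w) @ I)) \<in> gcong n"
      unfolding I_def by (intro word_cong_append O word_cong_sym[OF 2])
    also have "([Omega_inv n] @ (concat (map (sigma_image n) w) @ I), [Omega_inv n] @ ([Garside n]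
        @ I)) \<in> gcong n"
      by (intro word_cong_append O 1 I)
    also have "([Omega_inv n] @ ([Garside n] @ I), I) \<in> gcong n"
      using word_cong_append[OF gcong_rule[OF n GS_cancel(2)] I] by simp
    finally have "([Omega_inv n], I) \<in> gcong n"
      by simp
    moreover have "braid_of n (inverse_word w) = Omega_inv n"
      using inv_braid_of[OF wl] w(2) by (simp add: Garside_def)
    ultimately show "braid_rep n B \<in> lists (braid_letters n) \<and> braid_of n (braid_rep n B) = B \<and>
        ([B], concat (map (sigma_image n) (braid_rep n B))) \<in> gcong n"
      using inverse_word_in_lists[OF wl] unfolding rep I_def unfolding True by blast
  next
    case False
    then obtain a where a: "perm n a" "a \<noteq> id" "B = perm_braid n a"
      using assms(2) unfolding gens_eq by blast
    define w where "w = braid_rep n B"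
    have w: "reduced_word n w" "braid_of n w = perm_braid n a"
      using some[OF a(1), of w] False by (simp_all add: w_def braid_rep_def a(3))
    have "[B] = letters_of n a"
      using a by (simp add: letters_of_def del: id_apply)
    then show "braid_rep n B \<in> lists (braid_letters n) \<and> braid_of n (braid_rep n B) = B \<and>
        ([B], concat (map (sigma_image n) (braid_rep n B))) \<in> gcong n"
      using word_cong_sym[OF img[OF w a(1)]] reduced_in_lists[OF w(1)] w(2) a(3) unfolding
          w_def[symmetric] by simp
  qed
qed

lemma GS_defining_relations:
  assumes n: "n \<ge> 2"
  shows "defining_relations (Br n) (gens n) (GS_relations n)"
  unfolding Br_def
proof (rule tietze[where \<rho> = "braid_rep n" and \<phi> = "sigma_image n"])
  show "braid_relations n \<subseteq> lists (braid_letters n) \<times> lists (braid_letters n)"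
    by (intro subrelI SigmaI) (simp_all add: braid_relations_in_lists del: in_lists_conv_set)
  show "GS_relations n \<subseteq> lists (gens n) \<times> lists (gens n)"
    by (intro subrelI SigmaI) (simp_all add: GS_in_lists[OF n] del: in_lists_conv_set)
qed (use n braid_rep_properties[OF n] sigma_image_in word_prod_sigma_image GS_relations_hold[OF n]
    sigma_image_relations[OF n] in \<open>simp_all add: Br_def[symmetric] braid_of_def[symmetric]\<close>)

section \<open>Termination\<close>

lemma weak_le_antisym:
  assumes a: "perm n a" and b: "perm n b" and "weak_le a b" "weak_le b a"
  shows "a = b"
proof -
  have same: "inverts a p q \<longleftrightarrow> inverts b p q" for p q
    using assms(3,4) unfolding weak_le_def by blast
  have "\<not> inverts (pinv a \<cdot> b) (a p) (a q)" for p q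
    unfolding inverts_pmult inverts_pinv[OF a] perm_inverses(2)[OF a] same by simp
  then have "\<not> inverts (pinv a \<cdot> b) p q" for p q
    using perm_inverses(1)[OF a] by metis
  then have "pinv a \<cdot> b = id"
    using no_inversions_imp_id[of n "pinv a \<cdot> b"] perm_pmult[OF perm_pinv[OF a] b] by blast
  then have "a \<cdot> (pinv a \<cdot> b) = a"
    by simp
  then show ?thesis
    by (simp add: pmult_pinv_cancel(1)[OF a])
qed

lemma finite_inversions: "finite (inversions n a)"
  by (rule finite_subset[of _ "{1..n} \<times> {1..n}"]) (auto simp: inversions_def)

lemma card_inversions_less:
  assumes "perm n a" "perm n b" "weak_le a b" "a \<noteq> b"
  shows "card (inversions n a) < card (inversions n b)"
proof (rule psubset_card_mono[OF finite_inversions])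
  show "inversions n a \<subset> inversions n b"
    using weak_le_iff[OF assms(1,2)] weak_le_iff[OF assms(2,1)] weak_le_antisym[OF assms(1,2)]
        assms(3,4)
    by blast
qed

text \<open>The value for \<open>\<Omega>\<^sup>-\<^sup>1\<close> exceeds every number of inversions. Every proper rule that
  preserves the length makes the first letter smaller in this sense.\<close>
definition letter_size :: "nat \<Rightarrow> braid \<Rightarrow> nat" where
  "letter_size n B = (if B \<in> non_repeating_braids n then card (inversions n (braid_perm B))
     else Suc (card ({1..n} \<times> {1..n})))"

lemma letter_size_perm_braid: "perm n a \<Longrightarrow> letter_size n (perm_braid n a) = card (inversions n a)"
  by (simp add: letter_size_def perm_braid_non_repeating braid_perm_perm_braid)

lemma letter_size_less_Omega_inv:
  assumes "n \<ge> 2" "perm n a"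
  shows "letter_size n (perm_braid n a) < letter_size n (Omega_inv n)"
proof -
  have "card (inversions n a) \<le> card ({1..n} \<times> {1..n})"
    by (rule card_mono) (auto simp: inversions_def)
  moreover have "letter_size n (Omega_inv n) = Suc (card ({1..n} \<times> {1..n}))"
    using inv_Garside_not_non_repeating[OF assms(1)] by (simp add: letter_size_def)
  ultimately show ?thesis
    unfolding letter_size_perm_braid[OF assms(2)] by linarith
qed

lemma proper_rule_decreases:
  assumes n: "n \<ge> 2" and rule: "(u, v) \<in> proper_rules (GS_relations n)"
  shows "length v < length u \<or>
    (\<exists>A B A' B'. u = [A, B] \<and> v = [A', B'] \<and> (A', A) \<in> letter_less n \<and> letter_size n A' <
        letter_size n A)"
proof -
  have uv: "(u, v) \<in> GS_relations n" "u \<noteq> v"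
    using rule by (auto simp: proper_rules_def)
  from uv(1) show ?thesis
  proof (cases rule: GS_cases)
    case (mult a b)
    note p = asymp_properties[OF mult(1,2)] and q = bowtie_perm[OF mult(1,2)]
    have "a \<noteq> id" "b \<noteq> id"
      using uv(2) mult(3,4) asymp_bowtie_special[OF mult(1)] asymp_bowtie_special[OF mult(2)]
          by auto
    then have u: "u = [perm_braid n a, perm_braid n b]"
      by (simp add: mult(3) letters_of_def)
    show ?thesis
    proof (cases "asymp_op n a b = id \<or> bowtie_op n a b = id")
      case True
      then show ?thesis
        unfolding u mult(4) letters_of_def by auto
    next
      case False
      then have v: "v = [perm_braid n (asymp_op n a b), perm_braid n (bowtie_op n a b)]"
        by (simp add: mult(4) letters_of_def)
      have "weak_le (asymp_op n a b) a"
        using weak_le_pmult[of "asymp_op n a b" "tail n a b"] p(2,3) by simp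
      moreover have "asymp_op n a b \<noteq> a"
      proof
        assume eq: "asymp_op n a b = a"
        then have "a \<cdot> bowtie_op n a b = a \<cdot> b"
          using asymp_bowtie_prod[OF mult(1,2)] by simp
        then have "pinv a \<cdot> (a \<cdot> bowtie_op n a b) = pinv a \<cdot> (a \<cdot> b)"
          by simp
        then have "bowtie_op n a b = b"
          by (simp only: pmult_pinv_cancel(2)[OF mult(1)])
        with eq uv(2) u v show False by simp
      qed
      ultimately have less: "card (inversions n (asymp_op n a b)) < card (inversions n a)"
        using card_inversions_less[OF p(1) mult(1)] by blast
      then have "(perm_braid n (asymp_op n a b), perm_braid n a) \<in> letter_less n"
        using perm_braid_non_repeating[OF p(1)] perm_braid_non_repeating[OF mult(1)]
          braid_perm_perm_braid[OF p(1)] braid_perm_perm_braid[OF mult(1)]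
        by (simp add: letter_less_def perm_less_def)
      then show ?thesis
        using u v less letter_size_perm_braid[OF p(1)] letter_size_perm_braid[OF mult(1)] by simp
    qed
  next
    case (flip a)
    have "a \<noteq> id"
      using uv(2) flip(2,3) by auto
    then have u: "u = [Omega_inv n, perm_braid n a]"
      and v: "v = [perm_braid n (twist n a), Omega_inv n]"
      by (simp_all add: flip(2,3) letters_of_def)
    have "(perm_braid n (twist n a), Omega_inv n) \<in> letter_less n"
      using perm_braid_non_repeating[OF twist_perm[OF flip(1)]] by (simp add: letter_less_def)
    then show ?thesis
      using u v letter_size_less_Omega_inv[OF n twist_perm[OF flip(1)]] by simp
  next
    case cancel
    then show ?thesis by auto
  qed
qed

lemma lenlex_context:
  assumes "length v < length u \<or> (\<exists>A B A' B'. u = [A, B] \<and> v = [A', B'] \<and> (A', A) \<in> r)"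
  shows "(p @ v @ q, p @ u @ q) \<in> lenlex r"
  using assms
proof
  assume "length v < length u"
  then show ?thesis by (simp add: lenlex_conv)
next
  assume "\<exists>A B A' B'. u = [A, B] \<and> v = [A', B'] \<and> (A', A) \<in> r"
  then obtain A B A' B' where "u = [A, B]" "v = [A', B']" "(A', A) \<in> r" by blast
  then show ?thesis
    by (simp add: lenlex_conv lex_append_leftI)
qed

lemma proper_rule_deglex:
  assumes "n \<ge> 2" "(u, v) \<in> proper_rules (GS_relations n)"
  shows "(v, u) \<in> deglex_less n"
proof -
  have "length v < length u \<or> (\<exists>A B A' B'. u = [A, B] \<and> v = [A', B'] \<and> (A', A) \<in> letter_less n)"
    using proper_rule_decreases[OF assms] by blast
  from lenlex_context[OF this, of "[]" "[]"] show ?thesis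
    by (simp add: deglex_less_def)
qed

abbreviation gstep :: "nat \<Rightarrow> braid list \<Rightarrow> braid list \<Rightarrow> bool" where
  "gstep n \<equiv> word_step (gens n) (proper_rules (GS_relations n))"

lemma gstep_terminates:
  assumes "n \<ge> 2"
  shows "wfp (gstep n)\<inverse>\<inverse>"
proof -
  have "wfp (\<lambda>x y. (x, y) \<in> lenlex (measure (letter_size n)))"
    unfolding wfp_wf_eq by (intro wf_lenlex wf_measure)
  then show ?thesis
  proof (rule wfp_subset)
    show "(gstep n)\<inverse>\<inverse> \<le> (\<lambda>x y. (x, y) \<in> lenlex (measure (letter_size n)))"
    proof (intro predicate2I)
      fix x y assume "(gstep n)\<inverse>\<inverse> x y"
      then have "gstep n y x" by simp
      then obtain p q u v where "(u, v) \<in> proper_rules (GS_relations n)" "y = p @ u @ q"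
          "x = p @ v @ q"
        by (rule word_stepE)
      then have "length v < length u \<or>
          (\<exists>A B A' B'. u = [A, B] \<and> v = [A', B'] \<and> (A', A) \<in> measure (letter_size n))"
        using proper_rule_decreases[OF assms, of u v] unfolding in_measure by blast
      then show "(x, y) \<in> lenlex (measure (letter_size n))"
        unfolding \<open>y = p @ u @ q\<close> \<open>x = p @ v @ q\<close> by (rule lenlex_context)
    qed
  qed
qed

section \<open>Confluence\<close>

text \<open>The two sides of a composition arise from one word by one step each.\<close>
lemma compositions_resolvable_if_confluent:
  assumes R: "R \<subseteq> lists X \<times> lists X" and conf: "confluentp (word_step X R)"
  shows "compositions_resolvable X R"
proof -
  have join: "joinable X R y z" if "word_step X R x y" "word_step X R x z" for x y z
    using confluentpD[OF conf r_into_rtranclp[of _ x y] r_into_rtranclp[of _ x z]] that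
    unfolding joinable_def by blast
  show ?thesis
    unfolding compositions_resolvable_def
  proof (intro conjI allI impI)
    fix p q r v v' assume a: "q \<noteq> [] \<and> (p @ q, v) \<in> R \<and> (q @ r, v') \<in> R"
    then have "p \<in> lists X" "r \<in> lists X"
      using R by auto
    then have "word_step X R ([] @ (p @ q) @ r) ([] @ v @ r)"
        "word_step X R (p @ (q @ r) @ []) (p @ v' @ [])"
      using a by (intro word_stepI; simp)+
    then show "joinable X R (v @ r) (p @ v')"
      using join[of "p @ q @ r"] by simp
  next
    fix p q u v v' assume a: "(p @ u @ q, v) \<in> R \<and> (u, v') \<in> R"
    then have "p \<in> lists X" "q \<in> lists X"
      using R by auto
    then have "word_step X R ([] @ (p @ u @ q) @ []) ([] @ v @ [])"
        "word_step X R (p @ u @ q) (p @ v' @ q)"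
      using a by (intro word_stepI; simp)+
    then show "joinable X R v (p @ v' @ q)"
      using join[of "p @ u @ q"] by simp
  qed
qed

lemma normal_form_exists:
  assumes "wfp r\<inverse>\<inverse>"
  shows "\<exists>y. r\<^sup>*\<^sup>* x y \<and> (\<forall>z. \<not> r y z)"
  using assms
proof (induction x rule: wfp_induct_rule)
  case (less x)
  show ?case
  proof (cases "\<exists>z. r x z")
    case True
    then obtain z where "r x z" by blast
    then show ?thesis
      using less.IH[of z] by (auto intro: converse_rtranclp_into_rtranclp)
  qed blast
qed

text \<open>Any two elements reached from \<open>x\<close> have normal forms, and these have the same value of
  \<open>f\<close>. An element outside \<open>P\<close> reaches only itself.\<close>
lemma confluent_if_unique_normal_form:
  assumes wf: "wfp r\<inverse>\<inverse>"
    and inv: "\<And>x y. r x y \<Longrightarrow> P x \<Longrightarrow> P y \<and> f x = f y"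
    and inj: "\<And>x y. P x \<Longrightarrow> P y \<Longrightarrow> \<forall>z. \<not> r x z \<Longrightarrow> \<forall>z. \<not> r y z \<Longrightarrow> f x = f y \<Longrightarrow> x = y"
    and dom: "\<And>x y. r x y \<Longrightarrow> P x"
  shows "confluentp r"
proof (rule confluentpI)
  fix x y z assume xy: "r\<^sup>*\<^sup>* x y" and xz: "r\<^sup>*\<^sup>* x z"
  have inv': "P y \<and> f x = f y" if "r\<^sup>*\<^sup>* x y" "P x" for x y
    using that
  proof (induction rule: rtranclp_induct)
    case (step y z)
    then show ?case using inv[of y z] by simp
  qed simp
  obtain y' where y': "r\<^sup>*\<^sup>* y y'" "\<forall>w. \<not> r y' w"
    using normal_form_exists[OF wf] by blast
  obtain z' where z': "r\<^sup>*\<^sup>* z z'" "\<forall>w. \<not> r z' w"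
    using normal_form_exists[OF wf] by blast
  show "\<exists>u. r\<^sup>*\<^sup>* y u \<and> r\<^sup>*\<^sup>* z u"
  proof (cases "P x")
    case True
    have "P y' \<and> f x = f y'" "P z' \<and> f x = f z'"
      using inv'[OF rtranclp_trans[OF xy y'(1)] True] inv'[OF rtranclp_trans[OF xz z'(1)] True]
          by auto
    then have "y' = z'"
      using inj[of y' z'] y'(2) z'(2) by simp
    then show ?thesis
      using y'(1) z'(1) by blast
  next
    case False
    then have "y = x" "z = x"
      using xy xz dom by (metis converse_rtranclpE)+
    then show ?thesis by blast
  qed
qed

definition letter_act :: "nat \<Rightarrow> braid \<Rightarrow> state \<Rightarrow> state" where
  "letter_act n B = (if B = Omega_inv n then act_inv n else act n (braid_perm B))"

definition run :: "nat \<Rightarrow> braid list \<Rightarrow> state \<Rightarrow> state" where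
  "run n w = fold (letter_act n) w"

lemma run_append: "run n (u @ v) x = run n v (run n u x)"
  by (simp add: run_def)

lemma run_Nil [simp]: "run n [] x = x"
  by (simp add: run_def)

lemma perm_braid_neq_Omega_inv: "n \<ge> 2 \<Longrightarrow> perm n a \<Longrightarrow> perm_braid n a \<noteq> Omega_inv n"
  using perm_braid_non_repeating[of n a] inv_Garside_not_non_repeating[of n] by auto

lemma run_perm_braid:
  assumes "n \<ge> 2" "perm n a"
  shows "run n [perm_braid n a] x = act n a x"
  using perm_braid_neq_Omega_inv[OF assms] braid_perm_perm_braid[OF assms(2)]
  by (simp add: run_def letter_act_def)

lemma run_Omega_inv: "run n [Omega_inv n] x = act_inv n x"
  by (simp add: run_def letter_act_def)

lemma run_letters_of:
  assumes "n \<ge> 2" "perm n a" "valid_state n x"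
  shows "run n (letters_of n a) x = act n a x"
proof (cases "a = id")
  case True
  then show ?thesis
    using act_id[OF assms(3)] unfolding letters_of_def by simp
next
  case False
  then show ?thesis
    using run_perm_braid[OF assms(1,2)] by (simp add: letters_of_def)
qed

lemma run_valid:
  assumes n: "n \<ge> 2" and "w \<in> lists (gens n)" "valid_state n x"
  shows "valid_state n (run n w x)"
  using assms(2,3)
proof (induction w arbitrary: x)
  case (Cons B w)
  have x: "valid_state n x" by (rule Cons.prems)
  consider "B = Omega_inv n" | a where "perm n a" "B = perm_braid n a"
    using Cons.hyps(1) unfolding gens_eq by blast
  then have "valid_state n (run n [B] x)"
  proof cases
    case 1
    then show ?thesis
      unfolding 1 run_Omega_inv by (intro valid_act_inv x)
  next
    case (2 a)
    then show ?thesis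
      unfolding 2(2) run_perm_braid[OF n 2(1)] by (intro valid_act x)
  qed
  then show ?case
    using Cons.IH run_append[of n "[B]" w x] by simp
qed simp

lemma run_rule:
  assumes n: "n \<ge> 2" and "(u, v) \<in> GS_relations n" and x: "valid_state n x"
  shows "run n u x = run n v x"
  using assms(2)
proof (cases rule: GS_cases)
  case (mult a b)
  note p = asymp_properties(1)[OF mult(1,2)] and q = bowtie_perm[OF mult(1,2)]
  show ?thesis
    unfolding mult(3,4) run_append run_letters_of[OF n mult(1) x] run_letters_of[OF n p x]
      run_letters_of[OF n mult(2) valid_act[OF x mult(1)]] run_letters_of[OF n q valid_act[OF x p]]
    by (rule act_asymp_bowtie[OF mult(1,2) x, symmetric])
next
  case (flip a)
  have "run n u x = run n (letters_of n a) (act_inv n x)"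
    using run_append[of n "[Omega_inv n]" "letters_of n a" x] by (simp add: flip(2) run_Omega_inv)
  also have "\<dots> = act n a (act_inv n x)"
    by (rule run_letters_of[OF n flip(1) valid_act_inv[OF x]])
  also have "\<dots> = act_inv n (act n (twist n a) x)"
    by (rule act_act_inv[OF flip(1)])
  also have "\<dots> = run n v x"
    unfolding flip(3) run_append run_Omega_inv run_letters_of[OF n twist_perm[OF flip(1)] x] ..
  finally show ?thesis .
next
  case cancel
  have "run n [Garside n, Omega_inv n] x = x"
    using run_append[of n "[Garside n]" "[Omega_inv n]" x] run_perm_braid[OF n perm_omega]
      run_Omega_inv act_inv_act_omega(1)[OF x] by (simp add: Garside_def)
  moreover have "run n [Omega_inv n, Garside n] x = x"
    using run_append[of n "[Omega_inv n]" "[Garside n]" x] run_perm_braid[OF n perm_omega]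
      run_Omega_inv act_inv_act_omega(2)[OF x] by (simp add: Garside_def)
  ultimately show ?thesis
    using cancel by auto
qed

definition initial_state :: state where "initial_state = ([], 0)"

lemma run_step:
  assumes n: "n \<ge> 2" and "gstep n x y"
  shows "x \<in> lists (gens n)" "y \<in> lists (gens n)" "run n x initial_state = run n y initial_state"
proof -
  obtain p q u v where pq: "p \<in> lists (gens n)" "q \<in> lists (gens n)"
    and uv: "(u, v) \<in> proper_rules (GS_relations n)" and xy: "x = p @ u @ q" "y = p @ v @ q"
    using assms(2) by (rule word_stepE)
  have r: "(u, v) \<in> GS_relations n" using uv by (simp add: proper_rules_def)
  show "x \<in> lists (gens n)" "y \<in> lists (gens n)"
    using pq GS_in_lists[OF n r] xy by auto
  have "valid_state n initial_state" using valid_init[OF n] by (simp add: initial_state_def)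
  then show "run n x initial_state = run n y initial_state"
    unfolding xy run_append using run_rule[OF n r run_valid[OF n pq(1)]] by simp
qed

definition state_word :: "nat \<Rightarrow> state \<Rightarrow> braid list" where
  "state_word n x = map (perm_braid n) (rev (fst x)) @ replicate (snd x) (Omega_inv n)"

lemma irreducible_prefix:
  assumes "\<forall>z. \<not> gstep n (w @ [B]) z" "B \<in> gens n"
  shows "\<forall>z. \<not> gstep n w z"
proof (intro allI notI)
  fix z assume "gstep n w z"
  then have "gstep n ([] @ w @ [B]) ([] @ z @ [B])"
    using assms(2) by (intro word_step_context) auto
  then show False using assms(1) by simp
qed

lemma snd_cancel_le: "snd (cancel n s m) \<le> m"
  by (induction n s m rule: cancel.induct) auto

lemma irreducible_no_rule:
  assumes "\<forall>z. \<not> gstep n (p @ u @ q) z" "p \<in> lists (gens n)" "q \<in> lists (gens n)"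
      "(u, v) \<in> GS_relations n"
  shows "u = v"
proof (rule ccontr)
  assume "u \<noteq> v"
  then have "(u, v) \<in> proper_rules (GS_relations n)"
    using assms(4) by (simp add: proper_rules_def)
  then show False
    using word_stepI[of u v "proper_rules (GS_relations n)" p "gens n" q] assms by blast
qed

text \<open>In an irreducible word no letter \<open>\<Omega>\<^sup>-\<^sup>1\<close> precedes a non-repeating braid, no letter \<open>\<Omega>\<close>
  precedes \<open>\<Omega>\<^sup>-\<^sup>1\<close>, and \<open>b \<asymp> c = b\<close>, \<open>b \<bowtie> c = c\<close> for consecutive letters \<open>R\<^sub>b R\<^sub>c\<close>. Hence
  every letter acts by being appended. The third conjunct is for the induction: pushing \<open>c\<close>
  against the last entry \<open>b\<close> carries \<open>b\<close> on, and this has to restore the sequence.\<close>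
lemma irreducible_run:
  assumes n: "n \<ge> 2" and "w \<in> lists (gens n)" "\<forall>z. \<not> gstep n w z"
  shows "\<exists>s m. run n w initial_state = (s, m) \<and> state_word n (s, m) = w \<and> (\<forall>b t. s = b # t \<longrightarrow> push
      n b t = s)"
  using assms(2,3)
proof (induction w rule: rev_induct)
  case Nil
  show ?case by (simp add: initial_state_def state_word_def)
next
  case (snoc B w)
  then have B: "B \<in> gens n" and w: "w \<in> lists (gens n)" by auto
  obtain s m where sm: "run n w initial_state = (s, m)" "state_word n (s, m) = w"
      "\<forall>b t. s = b # t \<longrightarrow> push n b t = s"
    using snoc.IH[OF w irreducible_prefix[OF snoc.prems(2) B]] by blast
  have "valid_state n (run n w initial_state)"
    using run_valid[OF n w, of initial_state] valid_init[OF n] by (simp add: initial_state_def)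
  then have val: "valid_state n (s, m)" by (simp add: sm)
  then have s: "proper_perms n s"
    by (simp add: valid_state_def omega_central_def)
  have run: "run n (w @ [B]) initial_state = run n [B] (s, m)"
    by (simp add: run_append sm(1))
  consider "B = Omega_inv n" | c where "perm n c" "c \<noteq> id" "B = perm_braid n c"
    using B unfolding gens_eq by blast
  then show ?case
  proof cases
    case 1
    have "cancel n s (Suc m) = (s, Suc m)"
    proof (cases s)
      case (Cons b t)
      have "b \<noteq> omega n"
      proof
        assume b: "b = omega n"
        show False
        proof (cases m)
          case 0
          define p where "p = map (perm_braid n) (rev t)"
          have wB: "w @ [B] = p @ [Garside n, Omega_inv n] @ []"
            using sm(2) by (simp add: p_def state_word_def Cons 0 b 1 Garside_def)
          have "p \<in> lists (gens n)"
            using w sm(2) by (auto simp: p_def state_word_def Cons 0)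
          then show False
            using irreducible_no_rule[of n p "[Garside n, Omega_inv n]" "[]" "[]"] GS_cancel(1)
                snoc.prems(2)
            unfolding wB by simp
        next
          case (Suc k)
          then have "cancel n t k = (s, m)"
            using val by (simp add: valid_state_def Cons b)
          then show False
            using snd_cancel_le[of n t k] Suc by simp
        qed
      qed
      then show ?thesis by (simp add: Cons)
    qed simp
    then have "run n (w @ [B]) initial_state = (s, Suc m)"
      using run run_Omega_inv[of n "(s, m)"] by (simp add: 1 act_inv_def)
    moreover have "state_word n (s, Suc m) = w @ [B]"
      unfolding sm(2)[symmetric] 1 by (simp add: state_word_def replicate_append_same)
    ultimately show ?thesis
      using sm(3) by blast
  next
    case (2 c)
    have m: "m = 0"
    proof (rule ccontr)
      assume "m \<noteq> 0"
      then obtain k where k: "m = Suc k" by (cases m) auto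
      define p where "p = map (perm_braid n) (rev s) @ replicate k (Omega_inv n)"
      have wp: "w = p @ [Omega_inv n]"
        unfolding sm(2)[symmetric] by (simp add: p_def state_word_def k replicate_append_same)
      then have "p \<in> lists (gens n)" using w by simp
      then have "Omega_inv n # letters_of n c = letters_of n (twist n c) @ [Omega_inv n]"
        using irreducible_no_rule[of n p _ "[]", OF _ _ _ GS_flip[OF 2(1)]] snoc.prems(2) 2
        by (simp add: wp letters_of_def)
      then show False
        using 2 perm_braid_neq_Omega_inv[OF n twist_perm[OF 2(1)]] by (simp add: letters_of_def)
    qed
    have "push n c s = c # s"
    proof (cases s)
      case Nil
      then show ?thesis using 2 by simp
    next
      case (Cons b t)
      have b: "perm n b" "b \<noteq> id" using s by (simp_all add: Cons)
      define p where "p = map (perm_braid n) (rev t)"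
      have wp: "w = p @ [perm_braid n b]"
        using sm(2) by (simp add: p_def state_word_def Cons m)
      then have "p \<in> lists (gens n)" using w by simp
      then have "letters_of n b @ letters_of n c =
          letters_of n (asymp_op n b c) @ letters_of n (bowtie_op n b c)"
        using irreducible_no_rule[of n p _ "[]", OF _ _ _ GS_mult[OF b(1) 2(1)]] snoc.prems(2) 2 b
        by (simp add: wp letters_of_def)
      then have "perm_braid n (asymp_op n b c) = perm_braid n b \<and> perm_braid n (bowtie_op n b c) =
          perm_braid n c"
        using b 2 unfolding letters_of_def by (auto split: if_splits)
      then have "asymp_op n b c = b" "bowtie_op n b c = c"
        using perm_braid_inj[OF asymp_properties(1)[OF b(1) 2(1)] b(1)]
          perm_braid_inj[OF bowtie_perm[OF b(1) 2(1)] 2(1)] by blast+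
      then show ?thesis
        using sm(3) by (simp add: Cons)
    qed
    then have "act n c (s, 0) = (c # s, 0)"
      by (simp add: act_def twists_simps)
    then have "run n (w @ [B]) initial_state = (c # s, 0)"
      using run run_perm_braid[OF n 2(1), of "(s, m)"] by (simp add: 2(3) m)
    moreover have "state_word n (c # s, 0) = w @ [B]"
      using sm(2) by (simp add: state_word_def 2(3) m)
    ultimately show ?thesis
      using \<open>push n c s = c # s\<close> by blast
  qed
qed

lemma gstep_confluent:
  assumes n: "n \<ge> 2"
  shows "confluentp (gstep n)"
proof (rule confluent_if_unique_normal_form[where P = "\<lambda>w. w \<in> lists (gens n)" and f = "\<lambda>w. run n
    w initial_state"])
  show "wfp (gstep n)\<inverse>\<inverse>" by (rule gstep_terminates[OF n])
  show "x \<in> lists (gens n)" if "gstep n x y" for x y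
    by (rule run_step(1)[OF n that])
  show "y \<in> lists (gens n) \<and> run n x initial_state = run n y initial_state" if "gstep n x y" for x y
    using run_step(2,3)[OF n that] by simp
  show "x = y" if "x \<in> lists (gens n)" "y \<in> lists (gens n)" "\<forall>z. \<not> gstep n x z" "\<forall>z. \<not> gstep n y z"
    "run n x initial_state = run n y initial_state" for x y
    using irreducible_run[OF n that(1,3)] irreducible_run[OF n that(2,4)] that(5) by auto
qed

section \<open>The basis\<close>

theorem theorem3p3:
  fixes n :: nat
  assumes "n \<ge> 2"
  shows "groebner_shirshov_basis (Br n) (gens n) (deglex_less n) (GS_relations n)"
proof -
  have "proper_rules (GS_relations n) \<subseteq> lists (gens n) \<times> lists (gens n)"
    using GS_in_lists[OF assms] unfolding proper_rules_def by blast
  then have "compositions_resolvable (gens n) (proper_rules (GS_relations n))"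
    using compositions_resolvable_if_confluent gstep_confluent[OF assms] by blast
  then show ?thesis
    unfolding groebner_shirshov_basis_def
    using GS_defining_relations[OF assms] proper_rule_deglex[OF assms] gstep_terminates[OF assms]
      gstep_confluent[OF assms] by blast
qed

end
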